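(* For any graph $G$, we have $\mathrm{egd}(G)\le 2$ if and only if $G$ has no minor isomorphic to $F_3$ and no minor isomorphic to $H_3$.
   Context: All graphs are finite and simple. Notation: $[n]=\{1,\dots,n\}$; $X\succeq 0$ means $X$ is a real symmetric positive semidefinite matrix. Extreme Gram dimension: for a graph $G=([n],E)$, $\mathrm{egd}(G)$ is the smallest integer $r\ge 1$ such that for every $w\in\mathbb{R}^E$ the semidefinite program $\max\ \sum_{ij\in E}w_{ij}X_{ij}$ subject to $X_{ii}=1$ $(i\in[n])$, $X\succeq 0$ ($X$ an $n\times n$ symmetric matrix) has an optimal solution of rank at most $r$. A graph $M$ is a minor of $G$ if it can be obtained from $G$ by a series of edge deletions, edge contractions and node deletions. The graph $F_3$ has 6 nodes $v_1,v_2,v_3,v_{12},v_{13},v_{23}$; its edges are the three edges of the triangle on $\{v_1,v_2,v_3\}$ together with the edges $\{v_i,v_{ij}\}$ and $\{v_j,v_{ij}\}$ for $1\le i<j\le 3$. The graph $H_3$ is obtained from the complete graph $K_4$ on nodes $v_1,v_2,v_3,v_{13}$ by subdividing the edge $\{v_1,v_2\}$ with a new node $v_{12}$ and the edge $\{v_2,v_3\}$ with a new node $v_{23}$. Thus its edges are $\{v_1,v_{12}\},\{v_{12},v_2\},\{v_2,v_{23}\},\{v_{23},v_3\},\{v_1,v_3\},\{v_1,v_{13}\},\{v_2,v_{13}\},\{v_3,v_{13}\}$. *)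

theory Defs
  imports "HOL-Analysis.Analysis"
begin

type_synonym 'a graph = "'a set \<times> 'a set set"

definition simple_graph :: "'a graph \<Rightarrow> bool" where
  "simple_graph G \<longleftrightarrow> finite (fst G) \<and> (\<forall>e\<in>snd G. e \<subseteq> fst G \<and> card e = 2)"

definition graph_iso :: "'a graph \<Rightarrow> 'b graph \<Rightarrow> bool" where
  "graph_iso G H \<longleftrightarrow>
     (\<exists>f. bij_betw f (fst G) (fst H) \<and> (\<lambda>e. f ` e) ` snd G = snd H)"

(* Contracting the edge {u, v} merges v into u.  The loop {u, v} is dropped, and parallel edges
   are identified because the edges form a set, so the result is again simple. *)
definition contract_edge :: "'a \<Rightarrow> 'a \<Rightarrow> 'a graph \<Rightarrow> 'a graph" where
  "contract_edge u v G =
     (fst G - {v}, (\<lambda>e. (\<lambda>x. if x = v then u else x) ` e) ` (snd G - {{u, v}}))"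

(* minor_of G M: the graph M is obtained from G by a series of the three operations. *)
inductive minor_of :: "'a graph \<Rightarrow> 'a graph \<Rightarrow> bool" for G where
  refl: "minor_of G G"
| delete_edge: "minor_of G M \<Longrightarrow> e \<in> snd M \<Longrightarrow> minor_of G (fst M, snd M - {e})"
| contract: "minor_of G M \<Longrightarrow> {u, v} \<in> snd M \<Longrightarrow> minor_of G (contract_edge u v M)"
| delete_node: "minor_of G M \<Longrightarrow> v \<in> fst M \<Longrightarrow>
    minor_of G (fst M - {v}, {e \<in> snd M. v \<notin> e})"

definition has_minor_iso :: "'a graph \<Rightarrow> 'b graph \<Rightarrow> bool" where
  "has_minor_iso G H \<longleftrightarrow> (\<exists>M. minor_of G M \<and> graph_iso M H)"

datatype node = V1 | V2 | V3 | V12 | V13 | V23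

definition F3 :: "node graph" where
  "F3 = ({V1, V2, V3, V12, V13, V23},
     {{V1, V2}, {V1, V3}, {V2, V3},
      {V1, V12}, {V2, V12}, {V1, V13}, {V3, V13}, {V2, V23}, {V3, V23}})"

definition H3 :: "node graph" where
  "H3 = ({V1, V2, V3, V12, V13, V23},
     {{V1, V12}, {V12, V2}, {V2, V23}, {V23, V3},
      {V1, V3}, {V1, V13}, {V2, V13}, {V3, V13}})"

definition psd :: "real^'n^'n \<Rightarrow> bool" where
  "psd X \<longleftrightarrow> transpose X = X \<and> (\<forall>x. 0 \<le> x \<bullet> (X *v x))"

definition sdp_feasible :: "real^'n^'n \<Rightarrow> bool" where
  "sdp_feasible X \<longleftrightarrow> psd X \<and> (\<forall>i. X $ i $ i = 1)"

(* The sum runs over ordered pairs, so each edge is met twice (X is symmetric);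
   the factor 1/2 makes every edge count once. *)
definition sdp_objective :: "'n set set \<Rightarrow> ('n set \<Rightarrow> real) \<Rightarrow> real^'n^'n \<Rightarrow> real" where
  "sdp_objective E w X = (\<Sum>(i, j) \<in> {(i, j). {i, j} \<in> E}. w {i, j} * X $ i $ j) / 2"

definition sdp_optimal :: "'n set set \<Rightarrow> ('n set \<Rightarrow> real) \<Rightarrow> real^'n^'n \<Rightarrow> bool" where
  "sdp_optimal E w X \<longleftrightarrow> sdp_feasible X \<and>
     (\<forall>Y. sdp_feasible Y \<longrightarrow> sdp_objective E w Y \<le> sdp_objective E w X)"

(* Extreme Gram dimension of the graph (UNIV, E): the vertex set [n] is the finite index type.
   Values of w outside E are irrelevant to the objective. *)
definition egd :: "'n::finite set set \<Rightarrow> nat" where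
  "egd E = (LEAST r. r \<ge> 1 \<and> (\<forall>w. \<exists>X :: real^'n^'n. sdp_optimal E w X \<and> rank X \<le> r))"

end

theory Submission
  imports Defs
begin

text \<open> A positive semidefinite matrix with unit diagonal is the Gram matrix of unit vectors, one
per vertex, and its rank is the dimension that they span.  Call an edge set \<^emph>\<open>flattenable\<close> if, for
every choice of edge weights, no unit vectors in any dimension give a larger weighted sum of inner
products over the edges (their \<^emph>\<open>energy\<close>) than suitable unit vectors in the plane.  Then extreme
Gram dimension at most two means flattenable (\<open>egd_le_2_iff_flattenable\<close>), and the planar vectors
can be taken to be complex numbers.

\<^bold>\<open>The excluded minors are necessary.\<close>  Flattenability passes to minors: a deleted edge just loses
its weight, and contracting an edge is the limit of giving it a huge weight (\<open>tight_edge\<close>,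
\<open>flattenable_contract\<close>).  For F3 and H3 there are weights for which the energy is a constant minus
a sum of squares that vanishes only if the vectors at \<open>v1\<close>, \<open>v2\<close>, \<open>v3\<close> are orthonormal.  This is
possible in space but not in the plane (\<open>F3_not_flattenable\<close>, \<open>H3_not_flattenable\<close>).

\<^bold>\<open>They are sufficient\<close> (\<open>flattenable_if_minor_free\<close>), by induction on the size of the graph. At a
cut vertex one planar side is rotated to match the other.  At a cut \<open>{a, b}\<close> with at least two
vertices on either side, both sides need planar configurations with the same, prescribed inner
product at \<open>a\<close>, \<open>b\<close>.  A triangle put on top of \<open>{a, b}\<close> enforces it: the optimum of the side, as a
function of the inner product, is concave, so weights on the triangle can be chosen that balance
its slope and make the prescribed value the only possible one (\<open>rigid_pair_by_path\<close>,
\<open>supergradient_exists\<close>, \<open>rigid_pair_by_triangle\<close>).  The other side of the cut contains such a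
triangle as a minor, so that the induction hypothesis applies, unless the graph has two adjacent
vertices of degree two (\<open>rooted_triangle_or_adjacent_degree_two\<close>).  In that case the optimal path
through them is coplanar and itself acts as the enforcing gadget
(\<open>flattenable_adjacent_degree_two\<close>).

What remains are graphs on at most five vertices, and graphs in which a cut of at most two
vertices splits off at most a single vertex.  If the latter have at least six vertices and neither
minor, they are \<open>K\<^sub>3\<^sub>,\<^sub>3\<close> or consist of four vertices and two further vertices of degree two
attached to disjoint pairs of them (\<open>nearly_three_connected_classification\<close>); this is proved by
contracting edges without losing the connectivity.  For all these graphs the dimension of an
optimal configuration can be lowered as long as it is at least three: if a quadratic form vanishes
at all vectors of the configuration but not identically, then moving the Gram matrix along it
keeps the unit diagonal and the optimal energy, until a dimension is lost
(\<open>lower_dimension_by_perturbation\<close>).  Such a form exists by counting for five vectors, from the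
equilibrium of forces for \<open>K\<^sub>3\<^sub>,\<^sub>3\<close>, and as a pair of planes for the other family
(\<open>conic_through_few_points\<close>, \<open>flattenable_K33\<close>, \<open>flattenable_two_triangle_caps\<close>). \<close>

section \<open>Unit configurations and their energy\<close>

definition unit_config :: "('a \<Rightarrow> 'e::real_normed_vector) \<Rightarrow> bool" where
  "unit_config p \<longleftrightarrow> (\<forall>v. norm (p v) = 1)"

text \<open>The sum runs over ordered pairs, so an edge counts twice.  The weight is a function on all
sets of vertices; which of them are edges is expressed by \<open>supported\<close> below.\<close>
definition energy :: "('a::finite set \<Rightarrow> real) \<Rightarrow> ('a \<Rightarrow> 'e::real_inner) \<Rightarrow> real" where
  "energy w p = (\<Sum>i\<in>UNIV. \<Sum>j\<in>UNIV. w {i, j} * (p i \<bullet> p j))"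

definition supported :: "('a set \<Rightarrow> real) \<Rightarrow> 'a set set \<Rightarrow> bool" where
  "supported w E \<longleftrightarrow> (\<forall>e. e \<notin> E \<longrightarrow> w e = 0)"

text \<open>The space \<open>real^'a\<close> has one dimension per vertex, which is room for the vectors of every
Gram matrix on the vertices, so it stands for all dimensions.\<close>
definition flattenable :: "'a::finite set set \<Rightarrow> bool" where
  "flattenable E \<longleftrightarrow> (\<forall>w (p :: 'a \<Rightarrow> real^'a). supported w E \<longrightarrow> unit_config p \<longrightarrow>
     (\<exists>q :: 'a \<Rightarrow> complex. unit_config q \<and> energy w p \<le> energy w q))"

lemma unit_config_inner_self: "unit_config p \<Longrightarrow> p v \<bullet> p v = (1::real)"
  for p :: "'a \<Rightarrow> 'e::real_inner"
  by (simp add: unit_config_def dot_square_norm)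

lemma inner_unit_bounds:
  fixes p :: "'a \<Rightarrow> 'e::real_inner"
  assumes "unit_config p" shows "\<bar>p i \<bullet> p j\<bar> \<le> 1"
  using Cauchy_Schwarz_ineq2[of "p i" "p j"] assms by (simp add: unit_config_def)

lemma energy_add: "energy (\<lambda>e. w e + w' e) p = energy w p + energy w' p"
  by (simp add: energy_def sum.distrib algebra_simps)

lemma energy_scale: "energy (\<lambda>e. k * w e) p = k * energy w p"
  by (simp add: energy_def sum_distrib_left algebra_simps)

lemma energy_sum: "finite S \<Longrightarrow> energy (\<lambda>e. \<Sum>s\<in>S. w s e) p = (\<Sum>s\<in>S. energy (w s) p)"
proof (induction S rule: finite_induct)
  case empty then show ?case by (simp add: energy_def)
next
  case (insert x F) then show ?case by (simp add: energy_add)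
qed

definition edge_weight :: "'a set \<Rightarrow> 'a set \<Rightarrow> real" where
  "edge_weight e0 e = (if e = e0 then 1 else 0)"

lemma energy_edge_weight:
  assumes "a \<noteq> b" shows "energy (edge_weight {a, b}) p = 2 * (p a \<bullet> p b)"
proof -
  have "edge_weight {a,b} {i,j} * (p i \<bullet> p j)
      = (if i = a then if j = b then p a \<bullet> p b else 0 else 0) +
        (if i = b then if j = a then p a \<bullet> p b else 0 else 0)" for i j
    using assms by (auto simp: edge_weight_def doubleton_eq_iff inner_commute)
  then have "energy (edge_weight {a,b}) p = (\<Sum>i\<in>UNIV. \<Sum>j\<in>UNIV. (if i = a then if j = b then p a \<bullet> p b else 0 else 0) +
        (if i = b then if j = a then p a \<bullet> p b else 0 else 0))"
    by (simp only: energy_def)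
  also have "\<dots> = (\<Sum>i\<in>UNIV. (if i = a then p a \<bullet> p b else 0) + (if i = b then p a \<bullet> p b else 0))"
    by (intro sum.cong refl) (auto simp: sum.distrib)
  also have "\<dots> = 2 * (p a \<bullet> p b)" by (simp add: sum.distrib)
  finally show ?thesis .
qed

lemma energy_edge_sum: "energy w p = (\<Sum>e\<in>UNIV. w e * energy (edge_weight e) p)"
proof -
  have "w = (\<lambda>e. \<Sum>s\<in>UNIV. w s * edge_weight s e)"
    by (rule ext) (simp add: edge_weight_def if_distrib cong: if_cong)
  then have "energy w p = energy (\<lambda>e. \<Sum>s\<in>UNIV. w s * edge_weight s e) p" by simp
  also have "\<dots> = (\<Sum>e\<in>UNIV. energy (\<lambda>x. w e * edge_weight e x) p)" by (rule energy_sum) simp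
  finally show ?thesis by (simp add: energy_scale)
qed

lemma energy_cong:
  assumes "\<And>i j. w {i,j} \<noteq> 0 \<Longrightarrow> p i \<bullet> p j = q i \<bullet> q j"
  shows "energy w p = energy w q"
proof -
  have "w {i,j} * (p i \<bullet> p j) = w {i,j} * (q i \<bullet> q j)" for i j
    using assms[of i j] by (cases "w {i,j} = 0") auto
  then show ?thesis unfolding energy_def by presburger
qed

lemma energy_bound:
  fixes p :: "'a::finite \<Rightarrow> 'e::real_inner"
  assumes "unit_config p"
  shows "\<bar>energy w p\<bar> \<le> (\<Sum>i\<in>UNIV. \<Sum>j\<in>UNIV. \<bar>w {i, j}\<bar>)"
proof -
  have "\<bar>energy w p\<bar> \<le> (\<Sum>i\<in>UNIV. \<bar>\<Sum>j\<in>UNIV. w {i, j} * (p i \<bullet> p j)\<bar>)"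
    unfolding energy_def by (rule sum_abs)
  also have "\<dots> \<le> (\<Sum>i\<in>UNIV. \<Sum>j\<in>UNIV. \<bar>w {i, j} * (p i \<bullet> p j)\<bar>)"
    by (intro sum_mono sum_abs)
  also have "\<dots> \<le> (\<Sum>i\<in>UNIV. \<Sum>j\<in>UNIV. \<bar>w {i, j}\<bar>)"
    by (intro sum_mono) (simp add: abs_mult mult_left_le inner_unit_bounds[OF assms])
  finally show ?thesis .
qed

lemma supported_mono: "supported w E \<Longrightarrow> E \<subseteq> F \<Longrightarrow> supported w F"
  by (auto simp: supported_def)

lemma flattenable_mono: "flattenable F \<Longrightarrow> E \<subseteq> F \<Longrightarrow> flattenable E"
  unfolding flattenable_def using supported_mono by blast

lemma supported_add: "supported w E \<Longrightarrow> supported w' E \<Longrightarrow> supported (\<lambda>e. w e + w' e) E"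
  by (auto simp: supported_def)

lemma supported_edge_weight: "e \<in> E \<Longrightarrow> supported (\<lambda>x. k * edge_weight e x) E"
  by (auto simp: supported_def edge_weight_def)

lemma continuous_energy: "continuous_on S (\<lambda>p :: 'a::finite \<Rightarrow> 'e::euclidean_space. energy w p)"
proof -
  have "continuous_on S (\<lambda>p :: 'a \<Rightarrow> 'e. p i)" for i
    by (rule continuous_on_subset[OF continuous_on_product_coordinates subset_UNIV])
  then show ?thesis unfolding energy_def by (intro continuous_intros)
qed

lemma compact_unit_config: "compact {p :: 'a::finite \<Rightarrow> 'e::euclidean_space. unit_config p}"
proof -
  have "compactin (product_topology (\<lambda>_. euclidean) UNIV) (PiE UNIV (\<lambda>_::'a. sphere (0::'e) 1))"
    by (subst compactin_PiE) auto
  moreover have "PiE UNIV (\<lambda>_::'a. sphere (0::'e) 1) = {p. unit_config p}"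
    by (auto simp: unit_config_def PiE_def Pi_def)
  ultimately show ?thesis by (simp add: euclidean_product_topology)
qed

text \<open>Unit configurations form a compact set and the energy is continuous.\<close>
lemma optimal_config_exists:
  fixes S :: "('a::finite \<Rightarrow> 'e::euclidean_space) set"
  assumes "closed S" "p0 \<in> S" "unit_config p0"
  obtains p where "p \<in> S" "unit_config p" "\<And>p'. p' \<in> S \<Longrightarrow> unit_config p' \<Longrightarrow> energy w p' \<le> energy w p"
proof -
  have c: "compact ({p. unit_config p} \<inter> S)" using compact_unit_config assms(1) by blast
  have "{p. unit_config p} \<inter> S \<noteq> {}" using assms by blast
  from continuous_attains_sup[OF c this continuous_energy[of _ w]]
  show ?thesis using that by blast
qed

lemma closed_inner_level: "closed {p :: 'a::finite \<Rightarrow> 'e::euclidean_space. p a \<bullet> p b = c}"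
proof -
  have "continuous_on UNIV (\<lambda>p :: 'a \<Rightarrow> 'e. p i)" for i
    by (rule continuous_on_product_coordinates)
  then have "continuous_on UNIV (\<lambda>p :: 'a \<Rightarrow> 'e. p a \<bullet> p b)" by (intro continuous_intros)
  then show ?thesis by (intro closed_Collect_eq continuous_on_const)
qed

lemma quad_update:
  fixes K :: "'a::finite \<Rightarrow> 'a \<Rightarrow> real"
  assumes sym: "\<And>i j. K i j = K j i"
  shows "(\<Sum>i\<in>UNIV. \<Sum>j\<in>UNIV. (c i + (if i = v then l else 0)) * (c j + (if j = v then l else 0)) * K i j)
   = (\<Sum>i\<in>UNIV. \<Sum>j\<in>UNIV. c i * c j * K i j) + 2 * l * (\<Sum>j\<in>UNIV. c j * K v j) + l\<^sup>2 * K v v"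
proof -
  let ?d = "\<lambda>i. (if i = v then l else 0)"
  have "(\<Sum>i\<in>UNIV. \<Sum>j\<in>UNIV. (c i + ?d i) * (c j + ?d j) * K i j)
    = (\<Sum>i\<in>UNIV. \<Sum>j\<in>UNIV. c i * c j * K i j) + (\<Sum>i\<in>UNIV. \<Sum>j\<in>UNIV. ?d i * (c j * K i j))
     + (\<Sum>i\<in>UNIV. \<Sum>j\<in>UNIV. ?d j * (c i * K i j)) + (\<Sum>i\<in>UNIV. \<Sum>j\<in>UNIV. ?d i * (?d j * K i j))"
    by (simp only: sum.distrib[symmetric] distrib_left distrib_right) (intro sum.cong, simp_all add: algebra_simps)
  also have "(\<Sum>i\<in>UNIV. \<Sum>j\<in>UNIV. ?d i * (c j * K i j)) = l * (\<Sum>j\<in>UNIV. c j * K v j)"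
  proof -
    have "(\<Sum>j\<in>UNIV. ?d i * (c j * K i j)) = (if i = v then l * (\<Sum>j\<in>UNIV. c j * K v j) else 0)" for i
      by (simp add: sum_distrib_left)
    then show ?thesis by simp
  qed
  also have "(\<Sum>i\<in>UNIV. \<Sum>j\<in>UNIV. ?d j * (c i * K i j)) = l * (\<Sum>j\<in>UNIV. c j * K v j)"
    using sym by (simp add: if_distrib[of "\<lambda>x. x * _"] sum_distrib_left cong: if_cong)
  also have "(\<Sum>i\<in>UNIV. \<Sum>j\<in>UNIV. ?d i * (?d j * K i j)) = l\<^sup>2 * K v v"
  proof -
    have "(\<Sum>j\<in>UNIV. ?d i * (?d j * K i j)) = (if i = v then l\<^sup>2 * K v v else 0)" for i
      by (cases "i = v") (simp_all add: if_distrib[of "\<lambda>x. x * _"] if_distrib[of "\<lambda>x. _ * x"] power2_eq_square cong: if_cong)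
    then show ?thesis by simp
  qed
  finally show ?thesis by simp
qed

text \<open>Cholesky factorization, one index at a time.  The coordinates outside \<open>S\<close> stay zero, so that
the coordinate \<open>v\<close> is still free when the index \<open>v\<close> is reinstated.\<close>
lemma gram_factorization_aux:
  fixes K :: "'a::finite \<Rightarrow> 'a \<Rightarrow> real"
  assumes "finite S" "\<And>i j. K i j = K j i"
    "\<And>c. 0 \<le> (\<Sum>i\<in>UNIV. \<Sum>j\<in>UNIV. c i * c j * K i j)"
    "\<And>i j. i \<notin> S \<Longrightarrow> K i j = 0"
  shows "\<exists>f :: 'a \<Rightarrow> real^'a. (\<forall>i j. f i \<bullet> f j = K i j) \<and> (\<forall>i k. k \<notin> S \<longrightarrow> f i $ k = 0)"
  using assms
proof (induction S arbitrary: K rule: finite_induct)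
  case empty
  then show ?case by (intro exI[of _ "\<lambda>_. 0"]) auto
next
  case (insert v S)
  note sym = insert.prems(1) and psd = insert.prems(2) and supp = insert.prems(3)
  have upd: "0 \<le> (\<Sum>i\<in>UNIV. \<Sum>j\<in>UNIV. c i * c j * K i j) + 2 * l * (\<Sum>j\<in>UNIV. c j * K v j) + l\<^sup>2 * K v v" for c l
    using psd[of "\<lambda>i. c i + (if i = v then l else 0)"] quad_update[of K c v l] sym by simp
  have unit: "(\<Sum>i\<in>UNIV. \<Sum>j\<in>UNIV. (if i = u then 1 else 0) * (if j = u then 1 else 0) * K i j) = K u u"
    "(\<Sum>j\<in>UNIV. (if j = u then 1 else 0) * K v j) = K v u" for u
  proof -
    have "(\<Sum>j\<in>UNIV. (if i = u then 1 else 0) * (if j = u then 1 else 0) * K i j) = (if i = u then K u u else 0)" for i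
      by (cases "i = u") (simp_all add: if_distrib[of "\<lambda>x. x * _"] cong: if_cong)
    then show "(\<Sum>i\<in>UNIV. \<Sum>j\<in>UNIV. (if i = u then 1 else 0) * (if j = u then 1 else 0) * K i j) = K u u"
      by simp
    show "(\<Sum>j\<in>UNIV. (if j = u then 1 else 0) * K v j) = K v u"
      by (simp add: if_distrib[of "\<lambda>x. x * _"] cong: if_cong)
  qed
  have nonneg: "0 \<le> K u u" for u
    using psd[of "\<lambda>i. if i = u then 1 else 0"] unit(1)[of u] by simp
  show ?case
  proof (cases "K v v = 0")
    case True
    \<comment> \<open>a vanishing diagonal entry of a semidefinite matrix makes the whole row vanish\<close>
    have "K v u = 0" for u
    proof (rule ccontr)
      assume ne: "K v u \<noteq> 0"
      have "0 \<le> K u u + 2 * l * K v u" for l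
        using upd[of "\<lambda>i. if i = u then 1 else 0" l] unit[of u] True by simp
      from this[of "- (K u u + 1) / (2 * K v u)"] show False using ne by (simp add: field_simps)
    qed
    then have "\<And>i j. i \<notin> S \<Longrightarrow> K i j = 0" using supp by (metis insert_iff)
    from insert.IH[OF sym psd this] show ?thesis by blast
  next
    case False
    then have pos: "0 < K v v" using nonneg[of v] by simp
    \<comment> \<open>the Schur complement, which no longer involves the index \<open>v\<close>\<close>
    define K' where "K' i j = K i j - K i v * K j v / K v v" for i j
    have "0 \<le> (\<Sum>i\<in>UNIV. \<Sum>j\<in>UNIV. c i * c j * K' i j)" for c
    proof -
      define m where "m = (\<Sum>j\<in>UNIV. c j * K v j)"
      have m': "m = (\<Sum>j\<in>UNIV. c j * K j v)" unfolding m_def using sym by metis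
      have "(\<Sum>i\<in>UNIV. \<Sum>j\<in>UNIV. c i * c j * K' i j)
         = (\<Sum>i\<in>UNIV. \<Sum>j\<in>UNIV. c i * c j * K i j) - (\<Sum>i\<in>UNIV. \<Sum>j\<in>UNIV. (c i * K i v) * (c j * K j v)) / K v v"
        unfolding K'_def by (simp only: sum_divide_distrib sum_subtractf[symmetric])
          (intro sum.cong, simp_all add: field_simps)
      also have "(\<Sum>i\<in>UNIV. \<Sum>j\<in>UNIV. (c i * K i v) * (c j * K j v)) = m\<^sup>2"
        by (simp add: m' power2_eq_square sum_product)
      finally have "(\<Sum>i\<in>UNIV. \<Sum>j\<in>UNIV. c i * c j * K' i j) = (\<Sum>i\<in>UNIV. \<Sum>j\<in>UNIV. c i * c j * K i j) - m\<^sup>2 / K v v" .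
      moreover have "0 \<le> (\<Sum>i\<in>UNIV. \<Sum>j\<in>UNIV. c i * c j * K i j) + 2 * (- m / K v v) * m + (- m / K v v)\<^sup>2 * K v v"
        using upd[of c "- m / K v v"] by (simp add: m_def)
      moreover have "2 * (- m / K v v) * m + (- m / K v v)\<^sup>2 * K v v = - (m\<^sup>2 / K v v)"
        using pos by (simp add: power2_eq_square field_simps)
      ultimately show ?thesis by linarith
    qed
    moreover have "K' i j = K' j i" for i j using sym by (simp add: K'_def mult.commute)
    moreover have "K' i j = 0" if "i \<notin> S" for i j
    proof (cases "i = v")
      case True then show ?thesis using pos sym by (simp add: K'_def)
    next
      case False then show ?thesis using that supp by (simp add: K'_def)
    qed
    ultimately obtain f where f: "\<And>i j. f i \<bullet> f j = K' i j" "\<And>i k. k \<notin> S \<Longrightarrow> (f i :: real^'a) $ k = 0"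
      using insert.IH[of K'] by blast
    define g where "g i = f i + (K i v / sqrt (K v v)) *\<^sub>R axis v 1" for i
    have "g i \<bullet> g j = K i j" for i j
      using f(2)[OF insert.hyps(2)] pos
      by (simp add: g_def inner_add_left inner_add_right inner_axis inner_axis' f(1) K'_def inner_axis_axis)
    moreover have "g i $ k = 0" if "k \<notin> insert v S" for i k
      using that f(2) by (simp add: g_def axis_def)
    ultimately show ?thesis by blast
  qed
qed

lemma gram_factorization:
  fixes K :: "'a::finite \<Rightarrow> 'a \<Rightarrow> real"
  assumes "\<And>i j. K i j = K j i"
    "\<And>c. 0 \<le> (\<Sum>i\<in>UNIV. \<Sum>j\<in>UNIV. c i * c j * K i j)"
  obtains f :: "'a \<Rightarrow> real^'a" where "\<And>i j. f i \<bullet> f j = K i j"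
proof -
  have "\<exists>f :: 'a \<Rightarrow> real^'a. (\<forall>i j. f i \<bullet> f j = K i j) \<and> (\<forall>i k. k \<notin> UNIV \<longrightarrow> f i $ k = 0)"
    by (rule gram_factorization_aux) (use assms in auto)
  then show ?thesis using that by blast
qed

lemma gram_quadratic:
  fixes f :: "'a::finite \<Rightarrow> 'e::real_inner"
  shows "(\<Sum>i\<in>UNIV. \<Sum>j\<in>UNIV. c i * c j * (f i \<bullet> f j)) = (norm (\<Sum>i\<in>UNIV. c i *\<^sub>R f i))\<^sup>2"
  unfolding power2_norm_eq_inner inner_sum_left unfolding inner_sum_right
  by (simp add: ac_simps)

text \<open>Gram matrices form a convex set: this is where the ambient dimension must not be restricted,
since the combination may need more dimensions than either configuration.\<close>
lemma convex_combination_config: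
  fixes p :: "'a::finite \<Rightarrow> 'e::real_inner" and p' :: "'a \<Rightarrow> 'f::real_inner"
  assumes "0 \<le> t" "t \<le> 1"
  obtains f :: "'a \<Rightarrow> real^'a" where "\<And>i j. f i \<bullet> f j = (1 - t) * (p i \<bullet> p j) + t * (p' i \<bullet> p' j)"
proof -
  define K where "K i j = (1 - t) * (p i \<bullet> p j) + t * (p' i \<bullet> p' j)" for i j
  have "(\<Sum>i\<in>UNIV. \<Sum>j\<in>UNIV. c i * c j * K i j) = (1 - t) * (\<Sum>i\<in>UNIV. \<Sum>j\<in>UNIV. c i * c j * (p i \<bullet> p j))
     + t * (\<Sum>i\<in>UNIV. \<Sum>j\<in>UNIV. c i * c j * (p' i \<bullet> p' j))" for c
    unfolding K_def sum_distrib_left sum.distrib[symmetric] by (intro sum.cong) (simp_all add: algebra_simps)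
  then have "0 \<le> (\<Sum>i\<in>UNIV. \<Sum>j\<in>UNIV. c i * c j * K i j)" for c
    using assms by (simp add: gram_quadratic)
  moreover have "K i j = K j i" for i j by (simp add: K_def inner_commute)
  ultimately show ?thesis using gram_factorization[of K] that unfolding K_def by blast
qed

section \<open>Gluing planar configurations\<close>

lemma plane_to_complex:
  fixes S :: "'e::euclidean_space set"
  assumes "dim S \<le> 2"
  obtains f :: "'e \<Rightarrow> complex" where "\<And>x y. x \<in> S \<Longrightarrow> y \<in> S \<Longrightarrow> f x \<bullet> f y = x \<bullet> y"
proof -
  have "dim (span S) \<le> dim (UNIV :: complex set)" using assms by simp
  then obtain f :: "'e \<Rightarrow> complex" where f: "linear f" "\<And>x. x \<in> span S \<Longrightarrow> norm (f x) = norm x"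
    using isometry_subset_subspace[OF subspace_span subspace_UNIV] by blast
  have "f x \<bullet> f y = x \<bullet> y" if "x \<in> S" "y \<in> S" for x y
  proof -
    have "x \<in> span S" "y \<in> span S" "x + y \<in> span S" using that by (auto simp: span_base span_add)
    then show ?thesis using f by (simp add: dot_norm linear_add[symmetric])
  qed
  then show ?thesis using that by blast
qed

lemma complex_to_vec:
  fixes a b :: "'a::finite"
  assumes "a \<noteq> b"
  obtains f :: "complex \<Rightarrow> real^'a" where "\<And>z w. f z \<bullet> f w = z \<bullet> w"
proof
  show "(Re z *\<^sub>R axis a 1 + Im z *\<^sub>R axis b 1) \<bullet> (Re w *\<^sub>R axis a 1 + Im w *\<^sub>R axis b (1::real) :: real^'a) = z \<bullet> w"
    for z w
    using assms by (simp add: inner_add_left inner_add_right inner_axis_axis inner_complex_def)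
qed

lemma inner_complex_mult_left: "(u * x) \<bullet> (u * y) = (norm u)\<^sup>2 * (x \<bullet> y)" for u x y :: complex
  unfolding cmod_power2 inner_complex_def by (simp add: power2_eq_square algebra_simps)

text \<open>Two unit vectors in the plane are determined by their inner product up to a rotation and,
for one of the two signs of the angle, a reflection.\<close>
lemma isometry_aligning_pairs:
  fixes z1 z2 w1 w2 :: complex
  assumes n: "norm z1 = 1" "norm z2 = 1" "norm w1 = 1" "norm w2 = 1" and eq: "z1 \<bullet> z2 = w1 \<bullet> w2"
  obtains T :: "complex \<Rightarrow> complex" where "\<And>x y. T x \<bullet> T y = x \<bullet> y" "T z1 = w1" "T z2 = w2"
proof -
  have Re: "Re (z / z') = z' \<bullet> z" if "norm z' = 1" for z z' :: complex
  proof -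
    have "(Re z')\<^sup>2 + (Im z')\<^sup>2 = 1" using that cmod_power2[of z'] by simp
    then show ?thesis by (simp add: Re_divide inner_complex_def mult.commute)
  qed
  have iso: "(w1 * (x / z1)) \<bullet> (w1 * (y / z1)) = x \<bullet> y" for x y
    using inner_complex_mult_left[of "w1 / z1" x y] n by (simp add: norm_divide)
  have nz: "z1 \<noteq> 0" "w1 \<noteq> 0" using n by auto
  have re: "Re (z2 / z1) = Re (w2 / w1)" using Re n eq by simp
  have "norm (z2 / z1) = 1" "norm (w2 / w1) = 1" using n by (simp_all add: norm_divide)
  then have "(Re (z2 / z1))\<^sup>2 + (Im (z2 / z1))\<^sup>2 = (Re (w2 / w1))\<^sup>2 + (Im (w2 / w1))\<^sup>2"
    by (simp only: cmod_power2[symmetric])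
  then have "(Im (z2 / z1))\<^sup>2 = (Im (w2 / w1))\<^sup>2" unfolding re by (rule add_left_imp_eq)
  then consider "Im (z2 / z1) = Im (w2 / w1)" | "Im (z2 / z1) = - Im (w2 / w1)" by (auto simp: power2_eq_iff)
  then show ?thesis
  proof cases
    case 1
    then have "z2 / z1 = w2 / w1" using re complex_eqI by blast
    then show ?thesis using that[of "\<lambda>x. w1 * (x / z1)"] iso nz by auto
  next
    case 2
    then have "cnj (z2 / z1) = w2 / w1" using re by (intro complex_eqI) (simp_all del: complex_cnj_divide)
    then have "w1 * cnj (z2 / z1) = w2" using nz by simp
    moreover have "(w1 * cnj (x / z1)) \<bullet> (w1 * cnj (y / z1)) = x \<bullet> y" for x y
    proof -
      have "cnj u \<bullet> cnj v = u \<bullet> v" for u v by (simp add: inner_complex_def)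
      then show ?thesis using iso[of x y] by (simp only: inner_complex_mult_left)
    qed
    moreover have "w1 * cnj (z1 / z1) = w1" using nz by simp
    ultimately show ?thesis using that[of "\<lambda>x. w1 * cnj (x / z1)"] by blast
  qed
qed

definition restrict_weight :: "('a set \<Rightarrow> real) \<Rightarrow> 'a set set \<Rightarrow> 'a set \<Rightarrow> real" where
  "restrict_weight w E e = (if e \<in> E then w e else 0)"

lemma supported_restrict_weight: "supported (restrict_weight w E) E"
  by (simp add: supported_def restrict_weight_def)

lemma energy_split:
  assumes "supported w (E1 \<union> E2)"
  shows "energy w p = energy (restrict_weight w E1) p + energy (restrict_weight w (E2 - E1)) p"
proof -
  have "w = (\<lambda>e. restrict_weight w E1 e + restrict_weight w (E2 - E1) e)"
    using assms by (auto simp: restrict_weight_def supported_def)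
  then show ?thesis using energy_add[of "restrict_weight w E1" "restrict_weight w (E2 - E1)" p] by simp
qed

lemma energy_glue:
  fixes q1 q2 :: "'a::finite \<Rightarrow> 'e::real_inner"
  assumes "supported w (E1 \<union> E2)" "\<And>e. e \<in> E1 \<Longrightarrow> e \<subseteq> U1" "\<And>e. e \<in> E2 \<Longrightarrow> e \<subseteq> U2"
    "\<And>v. v \<in> U1 \<inter> U2 \<Longrightarrow> q1 v = q2 v"
  shows "energy w (\<lambda>v. if v \<in> U1 then q1 v else q2 v)
       = energy (restrict_weight w E1) q1 + energy (restrict_weight w (E2 - E1)) q2"
proof -
  let ?q = "\<lambda>v. if v \<in> U1 then q1 v else q2 v"
  have "energy (restrict_weight w E1) ?q = energy (restrict_weight w E1) q1"
    by (rule energy_cong) (use assms(2) in \<open>fastforce simp: restrict_weight_def split: if_splits\<close>)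
  moreover have "?q v = q2 v" if "v \<in> U2" for v using that assms(4) by auto
  then have "energy (restrict_weight w (E2 - E1)) ?q = energy (restrict_weight w (E2 - E1)) q2"
    by (intro energy_cong) (use assms(3) in \<open>fastforce simp: restrict_weight_def split: if_splits\<close>)
  ultimately show ?thesis by (simp add: energy_split[OF assms(1)])
qed

text \<open>The second planar configuration is moved by an isometry so that it agrees with the first at
\<open>a\<close> and \<open>b\<close>.  No other vertex is shared.\<close>
lemma glue_along_pair:
  fixes p :: "'a::finite \<Rightarrow> 'e::real_inner" and q1 q2 :: "'a \<Rightarrow> complex"
  assumes "supported w (E1 \<union> E2)" "\<And>e. e \<in> E1 \<Longrightarrow> e \<subseteq> U1" "\<And>e. e \<in> E2 \<Longrightarrow> e \<subseteq> U2" "U1 \<inter> U2 \<subseteq> {a, b}"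
    "unit_config q1" "unit_config q2" "q1 a \<bullet> q1 b = q2 a \<bullet> q2 b"
    "energy (restrict_weight w E1) p \<le> energy (restrict_weight w E1) q1"
    "energy (restrict_weight w (E2 - E1)) p \<le> energy (restrict_weight w (E2 - E1)) q2"
  shows "\<exists>q :: 'a \<Rightarrow> complex. unit_config q \<and> energy w p \<le> energy w q"
proof -
  obtain T :: "complex \<Rightarrow> complex" where T: "\<And>x y. T x \<bullet> T y = x \<bullet> y" "T (q2 a) = q1 a" "T (q2 b) = q1 b"
    using isometry_aligning_pairs[of "q2 a" "q2 b" "q1 a" "q1 b"] assms(5,6,7) by (auto simp: unit_config_def)
  have nT: "norm (T x) = norm x" for x using T(1) by (simp add: norm_eq_sqrt_inner)
  let ?q = "\<lambda>v. if v \<in> U1 then q1 v else (T \<circ> q2) v"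
  have "energy w ?q = energy (restrict_weight w E1) q1 + energy (restrict_weight w (E2 - E1)) (T \<circ> q2)"
    by (rule energy_glue[OF assms(1-3)]) (use assms(4) T in auto)
  also have "energy (restrict_weight w (E2 - E1)) (T \<circ> q2) = energy (restrict_weight w (E2 - E1)) q2"
    by (rule energy_cong) (simp add: T)
  finally have "energy w p \<le> energy w ?q" using assms(8,9) energy_split[OF assms(1), of p] by simp
  moreover have "unit_config ?q" using assms(5,6) nT by (auto simp: unit_config_def)
  ultimately show ?thesis by blast
qed

text \<open>Gluing along a pair with \<open>a = b\<close>: the inner product of \<open>a\<close> with itself is 1 on both sides.\<close>
lemma flattenable_glue_vertex:
  assumes "flattenable E1" "flattenable E2" "\<And>e. e \<in> E1 \<Longrightarrow> e \<subseteq> U1" "\<And>e. e \<in> E2 \<Longrightarrow> e \<subseteq> U2" "U1 \<inter> U2 \<subseteq> {a}"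
  shows "flattenable (E1 \<union> E2)"
  unfolding flattenable_def
proof (intro allI impI)
  fix w and p :: "'a \<Rightarrow> real^'a"
  assume w: "supported w (E1 \<union> E2)" and p: "unit_config p"
  obtain q1 :: "'a \<Rightarrow> complex" where q1: "unit_config q1" "energy (restrict_weight w E1) p \<le> energy (restrict_weight w E1) q1"
    using assms(1) p supported_restrict_weight unfolding flattenable_def by blast
  have "supported (restrict_weight w (E2 - E1)) E2" by (auto simp: supported_def restrict_weight_def)
  then obtain q2 :: "'a \<Rightarrow> complex" where q2: "unit_config q2"
      "energy (restrict_weight w (E2 - E1)) p \<le> energy (restrict_weight w (E2 - E1)) q2"
    using assms(2) p unfolding flattenable_def by blast
  show "\<exists>q :: 'a \<Rightarrow> complex. unit_config q \<and> energy w p \<le> energy w q"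
    by (rule glue_along_pair[OF w assms(3,4) _ q1(1) q2(1) _ q1(2) q2(2), of a a])
      (use assms(5) q1 q2 in \<open>auto simp: unit_config_inner_self\<close>)
qed

text \<open>There is no loop at \<open>v\<close>, hence the energy depends affinely on the vector at \<open>v\<close>, and its
linear part is given by the weighted sum of the neighbouring vectors.\<close>
lemma energy_update:
  fixes p :: "'a::finite \<Rightarrow> 'e::real_inner"
  assumes "w {v} = 0"
  shows "energy w (p(v := z)) = energy w p + 2 * ((z - p v) \<bullet> (\<Sum>j\<in>UNIV. w {v, j} *\<^sub>R p j))"
proof -
  define d where "d = z - p v"
  let ?l = "\<lambda>i j. if i = v then w {v,j} * (d \<bullet> p j) else 0"
  have "w {i,j} * ((p(v := z)) i \<bullet> (p(v := z)) j) = w {i,j} * (p i \<bullet> p j) + ?l i j + ?l j i" for i j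
    using assms by (auto simp: d_def algebra_simps inner_commute insert_commute)
  then have "energy w (p(v := z)) = energy w p + (\<Sum>i\<in>UNIV. \<Sum>j\<in>UNIV. ?l i j) + (\<Sum>i\<in>UNIV. \<Sum>j\<in>UNIV. ?l j i)"
    by (simp only: energy_def sum.distrib)
  also have "(\<Sum>i\<in>UNIV. \<Sum>j\<in>UNIV. ?l j i) = (\<Sum>j\<in>UNIV. w {v,j} * (d \<bullet> p j))" by simp
  also have "(\<Sum>i\<in>UNIV. \<Sum>j\<in>UNIV. ?l i j) = (\<Sum>j\<in>UNIV. w {v,j} * (d \<bullet> p j))"
    by (subst sum.swap) simp
  also have "(\<Sum>j\<in>UNIV. w {v,j} * (d \<bullet> p j)) = d \<bullet> (\<Sum>j\<in>UNIV. w {v, j} *\<^sub>R p j)"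
    by (simp add: inner_sum_right)
  finally show ?thesis unfolding d_def by linarith
qed

lemma unit_config_update: "unit_config p \<Longrightarrow> norm z = 1 \<Longrightarrow> unit_config (p(v := z))"
  by (simp add: unit_config_def)

lemma norm_diff_unit: 
  fixes x y :: "'e::real_inner"
  assumes "norm x = 1" "norm y = 1" shows "(norm (x - y))\<^sup>2 = 2 - 2 * (x \<bullet> y)"
  using assms dot_norm_neg[of x y] by simp

text \<open>A configuration in which \<open>b\<close> lies at \<open>\<plusminus> a\<close> can be flattened with this relation preserved:
put the weight \<open>s * k\<close> on the edge and let \<open>k\<close> grow.  The planar configurations obtained nearly
satisfy the relation, and enforcing it changes their energy by an amount that tends to 0 with \<open>k\<close>;
a best planar configuration satisfying the relation exists by compactness.\<close>
lemma tight_edge: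
  fixes p :: "'a::finite \<Rightarrow> real^'a"
  assumes "flattenable E" "\<And>e. e \<in> E \<Longrightarrow> card e = 2" "{a, b} \<in> E" "supported w E" "unit_config p"
    "p b = s *\<^sub>R p a" "\<bar>s\<bar> = 1"
  obtains q :: "'a \<Rightarrow> complex" where "unit_config q" "q b = s *\<^sub>R q a" "energy w p \<le> energy w q"
proof -
  have ss: "s * s = 1" using assms(7) abs_mult_self_eq[of s] by simp
  have "a \<noteq> b" using assms(2)[OF assms(3)] by auto
  let ?S = "{q :: 'a \<Rightarrow> complex. q a \<bullet> q b = s}"
  have tight: "q b = s *\<^sub>R q a" if "unit_config q" "q \<in> ?S" for q :: "'a \<Rightarrow> complex"
  proof -
    have "(norm (q b - s *\<^sub>R q a))\<^sup>2 = 2 - 2 * (q b \<bullet> (s *\<^sub>R q a))"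
      by (rule norm_diff_unit) (use that assms(7) in \<open>auto simp: unit_config_def\<close>)
    also have "\<dots> = 0" using that ss by (simp add: inner_commute)
    finally show ?thesis by simp
  qed
  have m0: "(\<lambda>v. if v = b then complex_of_real s else 1) \<in> ?S" using \<open>a \<noteq> b\<close> by (simp add: inner_complex_def)
  have m1: "unit_config (\<lambda>v. if v = b then complex_of_real s else 1)" using assms(7) by (simp add: unit_config_def)
  obtain q where q: "q \<in> ?S" "unit_config q" "\<And>q'. q' \<in> ?S \<Longrightarrow> unit_config q' \<Longrightarrow> energy w q' \<le> energy w q"
    using optimal_config_exists[OF closed_inner_level m0 m1, of w] by blast
  have "energy w p \<le> energy w q"
  proof (rule ccontr)
    assume "\<not> ?thesis"
    then have lt: "energy w q < energy w p" by simp
    define M where "M = (\<Sum>i\<in>UNIV. \<Sum>j\<in>UNIV. \<bar>w {i, j}\<bar>)"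
    define L where "L = (\<Sum>j\<in>UNIV. \<bar>w {b, j}\<bar>)"
    define d where "d = energy w p - energy w q"
    have "d > 0" using lt by (simp add: d_def)
    have "L \<ge> 0" "M \<ge> 0" by (simp_all add: L_def M_def sum_nonneg)
    have wb: "w {b} = 0" using assms(2)[of "{b}"] assms(4) unfolding supported_def by auto
    \<comment> \<open>The defect of \<open>r b\<close> from \<open>s *\<^sub>R r a\<close> costs \<open>k\<close> times its square, and no more than \<open>2 * M\<close>
      can be gained elsewhere; repairing the defect changes the energy by at most \<open>2 * L\<close> times
      the defect.\<close>
    have est: "d\<^sup>2 * k \<le> (2 * L)\<^sup>2 * (2 * M)" if "k > 0" for k :: real
    proof -
      have "supported (\<lambda>e. w e + (k * s) * edge_weight {a,b} e) E"
        using assms(3,4) by (intro supported_add supported_edge_weight) auto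
      then obtain r :: "'a \<Rightarrow> complex" where r: "unit_config r"
        "energy (\<lambda>e. w e + (k * s) * edge_weight {a,b} e) p \<le> energy (\<lambda>e. w e + (k * s) * edge_weight {a,b} e) r"
        using assms(1,5) unfolding flattenable_def by blast
      have pab: "p a \<bullet> p b = s" using assms(5,6) by (simp add: unit_config_inner_self)
      have e1: "energy w p + k * s * (2 * s) \<le> energy w r + k * s * (2 * (r a \<bullet> r b))"
        using r(2) \<open>a \<noteq> b\<close> by (simp add: energy_add energy_scale energy_edge_weight pab)
      have "k * s * (2 * s) = 2 * k" using ss by simp
      then have e1': "energy w p + 2 * k \<le> energy w r + 2 * (k * (s * (r a \<bullet> r b)))"
        using e1 by (simp only: mult_ac)
      moreover have "energy w r - energy w p \<le> 2 * M"
        using energy_bound[OF r(1), of w] energy_bound[OF assms(5), of w] by (simp add: M_def)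
      ultimately have "k * (2 - 2 * (s * (r a \<bullet> r b))) \<le> 2 * M"
        by (simp add: algebra_simps)
      moreover have "(norm (s *\<^sub>R r a - r b))\<^sup>2 = 2 - 2 * (s * (r a \<bullet> r b))"
        using norm_diff_unit[of "s *\<^sub>R r a" "r b"] r(1) assms(7) by (simp add: unit_config_def)
      ultimately have n: "k * (norm (s *\<^sub>R r a - r b))\<^sup>2 \<le> 2 * M" by simp
      define r' where "r' = r(b := s *\<^sub>R r a)"
      have ur': "unit_config r'" unfolding r'_def
        by (rule unit_config_update) (use r(1) assms(7) in \<open>auto simp: unit_config_def\<close>)
      have "r' \<in> ?S" using \<open>a \<noteq> b\<close> r(1) by (simp add: r'_def unit_config_inner_self)
      from q(3)[OF this ur'] have le: "energy w r' \<le> energy w q" .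
      have "energy w r' = energy w r + 2 * ((s *\<^sub>R r a - r b) \<bullet> (\<Sum>j\<in>UNIV. w {b, j} *\<^sub>R r j))"
        unfolding r'_def by (rule energy_update[of w b r]) (rule wb)
      moreover have "\<bar>(s *\<^sub>R r a - r b) \<bullet> (\<Sum>j\<in>UNIV. w {b, j} *\<^sub>R r j)\<bar> \<le> norm (s *\<^sub>R r a - r b) * L"
      proof -
        have "norm (\<Sum>j\<in>UNIV. w {b, j} *\<^sub>R r j) \<le> (\<Sum>j\<in>UNIV. norm (w {b, j} *\<^sub>R r j))" by (rule norm_sum)
        also have "\<dots> = L" using r(1) by (simp add: L_def unit_config_def)
        finally show ?thesis
          using Cauchy_Schwarz_ineq2[of "s *\<^sub>R r a - r b" "\<Sum>j\<in>UNIV. w {b, j} *\<^sub>R r j"]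
          mult_left_mono[of "norm (\<Sum>j\<in>UNIV. w {b, j} *\<^sub>R r j)" L "norm (s *\<^sub>R r a - r b)"] by simp
      qed
      moreover have "energy w p \<le> energy w r"
      proof -
        have "s * (r a \<bullet> r b) \<le> 1" using inner_unit_bounds[OF r(1), of a b] assms(7)
          abs_mult[of s "r a \<bullet> r b"] by simp
        then have "k * (s * (r a \<bullet> r b)) \<le> k" using that by simp
        then show ?thesis using e1' by simp
      qed
      ultimately have "d \<le> (2 * L) * norm (s *\<^sub>R r a - r b)" using le by (simp add: d_def algebra_simps)
      then have "d\<^sup>2 \<le> ((2 * L) * norm (s *\<^sub>R r a - r b))\<^sup>2" using \<open>d > 0\<close> by (intro power_mono) auto
      then have "d\<^sup>2 \<le> (2 * L)\<^sup>2 * (norm (s *\<^sub>R r a - r b))\<^sup>2" by (simp add: power_mult_distrib)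
      then have "d\<^sup>2 * k \<le> (2 * L)\<^sup>2 * (norm (s *\<^sub>R r a - r b))\<^sup>2 * k" using that by (simp add: mult_right_mono)
      also have "\<dots> = (2 * L)\<^sup>2 * (k * (norm (s *\<^sub>R r a - r b))\<^sup>2)" by simp
      also have "\<dots> \<le> (2 * L)\<^sup>2 * (2 * M)" using n by (intro mult_left_mono) auto
      finally show ?thesis .
    qed
    \<comment> \<open>makes the left-hand side of \<open>est\<close> exceed the right-hand side by 1\<close>
    define k where "k = ((2 * L)\<^sup>2 * (2 * M) + 1) / d\<^sup>2"
    have "k > 0" unfolding k_def using \<open>d > 0\<close> \<open>M \<ge> 0\<close> by (intro divide_pos_pos add_nonneg_pos) auto
    from est[OF this] show False using \<open>d > 0\<close> by (simp add: k_def)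
  qed
  then show ?thesis using that q tight by blast
qed

text \<open>Suppose the energy of the side \<open>E\<close>, as a function of the inner product \<open>c\<close> of \<open>a\<close> and \<open>b\<close>,
lies below a line of slope \<open>\<sigma> \<noteq> 0\<close> touching it at \<open>p\<close>.  Join \<open>a\<close> and \<open>b\<close> by a path through \<open>x\<close>
with weights \<open>k\<close> and \<open>k * t\<close>, where \<open>t = \<plusminus> 1\<close>.  The best position of \<open>x\<close> contributes \<open>2 * k * \<rho>\<close>
with \<open>\<rho> = norm (a + t b)\<close>, so that \<open>\<rho>\<^sup>2 = 2 + 2 * t * c\<close>.  With \<open>t\<close> of the sign opposite to \<open>\<sigma>\<close>
the line becomes a negative multiple of \<open>\<rho>\<^sup>2\<close>, and for the right \<open>k\<close> the sum is a constant minus a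
multiple of \<open>(\<rho> - r)\<^sup>2\<close>, where \<open>r\<close> is the value of \<open>\<rho>\<close> at \<open>p\<close>.  A planar configuration that is as
good as \<open>p\<close> therefore has \<open>\<rho> = r\<close>, which means that it has the inner product of \<open>p\<close> at \<open>a\<close> and
\<open>b\<close>.\<close>
lemma rigid_pair_by_path:
  fixes p :: "'a::finite \<Rightarrow> real^'a"
  assumes flat: "flattenable (E \<union> {{a, x}, {b, x}})" and x: "x \<notin> \<Union>E" "x \<noteq> a" "x \<noteq> b" "a \<noteq> b"
    and w: "supported w E" and p: "unit_config p" "\<bar>p a \<bullet> p b\<bar> < 1" and "\<sigma> \<noteq> 0"
    and slope: "\<And>p' :: 'a \<Rightarrow> real^'a. unit_config p' \<Longrightarrow> energy w p' \<le> energy w p + \<sigma> * (p' a \<bullet> p' b - p a \<bullet> p b)"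
  obtains q :: "'a \<Rightarrow> complex" where "unit_config q" "q a \<bullet> q b = p a \<bullet> p b" "energy w p \<le> energy w q"
proof -
  define y where "y = p a \<bullet> p b"
  define t where "t = - sgn \<sigma>"
  have t: "\<bar>t\<bar> = 1" "\<sigma> = - \<bar>\<sigma>\<bar> * t" "t * t = 1" using \<open>\<sigma> \<noteq> 0\<close> by (auto simp: t_def sgn_real_def)
  have sq: "(norm (z1 + t *\<^sub>R z2))\<^sup>2 = 2 + 2 * t * (z1 \<bullet> z2)" if "norm z1 = 1" "norm z2 = 1" for z1 z2 :: "'e::real_inner"
  proof -
    have "z1 \<bullet> z1 = 1" "z2 \<bullet> z2 = 1" using that by (simp_all add: dot_square_norm)
    then show ?thesis using t(3) by (simp add: power2_norm_eq_inner inner_add_left inner_add_right inner_commute algebra_simps)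
  qed
  have pn: "norm (p v) = 1" for v using p(1) by (simp add: unit_config_def)
  define r where "r = norm (p a + t *\<^sub>R p b)"
  have r2: "r\<^sup>2 = 2 + 2 * t * y" unfolding r_def y_def by (rule sq) (simp_all add: pn)
  have "\<bar>t * y\<bar> < 1" using p(2) t(1) by (simp add: abs_mult y_def)
  then have "r\<^sup>2 > 0" using r2 by (simp add: abs_less_iff)
  then have r0: "r > 0" unfolding r_def by simp
  \<comment> \<open>with this \<open>k\<close>, the derivative of \<open>2 * k * \<rho> - \<bar>\<sigma>\<bar> * \<rho>\<^sup>2 / 2\<close> vanishes at \<open>\<rho> = r\<close>\<close>
  define k where "k = \<bar>\<sigma>\<bar> * r / 2"
  have k0: "k > 0" using r0 \<open>\<sigma> \<noteq> 0\<close> by (simp add: k_def)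
  define W where "W e = w e + (k * edge_weight {a, x} e + (k * t) * edge_weight {b, x} e)" for e
  have enW: "energy W p' = energy w p' + 2 * k * (p' x \<bullet> (p' a + t *\<^sub>R p' b))" for p' :: "'a \<Rightarrow> 'e::real_inner"
    unfolding W_def energy_add energy_scale using x by (simp add: energy_edge_weight inner_commute inner_add_right algebra_simps)
  have "supported W (E \<union> {{a, x}, {b, x}})"
    unfolding W_def by (intro supported_add supported_edge_weight supported_mono[OF w]) auto
  moreover define p1 where "p1 = p(x := (1 / r) *\<^sub>R (p a + t *\<^sub>R p b))"
  have u1: "unit_config p1" unfolding p1_def
    by (rule unit_config_update[OF p(1)]) (use r0 in \<open>simp add: r_def\<close>)
  ultimately obtain q :: "'a \<Rightarrow> complex" where q: "unit_config q" "energy W p1 \<le> energy W q"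
    using flat unfolding flattenable_def by blast
  have "energy w p1 = energy w p"
    by (rule energy_cong) (use x w in \<open>auto simp: p1_def supported_def\<close>)
  moreover have "p1 x \<bullet> (p1 a + t *\<^sub>R p1 b) = r"
    using x r0 by (simp add: p1_def dot_square_norm r_def[symmetric] power2_eq_square)
  ultimately have e1: "energy W p1 = energy w p + 2 * k * r" by (simp add: enW)
  define c where "c = q a \<bullet> q b"
  define \<rho> where "\<rho> = norm (q a + t *\<^sub>R q b)"
  have qn: "norm (q v) = 1" for v using q(1) by (simp add: unit_config_def)
  have \<rho>2: "\<rho>\<^sup>2 = 2 + 2 * t * c" unfolding \<rho>_def c_def by (rule sq) (simp_all add: qn)
  have "q x \<bullet> (q a + t *\<^sub>R q b) \<le> \<rho>"
    using norm_cauchy_schwarz[of "q x" "q a + t *\<^sub>R q b"] qn by (simp add: \<rho>_def)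
  then have e2: "energy W q \<le> energy w q + 2 * k * \<rho>" using k0 by (simp add: enW)
  obtain f :: "complex \<Rightarrow> real^'a" where f: "\<And>z w. f z \<bullet> f w = z \<bullet> w" using complex_to_vec[OF \<open>a \<noteq> b\<close>] by blast
  have "unit_config (f \<circ> q)" using q(1) f by (simp add: unit_config_def norm_eq_sqrt_inner)
  from slope[OF this] have e3: "energy w q \<le> energy w p + \<sigma> * (c - y)"
    using energy_cong[of w "f \<circ> q" q] f by (simp add: c_def y_def)
  have "2 * k * r \<le> \<sigma> * (c - y) + 2 * k * \<rho>" using e1 e2 e3 q(2) by linarith
  moreover have "\<sigma> * (c - y) = - \<bar>\<sigma>\<bar> * (\<rho>\<^sup>2 - r\<^sup>2) / 2"
    unfolding \<rho>2 r2 by (subst t(2)) (simp add: algebra_simps)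
  ultimately have "\<bar>\<sigma>\<bar> * (\<rho> - r)\<^sup>2 \<le> 0" unfolding k_def by (simp add: power2_eq_square algebra_simps)
  then have "(\<rho> - r)\<^sup>2 \<le> 0" using \<open>\<sigma> \<noteq> 0\<close> by (simp add: mult_le_0_iff)
  then have "\<rho> = r" by simp
  then have "2 + 2 * t * c = 2 + 2 * t * y" using \<rho>2 r2 by metis
  then have "t * c = t * y" by simp
  moreover have "t \<noteq> 0" using t(1) by auto
  ultimately have "c = y" by simp
  moreover have "energy w p \<le> energy w q" using e1 e2 q(2) \<open>\<rho> = r\<close> by simp
  ultimately show ?thesis using that q(1) unfolding c_def y_def by blast
qed

text \<open>By convexity of the set of Gram matrices, the maximal energy is a concave function of the
inner product of \<open>a\<close> and \<open>b\<close>.  Hence no slope of a chord to the right of \<open>p\<close> exceeds one to the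
left, and the supremum of the slopes to the right is a supergradient.\<close>
lemma supergradient_exists:
  fixes p :: "'a::finite \<Rightarrow> real^'a"
  assumes p: "unit_config p" "\<bar>p a \<bullet> p b\<bar> < 1" and "a \<noteq> b"
    and opt: "\<And>p' :: 'a \<Rightarrow> real^'a. unit_config p' \<Longrightarrow> p' a \<bullet> p' b = p a \<bullet> p b \<Longrightarrow> energy w p' \<le> energy w p"
  obtains \<sigma> where "\<And>p' :: 'a \<Rightarrow> real^'a. unit_config p' \<Longrightarrow> energy w p' \<le> energy w p + \<sigma> * (p' a \<bullet> p' b - p a \<bullet> p b)"
proof -
  define y where "y = p a \<bullet> p b"
  define L where "L = {(energy w p' - energy w p) / (p' a \<bullet> p' b - y) | p' :: 'a \<Rightarrow> real^'a. unit_config p' \<and> p' a \<bullet> p' b > y}"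
  have cross: "(energy w p2 - energy w p) / (p2 a \<bullet> p2 b - y) \<le> (energy w p - energy w p1) / (y - p1 a \<bullet> p1 b)"
    if "unit_config p1" "unit_config p2" "p1 a \<bullet> p1 b < y" "y < p2 a \<bullet> p2 b" for p1 p2 :: "'a \<Rightarrow> real^'a"
  proof -
    define c1 c2 where "c1 = p1 a \<bullet> p1 b" and "c2 = p2 a \<bullet> p2 b"
    have c: "c1 < y" "y < c2" using that by (auto simp: c1_def c2_def)
    define t where "t = (y - c1) / (c2 - c1)"
    have tt: "t * (c2 - c1) = y - c1" using c by (simp add: t_def)
    have t: "0 \<le> t" "t \<le> 1" "(1 - t) * c1 + t * c2 = y"
      subgoal using c by (simp add: t_def)
      subgoal using c by (simp add: t_def)
      subgoal using tt by (simp add: algebra_simps)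
      done
    obtain f :: "'a \<Rightarrow> real^'a" where f: "\<And>i j. f i \<bullet> f j = (1 - t) * (p1 i \<bullet> p1 j) + t * (p2 i \<bullet> p2 j)"
      using convex_combination_config[OF t(1,2)] by blast
    have "f i \<bullet> f i = 1" for i using that by (simp add: f unit_config_inner_self)
    then have "unit_config f" by (simp add: unit_config_def norm_eq_sqrt_inner)
    moreover have "f a \<bullet> f b = y" using t(3) by (simp add: f c1_def c2_def)
    ultimately have "energy w f \<le> energy w p" using opt by (simp add: y_def)
    moreover have "energy w f = (1 - t) * energy w p1 + t * energy w p2"
      unfolding energy_def f sum_distrib_left sum.distrib[symmetric]
      by (intro sum.cong) (simp_all add: algebra_simps)
    ultimately have "(1 - t) * energy w p1 + t * energy w p2 \<le> energy w p" by simp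
    moreover have "1 - t = (c2 - y) / (c2 - c1)" using c by (simp add: t_def field_simps)
    ultimately have "((c2 - y) * energy w p1 + (y - c1) * energy w p2) / (c2 - c1) \<le> energy w p"
      by (simp add: t_def add_divide_distrib)
    then have "(c2 - y) * energy w p1 + (y - c1) * energy w p2 \<le> energy w p * (c2 - c1)"
      using c by (simp add: pos_divide_le_eq)
    then have "(energy w p2 - energy w p) * (y - c1) \<le> (energy w p - energy w p1) * (c2 - y)"
      by (simp add: algebra_simps)
    then show ?thesis using c by (simp add: frac_le_eq divide_le_eq le_divide_eq c1_def[symmetric] c2_def[symmetric] field_simps)
  qed
  have y1: "-1 < y" "y < 1" using p(2) by (auto simp: y_def abs_less_iff)
  \<comment> \<open>The inner products 1 and -1 lie strictly on either side of \<open>y\<close>, so there are slopes on both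
    sides.\<close>
  define p0 where "p0 s v = (if v = b then s *\<^sub>R p a else p a)" for s :: real and v
  have p0: "unit_config (p0 s)" "p0 s a \<bullet> p0 s b = s" if "\<bar>s\<bar> = 1" for s
    using that \<open>a \<noteq> b\<close> p(1) by (auto simp: p0_def unit_config_def dot_square_norm)
  have "L \<noteq> {}" unfolding L_def using p0[of 1] y1 by force
  have bdd: "bdd_above L"
    unfolding bdd_above_def L_def using cross[OF p0(1)[of "-1"]] p0[of "-1"] y1 by force
  define \<sigma> where "\<sigma> = Sup L"
  have "energy w p' \<le> energy w p + \<sigma> * (p' a \<bullet> p' b - y)" if u: "unit_config p'" for p' :: "'a \<Rightarrow> real^'a"
  proof (cases "p' a \<bullet> p' b" y rule: linorder_cases)
    case equal then show ?thesis using opt u by (simp add: y_def)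
  next
    case greater
    then have "(energy w p' - energy w p) / (p' a \<bullet> p' b - y) \<le> \<sigma>"
      unfolding \<sigma>_def by (intro cSup_upper bdd) (use u in \<open>auto simp: L_def\<close>)
    then show ?thesis using greater by (simp add: pos_divide_le_eq algebra_simps)
  next
    case less
    have "\<sigma> \<le> (energy w p - energy w p') / (y - p' a \<bullet> p' b)"
      unfolding \<sigma>_def by (rule cSup_least[OF \<open>L \<noteq> {}\<close>]) (use cross[OF u _ less] in \<open>auto simp: L_def\<close>)
    then show ?thesis using less by (simp add: pos_le_divide_eq algebra_simps)
  qed
  then show ?thesis using that unfolding y_def by blast
qed

lemma optimal_config_with_inner:
  fixes p :: "'a::finite \<Rightarrow> 'e::euclidean_space"
  assumes "unit_config p"
  shows "\<exists>p' :: 'a \<Rightarrow> 'e. p' a \<bullet> p' b = p a \<bullet> p b \<and> unit_config p' \<and>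
    (\<forall>p'' :: 'a \<Rightarrow> 'e. unit_config p'' \<longrightarrow> p'' a \<bullet> p'' b = p a \<bullet> p b \<longrightarrow> energy w p'' \<le> energy w p')"
proof -
  define S where "S = {p' :: 'a \<Rightarrow> 'e. p' a \<bullet> p' b = p a \<bullet> p b}"
  have S: "closed S" "p \<in> S" using closed_inner_level[of a b "p a \<bullet> p b"] by (auto simp: S_def)
  obtain p' where "p' \<in> S" "unit_config p'" "\<And>p''. p'' \<in> S \<Longrightarrow> unit_config p'' \<Longrightarrow> energy w p'' \<le> energy w p'"
    using optimal_config_exists[OF S assms, of w] by blast
  then show ?thesis by (intro exI[of _ p']) (simp add: S_def)
qed

text \<open>The edge \<open>{a, b}\<close> of the triangle is used to change the slope of the supporting line to 1,
so that the path through \<open>x\<close> can balance it; a slope 0 could not be balanced.  If the inner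
product is \<open>\<plusminus> 1\<close>, which leaves no room for a supporting line, then the pair is kept together by a
heavy edge instead.\<close>
lemma rigid_pair_by_triangle:
  fixes p :: "'a::finite \<Rightarrow> real^'a"
  assumes flat: "flattenable (E \<union> {{a, x}, {b, x}})" and ab: "{a, b} \<in> E" and E: "\<And>e. e \<in> E \<Longrightarrow> card e = 2"
    and x: "x \<notin> \<Union>E"
    and w: "supported w E" and p: "unit_config p"
  obtains q :: "'a \<Rightarrow> complex" where "unit_config q" "q a \<bullet> q b = p a \<bullet> p b" "energy w p \<le> energy w q"
proof (cases "\<bar>p a \<bullet> p b\<bar> < 1")
  case True
  have "a \<noteq> b" using E[OF ab] by auto
  moreover have "x \<noteq> a" "x \<noteq> b" using ab x by auto
  ultimately have ne: "a \<noteq> b" "x \<noteq> a" "x \<noteq> b" by auto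
  obtain p' :: "'a \<Rightarrow> real^'a" where p': "p' a \<bullet> p' b = p a \<bullet> p b" "unit_config p'"
    "\<forall>p'' :: 'a \<Rightarrow> real^'a. unit_config p'' \<longrightarrow> p'' a \<bullet> p'' b = p a \<bullet> p b \<longrightarrow> energy w p'' \<le> energy w p'"
    using optimal_config_with_inner[OF p] by blast
  have opt: "energy w p'' \<le> energy w p'" if "unit_config p''" "p'' a \<bullet> p'' b = p' a \<bullet> p' b" for p'' :: "'a \<Rightarrow> real^'a"
    using p'(3) that p'(1) by simp
  have lt: "\<bar>p' a \<bullet> p' b\<bar> < 1" using True p'(1) by simp
  obtain \<sigma> where s: "\<And>p'' :: 'a \<Rightarrow> real^'a. unit_config p'' \<Longrightarrow> energy w p'' \<le> energy w p' + \<sigma> * (p'' a \<bullet> p'' b - p' a \<bullet> p' b)"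
    using supergradient_exists[OF p'(2) lt ne(1) opt] by blast
  \<comment> \<open>an edge counts twice in the energy, so this changes the slope by \<open>1 - \<sigma>\<close>\<close>
  define \<kappa> where "\<kappa> = (1 - \<sigma>) / 2"
  define W where "W e = w e + \<kappa> * edge_weight {a,b} e" for e
  have enW: "energy W r = energy w r + (1 - \<sigma>) * (r a \<bullet> r b)" for r :: "'a \<Rightarrow> 'e::real_inner"
    unfolding W_def energy_add energy_scale using ne by (simp add: energy_edge_weight \<kappa>_def)
  have slope: "energy W r \<le> energy W p' + 1 * (r a \<bullet> r b - p' a \<bullet> p' b)" if "unit_config r" for r :: "'a \<Rightarrow> real^'a"
    using s[OF that] by (simp add: enW algebra_simps)
  have sW: "supported W E" unfolding W_def by (intro supported_add w supported_edge_weight ab)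
  obtain q :: "'a \<Rightarrow> complex" where q: "unit_config q" "q a \<bullet> q b = p' a \<bullet> p' b" "energy W p' \<le> energy W q"
    using rigid_pair_by_path[OF flat x ne(2,3,1) sW p'(2) lt one_neq_zero slope] by blast
  then have "energy w p' \<le> energy w q" by (simp add: enW)
  moreover have "energy w p \<le> energy w p'" using p'(3) p by simp
  ultimately show ?thesis using that[of q] q p'(1) by simp
next
  case False
  define s where "s = p a \<bullet> p b"
  have s: "\<bar>s\<bar> = 1" using False inner_unit_bounds[OF p, of a b] by (simp add: s_def)
  have "(norm (p b - s *\<^sub>R p a))\<^sup>2 = 2 - 2 * (p b \<bullet> (s *\<^sub>R p a))"
    by (rule norm_diff_unit) (use p s in \<open>auto simp: unit_config_def\<close>)
  also have "\<dots> = 2 - 2 * (s * s)" by (simp add: s_def inner_commute)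
  also have "\<dots> = 0" using s abs_mult_self_eq[of s] by simp
  finally have pb: "p b = s *\<^sub>R p a" by simp
  have "flattenable E" using flattenable_mono[OF flat] by blast
  from tight_edge[OF this E ab w p pb s] obtain q :: "'a \<Rightarrow> complex"
    where q: "unit_config q" "q b = s *\<^sub>R q a" "energy w p \<le> energy w q" by blast
  then have "q a \<bullet> q b = s" by (simp add: unit_config_inner_self)
  then show ?thesis using that q unfolding s_def by blast
qed

section \<open>Extreme Gram dimension and planar configurations\<close>

lemma psd_gram:
  fixes X :: "real^'n^'n"
  assumes "psd X" obtains f :: "'n \<Rightarrow> real^'n" where "\<And>i j. f i \<bullet> f j = X $ i $ j"
proof -
  have "transpose X $ j $ i = X $ j $ i" for i j using assms by (simp add: psd_def)
  then have sym: "X $ i $ j = X $ j $ i" for i j by (simp add: transpose_def)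
  have "0 \<le> (\<Sum>i\<in>UNIV. \<Sum>j\<in>UNIV. c i * c j * X $ i $ j)" for c
  proof -
    have "0 \<le> (\<chi> i. c i) \<bullet> (X *v (\<chi> i. c i))" using assms by (simp add: psd_def)
    also have "\<dots> = (\<Sum>i\<in>UNIV. \<Sum>j\<in>UNIV. c i * c j * X $ i $ j)"
      by (simp add: inner_vec_def matrix_vector_mult_def sum_distrib_left ac_simps)
    finally show ?thesis .
  qed
  from gram_factorization[of "\<lambda>i j. X $ i $ j", OF sym this] show ?thesis using that by blast
qed

definition gram_matrix :: "('n \<Rightarrow> 'e::real_inner) \<Rightarrow> real^'n^'n" where
  "gram_matrix f = (\<chi> i j. f i \<bullet> f j)"

lemma psd_gram_matrix: "psd (gram_matrix f)"
proof -
  have "transpose (gram_matrix f) = gram_matrix f"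
    by (simp add: gram_matrix_def transpose_def vec_eq_iff inner_commute)
  moreover have "0 \<le> x \<bullet> (gram_matrix f *v x)" for x
  proof -
    have "x \<bullet> (gram_matrix f *v x) = (\<Sum>i\<in>UNIV. \<Sum>j\<in>UNIV. x $ i * x $ j * (f i \<bullet> f j))"
      by (simp add: inner_vec_def matrix_vector_mult_def gram_matrix_def sum_distrib_left ac_simps)
    then show ?thesis by (simp add: gram_quadratic)
  qed
  ultimately show ?thesis by (simp add: psd_def)
qed

lemma sdp_feasible_iff:
  "sdp_feasible X \<longleftrightarrow> (\<exists>f :: 'n \<Rightarrow> real^'n. unit_config f \<and> X = gram_matrix f)"
  for X :: "real^'n^'n"
proof
  assume X: "sdp_feasible X"
  then obtain f :: "'n \<Rightarrow> real^'n" where f: "\<And>i j. f i \<bullet> f j = X $ i $ j"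
    using psd_gram unfolding sdp_feasible_def by metis
  then have "unit_config f" using X by (simp add: unit_config_def sdp_feasible_def norm_eq_sqrt_inner)
  moreover have "X = gram_matrix f" by (simp add: gram_matrix_def vec_eq_iff f)
  ultimately show "\<exists>f :: 'n \<Rightarrow> real^'n. unit_config f \<and> X = gram_matrix f" by blast
next
  assume "\<exists>f :: 'n \<Rightarrow> real^'n. unit_config f \<and> X = gram_matrix f"
  then show "sdp_feasible X"
    using psd_gram_matrix unfolding sdp_feasible_def by (auto simp: gram_matrix_def unit_config_inner_self)
qed

lemma sdp_feasible_gram: "unit_config f \<Longrightarrow> sdp_feasible (gram_matrix f)"
  unfolding sdp_feasible_def using psd_gram_matrix[of f] unit_config_inner_self[of f] by (simp add: gram_matrix_def)

lemma sdp_objective_gram: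
  "sdp_objective E w (gram_matrix f) = energy (restrict_weight w E) f / 2"
proof -
  have "energy (restrict_weight w E) f = (\<Sum>x\<in>UNIV \<times> UNIV. restrict_weight w E {fst x, snd x} * (f (fst x) \<bullet> f (snd x)))"
    unfolding energy_def by (simp add: sum.cartesian_product case_prod_beta)
  also have "\<dots> = (\<Sum>x\<in>{(i, j). {i, j} \<in> E}. w {fst x, snd x} * (f (fst x) \<bullet> f (snd x)))"
    by (rule sum.mono_neutral_cong_right) (auto simp: restrict_weight_def)
  finally show ?thesis by (simp add: sdp_objective_def gram_matrix_def case_prod_beta)
qed

lemma rank_gram_complex: "rank (gram_matrix (q :: 'n::finite \<Rightarrow> complex)) \<le> 2"
proof -
  define A :: "real^2^'n" where "A = (\<chi> i k. if k = 1 then Re (q i) else Im (q i))"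
  have "gram_matrix q = A ** transpose A"
    by (simp add: vec_eq_iff gram_matrix_def matrix_matrix_mult_def transpose_def A_def inner_complex_def sum_2)
  then have "rank (gram_matrix q) \<le> rank A" using rank_mul_le_left by metis
  also have "\<dots> \<le> 2" using rank_bound[of A] by simp
  finally show ?thesis .
qed

text \<open>If \<open>A\<close> has the vectors as rows, then the Gram matrix is \<open>A\<close> times its transpose, and \<open>A\<close> is
injective on the range of its transpose because that range is orthogonal to the kernel of \<open>A\<close>.\<close>
lemma dim_le_rank_gram:
  fixes f :: "'n::finite \<Rightarrow> real^'n"
  shows "dim (range f) \<le> rank (gram_matrix f)"
proof -
  define A :: "real^'n^'n" where "A = (\<chi> i. f i)"
  have G: "gram_matrix f = A ** transpose A"
    by (simp add: vec_eq_iff gram_matrix_def matrix_matrix_mult_def transpose_def A_def inner_vec_def)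
  have "rows A = range f" by (auto simp: rows_def row_def A_def vec_lambda_eta image_def)
  then have "dim (range f) = rank A" by (simp add: row_rank_def)
  also have "\<dots> = rank (transpose A)" by (simp add: rank_transpose)
  also have "\<dots> = dim (range (\<lambda>x. transpose A *v x))" by (rule rank_dim_range)
  also have "\<dots> = dim ((\<lambda>x. A *v x) ` range (\<lambda>x. transpose A *v x))"
  proof (rule dim_image_eq[symmetric])
    show "linear ((*v) A)" by simp
    have sub: "subspace (range (\<lambda>x. transpose A *v x))"
      by (rule linear_subspace_image[OF matrix_vector_mul_linear subspace_UNIV])
    show "inj_on ((*v) A) (span (range (\<lambda>x. transpose A *v x)))"
    proof (rule inj_onI)
      fix x y assume xy: "x \<in> span (range (\<lambda>x. transpose A *v x))" "y \<in> span (range (\<lambda>x. transpose A *v x))" "A *v x = A *v y"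
      then have "x - y \<in> range (\<lambda>x. transpose A *v x)" using sub span_eq_iff subspace_diff by metis
      then obtain c where c: "x - y = transpose A *v c" by auto
      have "(x - y) \<bullet> (x - y) = (c v* A) \<bullet> (x - y)" using c by simp
      also have "\<dots> = c \<bullet> (A *v (x - y))" by (rule dot_lmul_matrix)
      also have "\<dots> = 0" using xy(3) by (simp add: matrix_vector_mult_diff_distrib)
      finally show "x = y" by simp
    qed
  qed
  also have "\<dots> = dim (range (\<lambda>x. gram_matrix f *v x))"
    by (simp only: G image_comp o_def matrix_vector_mul_assoc)
  also have "\<dots> = rank (gram_matrix f)" by (rule rank_dim_range[symmetric])
  finally show ?thesis by simp
qed

lemma sdp_optimal_gramI:
  fixes f :: "'n::finite \<Rightarrow> 'e::real_inner"
  assumes "unit_config f" "\<And>p :: 'n \<Rightarrow> real^'n. unit_config p \<Longrightarrow> energy (restrict_weight w E) p \<le> energy (restrict_weight w E) f"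
  shows "sdp_optimal E w (gram_matrix f)"
  unfolding sdp_optimal_def
proof (intro conjI allI impI)
  fix Y :: "real^'n^'n" assume "sdp_feasible Y"
  then obtain p :: "'n \<Rightarrow> real^'n" where "unit_config p" "Y = gram_matrix p" using sdp_feasible_iff by blast
  then show "sdp_objective E w Y \<le> sdp_objective E w (gram_matrix f)"
    using assms(2) by (simp add: sdp_objective_gram)
qed (rule sdp_feasible_gram[OF assms(1)])

text \<open>Gram matrices translate between feasible matrices and unit configurations, with half the
energy as objective; rank at most two means that the configuration fits into the plane.\<close>
theorem egd_le_2_iff_flattenable:
  fixes E :: "'n::finite set set"
  shows "egd E \<le> 2 \<longleftrightarrow> flattenable E"
proof -
  define P where "P r \<longleftrightarrow> r \<ge> 1 \<and> (\<forall>w. \<exists>X :: real^'n^'n. sdp_optimal E w X \<and> rank X \<le> r)" for r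
  have egd: "egd E = (LEAST r. P r)" by (simp add: egd_def P_def)
  have u0: "unit_config (\<lambda>v. axis v 1 :: real^'n)" by (simp add: unit_config_def)
  \<comment> \<open>some rank is always sufficient, so the minimum in the definition is attained\<close>
  have "P (CARD('n))"
    unfolding P_def
  proof (intro conjI allI)
    show "1 \<le> CARD('n)" by (simp add: Suc_leI)
    fix w
    obtain p :: "'n \<Rightarrow> real^'n" where p: "unit_config p"
      "\<And>p' :: 'n \<Rightarrow> real^'n. p' \<in> UNIV \<Longrightarrow> unit_config p' \<Longrightarrow> energy (restrict_weight w E) p' \<le> energy (restrict_weight w E) p"
      using optimal_config_exists[OF closed_UNIV UNIV_I u0, of "restrict_weight w E"] by blast
    have "sdp_optimal E w (gram_matrix p)" by (rule sdp_optimal_gramI) (use p in auto)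
    moreover have "rank (gram_matrix p) \<le> CARD('n)" using rank_bound[of "gram_matrix p"] by simp
    ultimately show "\<exists>X :: real^'n^'n. sdp_optimal E w X \<and> rank X \<le> CARD('n)" by blast
  qed
  then have Pegd: "P (egd E)" unfolding egd by (rule LeastI)
  show ?thesis
  proof
    assume le: "egd E \<le> 2"
    show "flattenable E" unfolding flattenable_def
    proof (intro allI impI)
      fix w and p :: "'n \<Rightarrow> real^'n" assume w: "supported w E" and p: "unit_config p"
      have wE: "restrict_weight w E = w" using w by (auto simp: restrict_weight_def supported_def)
      obtain X :: "real^'n^'n" where X: "sdp_optimal E w X" "rank X \<le> 2" using Pegd le unfolding P_def by (meson order_trans)
      then obtain f :: "'n \<Rightarrow> real^'n" where f: "unit_config f" "X = gram_matrix f"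
        using sdp_feasible_iff unfolding sdp_optimal_def by blast
      have "energy w p \<le> energy w f"
        using X(1) sdp_feasible_gram[OF p] unfolding sdp_optimal_def f(2) by (auto simp: sdp_objective_gram wE)
      have "dim (range f) \<le> 2" using dim_le_rank_gram[of f] X(2) f(2) by simp
      then obtain g :: "real^'n \<Rightarrow> complex" where g: "\<And>x y. x \<in> range f \<Longrightarrow> y \<in> range f \<Longrightarrow> g x \<bullet> g y = x \<bullet> y"
        using plane_to_complex by blast
      have "unit_config (g \<circ> f)" using f(1) g by (simp add: unit_config_def norm_eq_sqrt_inner)
      moreover have "energy w (g \<circ> f) = energy w f" by (rule energy_cong) (simp add: g)
      ultimately show "\<exists>q :: 'n \<Rightarrow> complex. unit_config q \<and> energy w p \<le> energy w q"
        using \<open>energy w p \<le> energy w f\<close> by metis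
    qed
  next
    assume flat: "flattenable E"
    have "P 2" unfolding P_def
    proof (intro conjI allI)
      fix w
      have u1: "unit_config (\<lambda>v::'n. 1 :: complex)" by (simp add: unit_config_def)
      obtain q :: "'n \<Rightarrow> complex" where q: "unit_config q"
        "\<And>q' :: 'n \<Rightarrow> complex. q' \<in> UNIV \<Longrightarrow> unit_config q' \<Longrightarrow> energy (restrict_weight w E) q' \<le> energy (restrict_weight w E) q"
        using optimal_config_exists[OF closed_UNIV UNIV_I u1, of "restrict_weight w E"] by blast
      have "sdp_optimal E w (gram_matrix q)"
      proof (rule sdp_optimal_gramI[OF q(1)])
        fix p :: "'n \<Rightarrow> real^'n" assume "unit_config p"
        then obtain q' :: "'n \<Rightarrow> complex" where "unit_config q'" "energy (restrict_weight w E) p \<le> energy (restrict_weight w E) q'"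
          using flat supported_restrict_weight unfolding flattenable_def by blast
        then show "energy (restrict_weight w E) p \<le> energy (restrict_weight w E) q" using q(2)[of q'] by simp
      qed
      then show "\<exists>X :: real^'n^'n. sdp_optimal E w X \<and> rank X \<le> 2" using rank_gram_complex by blast
    qed simp
    then show "egd E \<le> 2" unfolding egd by (rule Least_le)
  qed
qed

section \<open>Connected sets and minors by branch sets\<close>

lemma simple_graph_contract:
  assumes "simple_graph G" "{u, v} \<in> snd G"
  shows "simple_graph (contract_edge u v G)"
proof -
  define h where "h x = (if x = v then u else x)" for x
  have uv: "u \<noteq> v" "u \<in> fst G" using assms by (auto simp: simple_graph_def)
  have "h ` e \<subseteq> fst G - {v} \<and> card (h ` e) = 2" if e: "e \<in> snd G - {{u, v}}" for e
  proof -
    have c: "card e = 2" "e \<subseteq> fst G" using assms(1) e by (auto simp: simple_graph_def)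
    then obtain i j where ij: "e = {i, j}" "i \<noteq> j" by (auto simp: card_2_iff)
    have "h i \<noteq> h j" using e ij by (auto simp: h_def insert_commute)
    moreover have "h i \<in> fst G - {v}" "h j \<in> fst G - {v}" using c(2) ij(1) uv by (auto simp: h_def)
    ultimately show ?thesis by (simp add: ij(1))
  qed
  then show ?thesis using assms(1) unfolding simple_graph_def contract_edge_def h_def by auto
qed

lemma simple_graph_minor: "minor_of G M \<Longrightarrow> simple_graph G \<Longrightarrow> simple_graph M"
proof (induction rule: minor_of.induct)
  case (contract M u v)
  show ?case by (rule simple_graph_contract[OF contract.IH[OF contract.prems] contract.hyps(2)])
qed (auto simp: simple_graph_def)


text \<open>Connectedness in terms of cuts instead of paths: a cut of a contracted graph lifts to a cut
of the original one, which makes this form convenient for contractions.\<close>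
definition conn :: "'a set set \<Rightarrow> 'a set \<Rightarrow> bool" where
  "conn E B \<longleftrightarrow> B \<noteq> {} \<and> (\<forall>S. S \<subset> B \<longrightarrow> S \<noteq> {} \<longrightarrow> (\<exists>s\<in>S. \<exists>t\<in>B - S. {s, t} \<in> E))"

lemma conn_singleton: "conn E {v}"
  by (auto simp: conn_def)

lemma conn_Un:
  assumes A: "conn E A" and B: "conn E B" and ab: "a \<in> A" "b \<in> B" "{a, b} \<in> E \<or> a = b"
  shows "conn E (A \<union> B)"
  unfolding conn_def
proof (intro conjI allI impI)
  show "A \<union> B \<noteq> {}" using ab by auto
  fix S assume S: "S \<subset> A \<union> B" "S \<noteq> {}"
  consider "S \<inter> A \<noteq> {}" "S \<inter> A \<noteq> A" | "S \<inter> B \<noteq> {}" "S \<inter> B \<noteq> B" | "S \<inter> A = {} \<or> S \<inter> A = A" "S \<inter> B = {} \<or> S \<inter> B = B"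
    by blast
  then show "\<exists>s\<in>S. \<exists>t\<in>A \<union> B - S. {s, t} \<in> E"
  proof cases
    case 1
    then have "S \<inter> A \<subset> A" by blast
    then obtain s t where "s \<in> S \<inter> A" "t \<in> A - S \<inter> A" "{s, t} \<in> E" using A 1(1) unfolding conn_def by blast
    then show ?thesis by blast
  next
    case 2
    then have "S \<inter> B \<subset> B" by blast
    then obtain s t where "s \<in> S \<inter> B" "t \<in> B - S \<inter> B" "{s, t} \<in> E" using B 2(1) unfolding conn_def by blast
    then show ?thesis by blast
  next
    case 3
    then have "(A \<subseteq> S \<and> S \<inter> B = {}) \<or> (B \<subseteq> S \<and> S \<inter> A = {})" using S by blast
    then show ?thesis
    proof
      assume *: "A \<subseteq> S \<and> S \<inter> B = {}"
      then have "a \<in> S" "b \<in> A \<union> B - S" using ab by auto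
      then show ?thesis using ab * by blast
    next
      assume *: "B \<subseteq> S \<and> S \<inter> A = {}"
      then have "b \<in> S" "a \<in> A \<union> B - S" using ab by auto
      moreover have "{b, a} \<in> E" using ab * by (auto simp: insert_commute)
      ultimately show ?thesis by blast
    qed
  qed
qed

lemma conn_insert: "conn E B \<Longrightarrow> b \<in> B \<Longrightarrow> {b, v} \<in> E \<Longrightarrow> conn E (insert v B)"
  using conn_Un[of E B "{v}" b v] conn_singleton[of E v] by simp

text \<open>A connected set of maximal size among those containing \<open>c\<close>.\<close>
lemma component_exists:
  assumes "finite C" "c \<in> C"
  obtains K where "conn E K" "c \<in> K" "K \<subseteq> C" "\<And>k v. k \<in> K \<Longrightarrow> v \<in> C - K \<Longrightarrow> {k, v} \<notin> E"
proof -
  let ?P = "\<lambda>K. conn E K \<and> c \<in> K \<and> K \<subseteq> C"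
  have "?P {c}" using assms(2) conn_singleton by auto
  moreover have "\<forall>K. ?P K \<longrightarrow> card K \<le> card C" using assms(1) card_mono by blast
  ultimately obtain K where K: "?P K" "\<forall>K'. ?P K' \<longrightarrow> card K' \<le> card K"
    using ex_has_greatest_nat[of ?P "{c}" card "card C + 1"] by (metis less_Suc_eq_le Suc_eq_plus1)
  have "{k, v} \<notin> E" if kv: "k \<in> K" "v \<in> C - K" for k v
  proof
    assume "{k, v} \<in> E"
    then have "?P (insert v K)" using K(1) kv conn_insert[of E K k v] by auto
    then have "card (insert v K) \<le> card K" using K(2) by blast
    moreover have "finite K" using K(1) assms(1) finite_subset by blast
    ultimately show False using kv(2) by simp
  qed
  then show ?thesis using that K(1) by blast
qed

lemma minor_trans: "minor_of M N \<Longrightarrow> minor_of G M \<Longrightarrow> minor_of G N"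
  by (induction rule: minor_of.induct) (auto intro: minor_of.intros)

lemma has_minor_iso_trans: "minor_of G M \<Longrightarrow> has_minor_iso M H \<Longrightarrow> has_minor_iso G H"
  unfolding has_minor_iso_def using minor_trans by blast

lemma minor_delete_edges:
  assumes "finite F" "F \<subseteq> E"
  shows "minor_of (V, E) (V, E - F)"
  using assms
proof (induction F rule: finite_induct)
  case empty show ?case by (simp add: minor_of.refl)
next
  case (insert e F)
  then have "minor_of (V, E) (V, E - F)" by simp
  moreover have "e \<in> snd (V, E - F)" using insert by auto
  ultimately have "minor_of (V, E) (fst (V, E - F), snd (V, E - F) - {e})" by (rule minor_of.delete_edge)
  moreover have "E - F - {e} = E - insert e F" by auto
  ultimately show ?case by simp
qed

lemma minor_delete_nodes:
  assumes "finite F" "F \<subseteq> V"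
  shows "minor_of (V, E) (V - F, {e \<in> E. e \<inter> F = {}})"
  using assms
proof (induction F rule: finite_induct)
  case empty show ?case by (simp add: minor_of.refl)
next
  case (insert v F)
  let ?M = "(V - F, {e \<in> E. e \<inter> F = {}})"
  have "minor_of (V, E) ?M" using insert by simp
  moreover have "v \<in> fst ?M" using insert by auto
  ultimately have "minor_of (V, E) (fst ?M - {v}, {e \<in> snd ?M. v \<notin> e})" by (rule minor_of.delete_node)
  moreover have "fst ?M - {v} = V - insert v F" by auto
  moreover have "{e \<in> snd ?M. v \<notin> e} = {e \<in> E. e \<inter> insert v F = {}}" by auto
  ultimately show ?case by simp
qed

lemma simple_graph_finite_edges: "simple_graph G \<Longrightarrow> finite (snd G)"
  unfolding simple_graph_def by (meson PowI finite_Pow_iff finite_subset subsetI)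

lemma minor_subgraph:
  assumes "simple_graph (V, E)" "W \<subseteq> V" "F \<subseteq> E" "\<And>e. e \<in> F \<Longrightarrow> e \<subseteq> W"
  shows "minor_of (V, E) (W, F)"
proof -
  have fin: "finite V" "finite E" using assms(1) simple_graph_finite_edges[OF assms(1)] by (auto simp: simple_graph_def)
  let ?E = "{e \<in> E. e \<inter> (V - W) = {}}"
  have "minor_of (V, E) (V - (V - W), ?E)" using fin by (intro minor_delete_nodes) auto
  moreover have "V - (V - W) = W" using assms(2) by auto
  ultimately have 1: "minor_of (V, E) (W, ?E)" by simp
  have "minor_of (W, ?E) (W, ?E - (?E - F))" using fin by (intro minor_delete_edges) auto
  moreover have "?E - (?E - F) = F" using assms(3,4) by auto
  ultimately have "minor_of (W, ?E) (W, F)" by simp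
  then show ?thesis using 1 by (rule minor_trans)
qed

text \<open>The usual description of minors by branch sets.  While some branch set has more than its
representative \<open>v\<close>, it contains a neighbour \<open>u\<close> of \<open>v\<close>, and the edge is contracted onto \<open>v\<close>; when
all branch sets are singletons the remaining graph is a subgraph.\<close>
lemma minor_by_branch_sets:
  assumes "simple_graph (V, E)" "\<And>v. v \<in> W \<Longrightarrow> v \<in> B v \<and> B v \<subseteq> V \<and> conn E (B v)"
    "\<And>u v. u \<in> W \<Longrightarrow> v \<in> W \<Longrightarrow> u \<noteq> v \<Longrightarrow> B u \<inter> B v = {}"
    "\<And>e. e \<in> F \<Longrightarrow> \<exists>u v s t. e = {u, v} \<and> u \<in> W \<and> v \<in> W \<and> u \<noteq> v \<and> s \<in> B u \<and> t \<in> B v \<and> {s, t} \<in> E"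
  shows "minor_of (V, E) (W, F)"
  using assms
proof (induction "card V" arbitrary: V E B rule: less_induct)
  case less
  note simple = less.prems(1) and B = less.prems(2) and disj = less.prems(3) and F = less.prems(4)
  show ?case
  proof (cases "\<forall>v\<in>W. B v = {v}")
    case True
    show ?thesis
    proof (rule minor_subgraph[OF simple])
      show "W \<subseteq> V" using B by blast
      have "e \<in> E \<and> e \<subseteq> W" if "e \<in> F" for e using F[OF that] True by auto
      then show "F \<subseteq> E" "\<And>e. e \<in> F \<Longrightarrow> e \<subseteq> W" by auto
    qed
  next
    case False
    then obtain v where v: "v \<in> W" "B v \<noteq> {v}" by blast
    then have "{v} \<subset> B v" using B by blast
    then obtain u where u: "u \<in> B v" "u \<noteq> v" "{v, u} \<in> E" using B[OF v(1)] unfolding conn_def by blast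
    have uV: "u \<in> V" using u(1) B[OF v(1)] by blast
    have uB: "u \<notin> B x" if "x \<in> W" "x \<noteq> v" for x using disj[OF that(1) v(1) that(2)] u(1) by blast
    define h where "h x = (if x = u then v else x)" for x
    define E' where "E' = (\<lambda>e. h ` e) ` (E - {{v, u}})"
    have contr: "contract_edge v u (V, E) = (V - {u}, E')" by (simp add: contract_edge_def E'_def h_def)
    have E'I: "{h s, h t} \<in> E'" if "{s, t} \<in> E" "{s, t} \<noteq> {v, u}" for s t
      unfolding E'_def using that by (intro image_eqI[of _ _ "{s, t}"]) auto
    define B' where "B' = B(v := B v - {u})"
    have finV: "finite V" using simple by (simp add: simple_graph_def)
    have "minor_of (V - {u}, E') (W, F)"
    proof (rule less.hyps)
      show "card (V - {u}) < card V" by (rule card_Diff1_less[OF finV uV])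
      show "simple_graph (V - {u}, E')" using simple_graph_contract[OF simple, of v u] u(3) unfolding contr by simp
      show "B' x \<inter> B' y = {}" if "x \<in> W" "y \<in> W" "x \<noteq> y" for x y
        using disj[OF that] unfolding B'_def fun_upd_apply by auto
      show "\<exists>x y s t. e = {x, y} \<and> x \<in> W \<and> y \<in> W \<and> x \<noteq> y \<and> s \<in> B' x \<and> t \<in> B' y \<and> {s, t} \<in> E'" if e: "e \<in> F" for e
      proof -
        obtain x y s t where *: "e = {x, y}" "x \<in> W" "y \<in> W" "x \<noteq> y" "s \<in> B x" "t \<in> B y" "{s, t} \<in> E" using F[OF e] by blast
        have hB: "h z \<in> B' x" if "x \<in> W" "z \<in> B x" for x z
          using that uB[of x] u B[OF v(1)] by (auto simp: h_def B'_def)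
        have "{s, t} \<noteq> {v, u}"
        proof
          assume "{s, t} = {v, u}"
          moreover have "v \<in> B v" using B[OF v(1)] by blast
          ultimately have "s \<in> B v" "t \<in> B v" using u(1) by (auto simp: doubleton_eq_iff)
          then show False using disj[of x v] disj[of y v] * v(1) by blast
        qed
        then have "{h s, h t} \<in> E'" using *(7) by (intro E'I)
        then show ?thesis using * hB by blast
      qed
      show "x \<in> B' x \<and> B' x \<subseteq> V - {u} \<and> conn E' (B' x)" if x: "x \<in> W" for x
      proof (intro conjI)
        show "x \<in> B' x" using B[OF x] u(2) by (auto simp: B'_def)
        show "B' x \<subseteq> V - {u}" using B[OF x] uB[OF x] by (auto simp: B'_def)
        show "conn E' (B' x)"
        proof (cases "x = v")
          case False
          have cB: "conn E (B x)" using B[OF x] by blast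
          have "conn E' (B x)" unfolding conn_def
          proof (intro conjI allI impI)
            show "B x \<noteq> {}" using B[OF x] by blast
            fix S assume S: "S \<subset> B x" "S \<noteq> {}"
            then obtain s t where st: "s \<in> S" "t \<in> B x - S" "{s, t} \<in> E" using cB unfolding conn_def by blast
            have "s \<noteq> u" "t \<noteq> u" using uB[OF x False] st S by auto
            then have "{h s, h t} = {s, t}" "{s, t} \<noteq> {v, u}" by (auto simp: h_def doubleton_eq_iff)
            then have "{s, t} \<in> E'" using E'I[OF st(3)] by simp
            then show "\<exists>s\<in>S. \<exists>t\<in>B x - S. {s, t} \<in> E'" using st by blast
          qed
          then show ?thesis using False by (simp add: B'_def)
        next
          case True
          have cB: "conn E (B v)" and vB: "v \<in> B v" using B[OF v(1)] by auto
          have "conn E' (B v - {u})" unfolding conn_def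
          proof (intro conjI allI impI)
            show "B v - {u} \<noteq> {}" using vB u(2) by auto
            fix S assume S: "S \<subset> B v - {u}" "S \<noteq> {}"
            show "\<exists>s\<in>S. \<exists>t\<in>B v - {u} - S. {s, t} \<in> E'"
            proof (cases "v \<in> S")
              case True
              \<comment> \<open>a cut with \<open>v\<close> in \<open>S\<close> lifts to the cut of \<open>B v\<close> that has \<open>u\<close> on the same side\<close>
              have "insert u S \<subset> B v" using S u(1) by blast
              then obtain s t where st: "s \<in> insert u S" "t \<in> B v - insert u S" "{s, t} \<in> E" using cB unfolding conn_def by blast
              have "{s, t} \<noteq> {v, u}" using st True by (auto simp: doubleton_eq_iff)
              then have "{h s, h t} \<in> E'" using st(3) by (intro E'I)
              moreover have "h s \<in> S" "h t = t" using st True by (auto simp: h_def)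
              ultimately show ?thesis using st by auto
            next
              case False
              have "S \<subset> B v" using S by blast
              then obtain s t where st: "s \<in> S" "t \<in> B v - S" "{s, t} \<in> E" using cB S(2) unfolding conn_def by blast
              have su: "s \<noteq> u" "s \<noteq> v" using st(1) S False by auto
              then have "{s, t} \<noteq> {v, u}" by (auto simp: doubleton_eq_iff)
              then have "{h s, h t} \<in> E'" using st(3) by (intro E'I)
              moreover have "h s = s" "h t \<in> B v - {u} - S" using st su False vB u(2) by (auto simp: h_def)
              ultimately show ?thesis using st by auto
            qed
          qed
          then show ?thesis using True by (simp add: B'_def)
        qed
      qed
    qed
    moreover have "minor_of (V, E) (V - {u}, E')"
      using minor_of.contract[OF minor_of.refl, of v u "(V, E)"] u contr by simp
    ultimately show ?thesis by (rule minor_trans)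
  qed
qed

text \<open>A representative of each branch set serves as the corresponding vertex of a copy of \<open>H\<close>.\<close>
lemma has_minor_isoI:
  fixes H :: "'b graph" and B :: "'b \<Rightarrow> 'a set"
  assumes simple: "simple_graph (V, E)"
    and B: "\<And>x. x \<in> fst H \<Longrightarrow> conn E (B x) \<and> B x \<subseteq> V"
    and disj: "\<And>x y. x \<in> fst H \<Longrightarrow> y \<in> fst H \<Longrightarrow> x \<noteq> y \<Longrightarrow> B x \<inter> B y = {}"
    and edges: "\<And>e. e \<in> snd H \<Longrightarrow> \<exists>x y s t. e = {x, y} \<and> x \<in> fst H \<and> y \<in> fst H \<and> x \<noteq> y \<and> s \<in> B x \<and> t \<in> B y \<and> {s, t} \<in> E"
  shows "has_minor_iso (V, E) H"
proof -
  define r where "r x = (SOME v. v \<in> B x)" for x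
  have r: "r x \<in> B x" if "x \<in> fst H" for x
  proof -
    have "\<exists>v. v \<in> B x" using B[OF that] by (auto simp: conn_def)
    then show ?thesis unfolding r_def by (rule someI_ex)
  qed
  have inj: "inj_on r (fst H)"
  proof (rule inj_onI)
    fix x y assume xy: "x \<in> fst H" "y \<in> fst H" "r x = r y"
    then have "r x \<in> B x \<inter> B y" using r[of x] r[of y] by auto
    then show "x = y" using disj[OF xy(1,2)] by blast
  qed
  define W where "W = r ` fst H"
  define f where "f = inv_into (fst H) r"
  have f: "f v \<in> fst H" "r (f v) = v" if "v \<in> W" for v
    using that by (auto simp: W_def f_def inv_into_into f_inv_into_f)
  have fr: "f (r x) = x" if "x \<in> fst H" for x using that inj by (simp add: f_def)
  define F where "F = (\<lambda>e. r ` e) ` snd H"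
  have sub: "e \<subseteq> fst H" if "e \<in> snd H" for e using edges[OF that] by auto
  have "minor_of (V, E) (W, F)"
  proof (rule minor_by_branch_sets[OF simple, where B = "\<lambda>v. B (f v)"])
    show "v \<in> B (f v) \<and> B (f v) \<subseteq> V \<and> conn E (B (f v))" if "v \<in> W" for v
      using B[OF f(1)[OF that]] r[OF f(1)[OF that]] f(2)[OF that] by simp
    show "B (f u) \<inter> B (f v) = {}" if uv: "u \<in> W" "v \<in> W" "u \<noteq> v" for u v
    proof (rule disj)
      show "f u \<noteq> f v" using f(2)[OF uv(1)] f(2)[OF uv(2)] uv(3) by auto
    qed (use f uv in auto)
    show "\<exists>u v s t. e = {u, v} \<and> u \<in> W \<and> v \<in> W \<and> u \<noteq> v \<and> s \<in> B (f u) \<and> t \<in> B (f v) \<and> {s, t} \<in> E" if e: "e \<in> F" for e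
    proof -
      obtain e0 where e0: "e0 \<in> snd H" "e = r ` e0" using e by (auto simp: F_def)
      obtain x y s t where *: "e0 = {x, y}" "x \<in> fst H" "y \<in> fst H" "x \<noteq> y" "s \<in> B x" "t \<in> B y" "{s, t} \<in> E"
        using edges[OF e0(1)] by blast
      have "r x \<noteq> r y" using inj * by (auto simp: inj_on_def)
      moreover have "e = {r x, r y}" using e0(2) *(1) by simp
      moreover have "r x \<in> W" "r y \<in> W" using * by (auto simp: W_def)
      moreover have "s \<in> B (f (r x))" "t \<in> B (f (r y))" using * fr by auto
      ultimately show ?thesis using *(7) by blast
    qed
  qed
  moreover have "graph_iso (W, F) H"
    unfolding graph_iso_def
  proof (intro exI[of _ f] conjI)
    show "bij_betw f (fst (W, F)) (fst H)"
      using inj by (simp add: f_def W_def bij_betw_inv_into inj_on_imp_bij_betw)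
    have "f ` r ` e = e" if "e \<in> snd H" for e
      using sub[OF that] fr by (force simp: image_iff)
    then show "(\<lambda>e. f ` e) ` snd (W, F) = snd H" by (force simp: F_def image_iff)
  qed
  ultimately show ?thesis unfolding has_minor_iso_def by blast
qed

section \<open>Minors of flattenable graphs; the graphs F3 and H3\<close>

text \<open>Weights of the contracted graph are moved to edges of the original one.  Several original
edges may become the same edge, so one of them is selected to carry the weight.  On configurations
in which \<open>u\<close> and \<open>v\<close> agree both energies are the same, and \<open>tight_edge\<close> preserves this agreement.\<close>
lemma flattenable_contract:
  fixes E :: "'a::finite set set"
  assumes flat: "flattenable E" and card: "\<And>e. e \<in> E \<Longrightarrow> card e = 2" and uv: "{u, v} \<in> E"
  shows "flattenable ((\<lambda>e. (\<lambda>x. if x = v then u else x) ` e) ` (E - {{u, v}}))"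
proof -
  define h where "h x = (if x = v then u else x)" for x
  define E' where "E' = (\<lambda>e. h ` e) ` (E - {{u, v}})"
  have "u \<noteq> v" using card[OF uv] by auto
  \<comment> \<open>the selected original of each edge\<close>
  define s where "s = inv_into (E - {{u, v}}) (\<lambda>e. h ` e)"
  have s: "s e \<in> E" "s e \<noteq> {u, v}" "h ` s e = e" if "e \<in> E'" for e
    using that inv_into_into[of e "\<lambda>e. h ` e" "E - {{u,v}}"] f_inv_into_f[of e "\<lambda>e. h ` e" "E - {{u,v}}"]
    by (auto simp: s_def E'_def)
  have pull: "energy (edge_weight (s e)) r = energy (edge_weight e) r"
    if e0: "e \<in> E'" "\<And>x. r (h x) = r x" for e and r :: "'a \<Rightarrow> 'e::real_inner"
  proof -
    obtain i j where ij: "s e = {i, j}" "i \<noteq> j" using card[OF s(1)[OF e0(1)]] unfolding card_2_iff by blast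
    then have e: "e = {h i, h j}" using s(3)[OF that(1)] by auto
    have "h i \<noteq> h j" using s(2)[OF that(1)] ij by (auto simp: h_def insert_commute split: if_splits)
    then show ?thesis using ij by (simp add: e energy_edge_weight that(2))
  qed
  have "flattenable E'"
    unfolding flattenable_def
  proof (intro allI impI)
    fix w and p :: "'a \<Rightarrow> real^'a" assume w: "supported w E'" and p: "unit_config p"
    define W where "W = (\<lambda>e. \<Sum>e'\<in>E'. w e' * edge_weight (s e') e)"
    have eq: "energy W r = energy w r" if "\<And>x. r (h x) = r x" for r :: "'a \<Rightarrow> 'e::real_inner"
    proof -
      have "energy W r = (\<Sum>e'\<in>E'. w e' * energy (edge_weight (s e')) r)"
        unfolding W_def by (subst energy_sum) (simp_all add: energy_scale)
      also have "\<dots> = (\<Sum>e'\<in>E'. w e' * energy (edge_weight e') r)"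
        using pull that by (intro sum.cong) auto
      also have "\<dots> = (\<Sum>e'\<in>UNIV. w e' * energy (edge_weight e') r)"
        using w by (intro sum.mono_neutral_left) (auto simp: supported_def)
      finally show ?thesis by (simp add: energy_edge_sum[symmetric])
    qed
    have W: "supported W E" unfolding W_def supported_def
      using s(1) by (auto simp: edge_weight_def intro!: sum.neutral)
    have "unit_config (p \<circ> h)" using p by (simp add: unit_config_def)
    moreover have "(p \<circ> h) v = 1 *\<^sub>R (p \<circ> h) u" by (simp add: h_def)
    ultimately obtain q :: "'a \<Rightarrow> complex" where q: "unit_config q" "q v = 1 *\<^sub>R q u" "energy W (p \<circ> h) \<le> energy W q"
      using tight_edge[OF flat card uv W] by (metis abs_one)
    have "energy w p = energy w (p \<circ> h)"
    proof (rule energy_cong)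
      fix i j assume "w {i,j} \<noteq> 0"
      then have "{i,j} \<in> E'" using w by (auto simp: supported_def)
      then have "v \<notin> {i, j}" using \<open>u \<noteq> v\<close> by (auto simp: E'_def h_def)
      then show "p i \<bullet> p j = (p \<circ> h) i \<bullet> (p \<circ> h) j" by (auto simp: h_def)
    qed
    also have "\<dots> = energy W (p \<circ> h)" by (rule eq[symmetric]) (simp add: h_def)
    also have "\<dots> \<le> energy W q" by (rule q(3))
    also have "\<dots> = energy w q" using q(2) by (intro eq) (simp add: h_def)
    finally show "\<exists>q :: 'a \<Rightarrow> complex. unit_config q \<and> energy w p \<le> energy w q" using q(1) by blast
  qed
  then show ?thesis by (simp add: E'_def h_def)
qed

lemma flattenable_minor:
  fixes G :: "'a::finite graph"
  assumes "minor_of G M" "simple_graph G" "flattenable (snd G)"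
  shows "flattenable (snd M)"
  using assms
proof (induction rule: minor_of.induct)
  case (contract M u v)
  have "simple_graph M" using simple_graph_minor contract by blast
  then show ?case using flattenable_contract[of "snd M" u v] contract
    by (simp add: contract_edge_def simple_graph_def)
qed (auto intro: flattenable_mono)

lemma graph_iso_embedding:
  assumes "graph_iso M H" "simple_graph M" "\<And>e. e \<in> snd H \<Longrightarrow> e \<subseteq> fst H"
  obtains g where "inj_on g (fst H)" "\<And>e. e \<in> snd H \<Longrightarrow> g ` e \<in> snd M"
proof -
  obtain f where f: "bij_betw f (fst M) (fst H)" "(\<lambda>e. f ` e) ` snd M = snd H"
    using assms(1) by (auto simp: graph_iso_def)
  define g where "g = inv_into (fst M) f"
  have "g ` e \<in> snd M" if e0: "e \<in> snd H" for e
  proof -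
    obtain e' where e': "e' \<in> snd M" "e = f ` e'" using e0 unfolding f(2)[symmetric] by blast
    moreover have "e' \<subseteq> fst M" using assms(2) e'(1) unfolding simple_graph_def by blast
    ultimately have "g ` e = e'"
      using f(1) by (simp add: g_def bij_betw_def inv_into_image_cancel)
    then show ?thesis using e' by simp
  qed
  moreover have "inj_on g (fst H)" unfolding g_def using f(1) bij_betw_inv_into bij_betw_def by blast
  ultimately show ?thesis using that by blast
qed

text \<open>Let \<open>D\<close> be the determinant of two vectors.  Lagrange's identity makes \<open>D a b\<close> and \<open>D a c\<close>
equal to \<open>\<plusminus> 1\<close>, while its polarized form makes their product vanish.\<close>
lemma no_three_orthonormal_complex:
  fixes a b c :: complex
  assumes "norm a = 1" "norm b = 1" "norm c = 1" "a \<bullet> b = 0" "a \<bullet> c = 0" "b \<bullet> c = 0"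
  shows False
proof -
  define D where "D x y = Re x * Im y - Im x * Re y" for x y :: complex
  have lag: "(norm x)\<^sup>2 * (norm y)\<^sup>2 = (x \<bullet> y)\<^sup>2 + (D x y)\<^sup>2" for x y
    unfolding cmod_power2 inner_complex_def D_def by (simp add: power2_eq_square algebra_simps)
  have "(D a b)\<^sup>2 = 1" "(D a c)\<^sup>2 = 1" using lag[of a b] lag[of a c] assms by simp_all
  moreover have "(b \<bullet> c) * (norm a)\<^sup>2 = (a \<bullet> b) * (a \<bullet> c) + D a b * D a c"
    unfolding cmod_power2 inner_complex_def D_def by (simp add: power2_eq_square algebra_simps)
  then have "D a b * D a c = 0" using assms by simp
  ultimately show False by auto
qed

lemma norm_sum_pair:
  fixes a b x :: "'e::real_inner"
  assumes "norm a = 1" "norm b = 1" "norm x = 1" "t * t = 1"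
  shows "(norm (sqrt 2 *\<^sub>R x - a - t *\<^sub>R b))\<^sup>2 = 4 + 2 * t * (a \<bullet> b) - 2 * sqrt 2 * (x \<bullet> a) - 2 * sqrt 2 * t * (x \<bullet> b)"
proof -
  have "a \<bullet> a = 1" "b \<bullet> b = 1" "x \<bullet> x = 1" using assms by (simp_all add: dot_square_norm)
  then show ?thesis using assms(4)
    by (simp add: power2_norm_eq_inner inner_diff_left inner_diff_right inner_commute algebra_simps)
qed

lemma orthogonal_of_midpoint:
  fixes a b x :: "'e::real_inner"
  assumes "norm a = 1" "norm b = 1" "norm x = 1" "t * t = 1" "norm (sqrt 2 *\<^sub>R x - a - t *\<^sub>R b) = 0"
  shows "a \<bullet> b = 0"
proof -
  have i: "a \<bullet> a = 1" "b \<bullet> b = 1" "x \<bullet> x = 1" using assms by (simp_all add: dot_square_norm)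
  have "sqrt 2 *\<^sub>R x = a + t *\<^sub>R b" using assms(5) by (simp add: algebra_simps)
  then have "(sqrt 2 *\<^sub>R x) \<bullet> (sqrt 2 *\<^sub>R x) = (a + t *\<^sub>R b) \<bullet> (a + t *\<^sub>R b)" by simp
  then have "2 = 2 + 2 * t * (a \<bullet> b)" using i assms(4)
    by (simp add: inner_add_left inner_add_right inner_commute algebra_simps)
  moreover have "t \<noteq> 0" using assms(4) by auto
  ultimately show ?thesis by simp
qed

text \<open>With weight -1 on the triangle and \<open>\<surd>2\<close> on the other edges, the energy is 12 minus the
squares of \<open>\<surd>2 x\<^sub>i\<^sub>j - v\<^sub>i - v\<^sub>j\<close>.  All of them vanish if the \<open>v\<^sub>i\<close> are orthonormal and \<open>x\<^sub>i\<^sub>j\<close> is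
the normalized midpoint, and only then, because the unit vector \<open>x\<^sub>i\<^sub>j\<close> forces \<open>v\<^sub>i + v\<^sub>j\<close> to have
length \<open>\<surd>2\<close>.\<close>
lemma F3_not_flattenable:
  fixes v1 v2 v3 x12 x13 x23 :: "'a::finite"
  assumes d: "distinct [v1, v2, v3, x12, x13, x23]"
    and e: "{{v1,v2},{v1,v3},{v2,v3},{v1,x12},{v2,x12},{v1,x13},{v3,x13},{v2,x23},{v3,x23}} \<subseteq> E"
  shows "\<not> flattenable E"
proof
  assume flat: "flattenable E"
  define w where "w = (\<lambda>e. (-1) * edge_weight {v1,v2} e + ((-1) * edge_weight {v1,v3} e + ((-1) * edge_weight {v2,v3} e
    + (sqrt 2 * edge_weight {v1,x12} e + (sqrt 2 * edge_weight {v2,x12} e + (sqrt 2 * edge_weight {v1,x13} e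
    + (sqrt 2 * edge_weight {v3,x13} e + (sqrt 2 * edge_weight {v2,x23} e + sqrt 2 * edge_weight {v3,x23} e))))))))"
  have w: "supported w E" unfolding w_def by (intro supported_add supported_edge_weight) (use e in auto)
  have en: "energy w q = 12 - (norm (sqrt 2 *\<^sub>R q x12 - q v1 - 1 *\<^sub>R q v2))\<^sup>2 - (norm (sqrt 2 *\<^sub>R q x13 - q v1 - 1 *\<^sub>R q v3))\<^sup>2
     - (norm (sqrt 2 *\<^sub>R q x23 - q v2 - 1 *\<^sub>R q v3))\<^sup>2" if "unit_config q" for q :: "'a \<Rightarrow> 'e::real_inner"
  proof -
    have n: "norm (q v) = 1" for v using that by (simp add: unit_config_def)
    show ?thesis
      unfolding w_def energy_add energy_scale norm_sum_pair[OF n n n mult_1]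
      using d by (simp add: energy_edge_weight inner_commute)
  qed
  let ?e = "\<lambda>v. axis v 1 :: real^'a"
  define p :: "'a \<Rightarrow> real^'a" where "p = (\<lambda>_. ?e v1)(v2 := ?e v2, v3 := ?e v3, x12 := (1 / sqrt 2) *\<^sub>R (?e v1 + ?e v2),
     x13 := (1 / sqrt 2) *\<^sub>R (?e v1 + ?e v3), x23 := (1 / sqrt 2) *\<^sub>R (?e v2 + ?e v3))"
  have half: "norm ((1 / sqrt 2) *\<^sub>R (?e a + ?e b)) = 1" if "a \<noteq> b" for a b
  proof -
    have "(norm (?e a + ?e b))\<^sup>2 = 2" using that
      by (simp add: power2_norm_eq_inner inner_add_left inner_add_right inner_axis_axis)
    then have "norm (?e a + ?e b) = sqrt 2" by (metis norm_ge_zero real_sqrt_unique)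
    then show ?thesis by simp
  qed
  have "unit_config (\<lambda>_::'a. ?e v1)" by (simp add: unit_config_def)
  then have p: "unit_config p" unfolding p_def by (intro unit_config_update half) (use d in auto)
  obtain q :: "'a \<Rightarrow> complex" where q: "unit_config q" "energy w p \<le> energy w q"
    using flat w p unfolding flattenable_def by blast
  have "p v1 = ?e v1" "p v2 = ?e v2" "p v3 = ?e v3" "p x12 = (1 / sqrt 2) *\<^sub>R (?e v1 + ?e v2)"
    "p x13 = (1 / sqrt 2) *\<^sub>R (?e v1 + ?e v3)" "p x23 = (1 / sqrt 2) *\<^sub>R (?e v2 + ?e v3)"
    using d by (auto simp: p_def)
  then have "energy w p = 12" unfolding en[OF p] by simp
  then have "(norm (sqrt 2 *\<^sub>R q x12 - q v1 - 1 *\<^sub>R q v2))\<^sup>2 + (norm (sqrt 2 *\<^sub>R q x13 - q v1 - 1 *\<^sub>R q v3))\<^sup>2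
     + (norm (sqrt 2 *\<^sub>R q x23 - q v2 - 1 *\<^sub>R q v3))\<^sup>2 \<le> 0" using q en[OF q(1)] by simp
  then have "norm (sqrt 2 *\<^sub>R q x12 - q v1 - 1 *\<^sub>R q v2) = 0" "norm (sqrt 2 *\<^sub>R q x13 - q v1 - 1 *\<^sub>R q v3) = 0"
     "norm (sqrt 2 *\<^sub>R q x23 - q v2 - 1 *\<^sub>R q v3) = 0"
    by (smt (verit) zero_le_power2 power2_eq_iff zero_eq_power2)+
  then have "q v1 \<bullet> q v2 = 0" "q v1 \<bullet> q v3 = 0" "q v2 \<bullet> q v3 = 0"
    using orthogonal_of_midpoint[OF _ _ _ mult_1] q(1) unfolding unit_config_def by metis+
  then show False using no_three_orthonormal_complex[of "q v1" "q v2" "q v3"] q(1) by (simp add: unit_config_def)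
qed

text \<open>The energy is 14 minus the squares of \<open>\<surd>2 v\<^sub>1\<^sub>2 - v\<^sub>1 + v\<^sub>2\<close>, of \<open>\<surd>2 v\<^sub>2\<^sub>3 - v\<^sub>2 + v\<^sub>3\<close> and
of \<open>\<surd>3 v\<^sub>1\<^sub>3 - v\<^sub>1 - v\<^sub>2 - v\<^sub>3\<close>.  The inner products of \<open>v\<^sub>1\<close>, \<open>v\<^sub>2\<close> and of \<open>v\<^sub>2\<close>, \<open>v\<^sub>3\<close>, which do
not belong to edges, cancel.  The first two squares make these pairs orthogonal, and then the
third one, by comparing lengths, makes \<open>v\<^sub>1\<close> and \<open>v\<^sub>3\<close> orthogonal.\<close>
lemma H3_not_flattenable:
  fixes v1 v2 v3 v12 v13 v23 :: "'a::finite"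
  assumes d: "distinct [v1, v2, v3, v12, v13, v23]"
    and e: "{{v1,v12},{v12,v2},{v2,v23},{v23,v3},{v1,v3},{v1,v13},{v2,v13},{v3,v13}} \<subseteq> E"
  shows "\<not> flattenable E"
proof
  assume flat: "flattenable E"
  define w where "w = (\<lambda>e. sqrt 2 * edge_weight {v1,v12} e + ((- sqrt 2) * edge_weight {v12,v2} e + (sqrt 2 * edge_weight {v2,v23} e
    + ((- sqrt 2) * edge_weight {v23,v3} e + ((-1) * edge_weight {v1,v3} e + (sqrt 3 * edge_weight {v1,v13} e
    + (sqrt 3 * edge_weight {v2,v13} e + sqrt 3 * edge_weight {v3,v13} e)))))))"
  have w: "supported w E" unfolding w_def by (intro supported_add supported_edge_weight) (use e in auto)
  have en: "energy w q = 14 - (norm (sqrt 2 *\<^sub>R q v12 - q v1 - (-1) *\<^sub>R q v2))\<^sup>2 - (norm (sqrt 2 *\<^sub>R q v23 - q v2 - (-1) *\<^sub>R q v3))\<^sup>2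
     - (norm (sqrt 3 *\<^sub>R q v13 - q v1 - q v2 - q v3))\<^sup>2" if "unit_config q" for q :: "'a \<Rightarrow> 'e::real_inner"
  proof -
    have n: "norm (q v) = 1" for v using that by (simp add: unit_config_def)
    have i: "q v \<bullet> q v = 1" for v using that by (simp add: unit_config_inner_self)
    have "(norm (sqrt 3 *\<^sub>R q v13 - q v1 - q v2 - q v3))\<^sup>2 = 6 + 2 * (q v1 \<bullet> q v2) + 2 * (q v1 \<bullet> q v3) + 2 * (q v2 \<bullet> q v3)
       - 2 * sqrt 3 * (q v13 \<bullet> q v1) - 2 * sqrt 3 * (q v13 \<bullet> q v2) - 2 * sqrt 3 * (q v13 \<bullet> q v3)"
      by (simp add: power2_norm_eq_inner inner_diff_left inner_diff_right inner_commute i algebra_simps)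
    moreover have "v12 \<noteq> v2" "v23 \<noteq> v3" using d by auto
    ultimately show ?thesis
      unfolding w_def energy_add energy_scale
      using d norm_sum_pair[OF n n n, of "-1" v12 v1 v2] norm_sum_pair[OF n n n, of "-1" v23 v2 v3]
      by (simp add: energy_edge_weight inner_commute)
  qed
  let ?e = "\<lambda>v. axis v 1 :: real^'a"
  define p :: "'a \<Rightarrow> real^'a" where "p = (\<lambda>_. ?e v1)(v2 := ?e v2, v3 := ?e v3, v12 := (1 / sqrt 2) *\<^sub>R (?e v1 - ?e v2),
     v23 := (1 / sqrt 2) *\<^sub>R (?e v2 - ?e v3), v13 := (1 / sqrt 3) *\<^sub>R (?e v1 + ?e v2 + ?e v3))"
  have half: "norm ((1 / sqrt 2) *\<^sub>R (?e a - ?e b)) = 1" if "a \<noteq> b" for a b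
  proof -
    have "(norm (?e a - ?e b))\<^sup>2 = 2" using that
      by (simp add: power2_norm_eq_inner inner_diff_left inner_diff_right inner_axis_axis)
    then have "norm (?e a - ?e b) = sqrt 2" by (metis norm_ge_zero real_sqrt_unique)
    then show ?thesis by simp
  qed
  have third: "norm ((1 / sqrt 3) *\<^sub>R (?e v1 + ?e v2 + ?e v3)) = 1"
  proof -
    have "(norm (?e v1 + ?e v2 + ?e v3))\<^sup>2 = 3" using d
      by (simp add: power2_norm_eq_inner inner_add_left inner_add_right inner_axis_axis eq_commute[of v2 v1] eq_commute[of v3 v1] eq_commute[of v3 v2])
    then have "norm (?e v1 + ?e v2 + ?e v3) = sqrt 3" by (rule real_sqrt_unique[symmetric]) simp
    then show ?thesis by simp
  qed
  have "unit_config (\<lambda>_::'a. ?e v1)" by (simp add: unit_config_def)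
  then have p: "unit_config p" unfolding p_def by (intro unit_config_update half third) (use d in auto)
  obtain q :: "'a \<Rightarrow> complex" where q: "unit_config q" "energy w p \<le> energy w q"
    using flat w p unfolding flattenable_def by blast
  have "p v1 = ?e v1" "p v2 = ?e v2" "p v3 = ?e v3" "p v12 = (1 / sqrt 2) *\<^sub>R (?e v1 - ?e v2)"
    "p v23 = (1 / sqrt 2) *\<^sub>R (?e v2 - ?e v3)" "p v13 = (1 / sqrt 3) *\<^sub>R (?e v1 + ?e v2 + ?e v3)"
    using d by (auto simp: p_def)
  then have "energy w p = 14" unfolding en[OF p] by simp
  then have le: "(norm (sqrt 2 *\<^sub>R q v12 - q v1 - (-1) *\<^sub>R q v2))\<^sup>2 + (norm (sqrt 2 *\<^sub>R q v23 - q v2 - (-1) *\<^sub>R q v3))\<^sup>2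
     + (norm (sqrt 3 *\<^sub>R q v13 - q v1 - q v2 - q v3))\<^sup>2 \<le> 0" using q en[OF q(1)] by simp
  have z: "x = 0" "y = 0" "z = 0" if "x\<^sup>2 + y\<^sup>2 + z\<^sup>2 \<le> 0" for x y z :: real
    using that by (smt (verit) zero_le_power2 power2_eq_iff zero_eq_power2)+
  have o: "q v1 \<bullet> q v2 = 0" "q v2 \<bullet> q v3 = 0"
    using orthogonal_of_midpoint[of _ _ _ "-1"] z(1,2)[OF le] q(1) unfolding unit_config_def by force+
  have i: "q v \<bullet> q v = 1" for v using q by (simp add: unit_config_inner_self)
  have "sqrt 3 *\<^sub>R q v13 = q v1 + q v2 + q v3" using z(3)[OF le] by (simp add: algebra_simps)
  then have "(sqrt 3 *\<^sub>R q v13) \<bullet> (sqrt 3 *\<^sub>R q v13) = (q v1 + q v2 + q v3) \<bullet> (q v1 + q v2 + q v3)" by simp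
  then have "q v1 \<bullet> q v3 = 0" using i o by (simp add: inner_add_left inner_add_right inner_commute)
  then show False using no_three_orthonormal_complex[of "q v1" "q v2" "q v3"] q(1) o by (simp add: unit_config_def)
qed

lemma F3_minor_not_flattenable:
  fixes G :: "'a::finite graph"
  assumes "simple_graph G" "has_minor_iso G F3" shows "\<not> flattenable (snd G)"
proof -
  obtain M where M: "minor_of G M" "graph_iso M F3" using assms(2) unfolding has_minor_iso_def by blast
  have sub: "e \<subseteq> fst F3" if "e \<in> snd F3" for e using that by (auto simp: F3_def)
  obtain g where g: "inj_on g (fst F3)" "\<And>e. e \<in> snd F3 \<Longrightarrow> g ` e \<in> snd M"
    using graph_iso_embedding[OF M(2) simple_graph_minor[OF M(1) assms(1)] sub] by blast
  have "distinct [g V1, g V2, g V3, g V12, g V13, g V23]" using g(1) by (auto simp: F3_def inj_on_def)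
  moreover have "(\<lambda>e. g ` e) ` snd F3 \<subseteq> snd M" using g(2) by blast
  ultimately have "\<not> flattenable (snd M)"
    by (intro F3_not_flattenable) (simp_all add: F3_def)
  then show ?thesis using flattenable_minor[OF M(1) assms(1)] by blast
qed

lemma H3_minor_not_flattenable:
  fixes G :: "'a::finite graph"
  assumes "simple_graph G" "has_minor_iso G H3" shows "\<not> flattenable (snd G)"
proof -
  obtain M where M: "minor_of G M" "graph_iso M H3" using assms(2) unfolding has_minor_iso_def by blast
  have sub: "e \<subseteq> fst H3" if "e \<in> snd H3" for e using that by (auto simp: H3_def)
  obtain g where g: "inj_on g (fst H3)" "\<And>e. e \<in> snd H3 \<Longrightarrow> g ` e \<in> snd M"
    using graph_iso_embedding[OF M(2) simple_graph_minor[OF M(1) assms(1)] sub] by blast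
  have "distinct [g V1, g V2, g V3, g V12, g V13, g V23]" using g(1) by (auto simp: H3_def inj_on_def)
  moreover have "(\<lambda>e. g ` e) ` snd H3 \<subseteq> snd M" using g(2) by blast
  ultimately have "\<not> flattenable (snd M)"
    by (intro H3_not_flattenable) (simp_all add: H3_def)
  then show ?thesis using flattenable_minor[OF M(1) assms(1)] by blast
qed

section \<open>Lowering the dimension of an optimal configuration\<close>

text \<open>Complete \<open>x0\<close> to a basis of the span of \<open>S\<close>; the image is spanned by the images of the
others.\<close>
lemma dim_image_less:
  fixes T :: "'e::euclidean_space \<Rightarrow> 'f::euclidean_space"
  assumes "linear T" "x0 \<in> span S" "x0 \<noteq> 0" "T x0 = 0"
  shows "dim (T ` S) < dim S"
proof -
  have "independent {x0}" using assms(3) by simp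
  moreover have "{x0} \<subseteq> span S" using assms(2) by simp
  ultimately obtain B where B: "{x0} \<subseteq> B" "B \<subseteq> span S" "independent B" "span S \<subseteq> span B"
    using maximal_independent_subset_extend by blast
  have fin: "finite B" using B(3) by (rule independent_imp_finite)
  have card: "card B = dim S" using B basis_card_eq_dim[of B "span S"] by simp
  have "T ` S \<subseteq> T ` span B" using B(4) span_superset by blast
  also have "\<dots> = span (T ` B)" by (rule linear_span_image[OF assms(1), symmetric])
  also have "T ` B = insert 0 (T ` (B - {x0}))" using B(1) assms(4) by auto
  also have "span \<dots> = span (T ` (B - {x0}))" by (rule span_insert_0)
  finally have "dim (T ` S) \<le> card (T ` (B - {x0}))" using fin by (intro dim_le_card) auto
  also have "\<dots> \<le> card (B - {x0})" using fin by (intro card_image_le) auto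
  also have "\<dots> < card B" using B(1) fin by (intro psubset_card_mono) auto
  finally show ?thesis using card by simp
qed

text \<open>Otherwise the form would be negative at \<open>x + s y\<close> for a small \<open>s\<close> of suitable sign.\<close>
lemma psd_null_vector:
  fixes B :: "'e::real_vector \<Rightarrow> 'e \<Rightarrow> real"
  assumes lin: "\<And>s y. B (x + s *\<^sub>R y) (x + s *\<^sub>R y) = B x x + 2 * s * B x y + s\<^sup>2 * B y y"
    and "\<And>z. 0 \<le> B z z" "B x x = 0"
  shows "B x y = 0"
proof (rule ccontr)
  assume ne: "B x y \<noteq> 0"
  define s where "s = - B x y / (B y y + 1)"
  have pos: "B y y + 1 > 0" using assms(2)[of y] by simp
  have "0 \<le> 2 * s * B x y + s\<^sup>2 * B y y" using assms(2)[of "x + s *\<^sub>R y"] lin[of s y] assms(3) by simp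
  also have "B x y = - s * (B y y + 1)" using pos by (simp add: s_def)
  also have "2 * s * (- s * (B y y + 1)) + s\<^sup>2 * B y y = - (s\<^sup>2 * (B y y + 2))"
    by (simp add: power2_eq_square algebra_simps)
  also have "\<dots> < 0" using ne pos assms(2)[of y] by (simp add: s_def)
  finally show False by simp
qed

text \<open>The Gram matrices with entries \<open>p i \<bullet> p j + \<epsilon> * (A (p i) \<bullet> p j)\<close> keep the unit diagonal, and
the energy is affine in \<open>\<epsilon>\<close>.  Move \<open>\<epsilon>\<close> in the direction in which the energy does not decrease
until the form \<open>B x y = x \<bullet> y + \<epsilon> * (A x \<bullet> y)\<close> stops being positive definite; this happens because
\<open>A\<close> takes both signs.  There \<open>B\<close> is still semidefinite, hence \<open>B x y = T x \<bullet> T y\<close> for a linear map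
\<open>T\<close>, and its kernel contains a nonzero vector of the span.\<close>
lemma lower_dimension_by_perturbation:
  fixes p :: "'a::finite \<Rightarrow> real^'a" and A :: "real^'a \<Rightarrow> real^'a"
  assumes p: "unit_config p" and A: "linear A" "\<And>x y. A x \<bullet> y = x \<bullet> A y" "range A \<subseteq> span (range p)"
    and diag: "\<And>v. A (p v) \<bullet> p v = 0" and z: "z \<in> span (range p)" "A z \<bullet> z \<noteq> 0"
  obtains T :: "real^'a \<Rightarrow> real^'a" where "linear T" "unit_config (T \<circ> p)" "energy w p \<le> energy w (T \<circ> p)"
    "dim (range (T \<circ> p)) < dim (range p)"
proof -
  have ex: "\<exists>i j. A (p i) \<bullet> p j \<noteq> 0"
  proof (rule ccontr)
    assume "\<not> ?thesis"
    then have "\<forall>y\<in>range p. A (p i) \<bullet> y = 0" for i by auto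
    then have 1: "A (p i) \<bullet> z = 0" for i using z(1) span_induct[of z "range p" "\<lambda>y. A (p i) \<bullet> y = 0"]
      by (auto simp: subspace_def inner_add_right)
    have "A z \<bullet> p k = 0" for k using A(2)[of z "p k"] 1[of k] by (simp add: inner_commute)
    then have "A z \<bullet> y = 0" if "y \<in> range p" for y using that by auto
    then have "A z \<bullet> z = 0" using z(1) span_induct[of z "range p" "\<lambda>y. A z \<bullet> y = 0"]
      by (auto simp: subspace_def inner_add_right)
    then show False using z(2) by simp
  qed
  then obtain i j where ij: "A (p i) \<bullet> p j \<noteq> 0" by blast
  define L where "L = (\<Sum>i\<in>UNIV. \<Sum>j\<in>UNIV. w {i, j} * (A (p i) \<bullet> p j))"
  \<comment> \<open>the sign for which moving along \<open>R\<close> does not decrease the energy\<close>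
  define \<sigma> :: real where "\<sigma> = (if L \<ge> 0 then 1 else - 1)"
  define R where "R x y = \<sigma> * (A x \<bullet> y)" for x y
  have Rlin: "R (x + s *\<^sub>R y) (x + s *\<^sub>R y) = R x x + 2 * s * R x y + s\<^sup>2 * R y y" for x y s
  proof -
    have "A y \<bullet> x = A x \<bullet> y" using A(2) by (metis inner_commute)
    then show ?thesis
      by (simp add: R_def linear_add[OF A(1)] linear_scale[OF A(1)] inner_add_left inner_add_right power2_eq_square algebra_simps)
  qed
  have \<sigma>: "\<sigma> \<noteq> 0" "\<sigma> * L \<ge> 0" by (auto simp: \<sigma>_def)
  \<comment> \<open>\<open>R\<close> vanishes at \<open>p i\<close> and \<open>p j\<close> but not at the pair, so it takes both signs on the plane
    through them\<close>
  obtain u where u: "R u u < 0"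
  proof -
    have e: "R (p i + s *\<^sub>R p j) (p i + s *\<^sub>R p j) = 2 * s * R (p i) (p j)" for s
      using diag by (simp add: Rlin) (simp add: R_def)
    have "R (p i) (p j) \<noteq> 0" using ij \<sigma> by (simp add: R_def)
    then have "0 < R (p i) (p j) * R (p i) (p j)" using not_real_square_gt_zero by blast
    then have "2 * (- R (p i) (p j)) * R (p i) (p j) < 0" by simp
    then have "R (p i + (- R (p i) (p j)) *\<^sub>R p j) (p i + (- R (p i) (p j)) *\<^sub>R p j) < 0"
      unfolding e .
    then show ?thesis using that by blast
  qed
  have "u \<noteq> 0" using u A(1) by (auto simp: R_def linear_0)
  have Rscale: "R (c *\<^sub>R x) (c *\<^sub>R x) = c\<^sup>2 * R x x" for c x
    by (simp add: R_def linear_scale[OF A(1)] power2_eq_square)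
  have "continuous_on (sphere 0 1) (\<lambda>x. R x x)" unfolding R_def
    using A(1) by (intro continuous_intros linear_continuous_on) (simp add: linear_conv_bounded_linear)
  moreover have "sphere (0::real^'a) 1 \<noteq> {}"
    using p by (auto simp: unit_config_def intro!: exI[of _ "p i"])
  ultimately obtain x0 where x0: "norm x0 = 1" "\<And>x. norm x = 1 \<Longrightarrow> R x0 x0 \<le> R x x"
    using continuous_attains_inf[OF compact_sphere, of 0 1 "\<lambda>x. R x x"] by auto
  \<comment> \<open>the negative of the smallest eigenvalue of \<open>R\<close>, so that \<open>1 / \<mu>\<close> is the largest admissible
    step\<close>
  define \<mu> where "\<mu> = - R x0 x0"
  have "R x0 x0 \<le> R ((1 / norm u) *\<^sub>R u) ((1 / norm u) *\<^sub>R u)" using \<open>u \<noteq> 0\<close> by (intro x0(2)) simp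
  also have "\<dots> < 0" unfolding Rscale using u \<open>u \<noteq> 0\<close> by (intro mult_pos_neg) auto
  finally have \<mu>: "\<mu> > 0" by (simp add: \<mu>_def)
  have low: "- \<mu> * (norm x)\<^sup>2 \<le> R x x" for x
  proof (cases "x = 0")
    case True then show ?thesis using A(1) by (simp add: R_def linear_0)
  next
    case False
    then have "R x0 x0 \<le> R ((1 / norm x) *\<^sub>R x) ((1 / norm x) *\<^sub>R x)" by (intro x0(2)) simp
    also have "\<dots> = R x x / (norm x)\<^sup>2" unfolding Rscale by (simp add: power_one_over)
    finally show ?thesis using False by (simp add: \<mu>_def field_simps)
  qed
  define B where "B x y = x \<bullet> y + R x y / \<mu>" for x y
  have Bpsd: "0 \<le> B x x" for x
    using low[of x] \<mu> by (simp add: B_def power2_norm_eq_inner field_simps)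
  have B0: "B x0 x0 = 0" using x0(1) \<mu> by (simp add: B_def \<mu>_def dot_square_norm)
  have Blin: "B (x + s *\<^sub>R y) (x + s *\<^sub>R y) = B x x + 2 * s * B x y + s\<^sup>2 * B y y" for x y s
    unfolding B_def Rlin by (simp add: inner_add_left inner_add_right inner_commute power2_eq_square add_divide_distrib algebra_simps)
  have Bx0: "B x0 y = 0" for y by (rule psd_null_vector[of B x0, OF Blin Bpsd B0])
  \<comment> \<open>\<open>x0\<close> is an eigenvector for a nonzero eigenvalue, hence in the range of \<open>A\<close>\<close>
  have "x0 \<in> span (range p)"
  proof -
    have "(x0 + (\<sigma> / \<mu>) *\<^sub>R A x0) \<bullet> y = 0" for y using Bx0[of y] by (simp add: B_def R_def inner_add_left)
    then have "x0 + (\<sigma> / \<mu>) *\<^sub>R A x0 = 0" by (metis inner_eq_zero_iff)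
    then have "x0 = (- \<sigma> / \<mu>) *\<^sub>R A x0" by (simp add: eq_neg_iff_add_eq_0)
    then show ?thesis using A(3) by (metis rangeI span_scale subsetD)
  qed
  have Bsym: "B x y = B y x" for x y using A(2)[of x y] by (simp add: B_def R_def inner_commute)
  have Bsum: "B (\<Sum>i\<in>UNIV. c i *\<^sub>R f i) (\<Sum>j\<in>UNIV. d j *\<^sub>R h j) = (\<Sum>i\<in>UNIV. \<Sum>j\<in>UNIV. c i * d j * B (f i) (h j))"
    for c d :: "'a \<Rightarrow> real" and f h :: "'a \<Rightarrow> real^'a"
  proof -
    define C where "C x = x + (\<sigma> / \<mu>) *\<^sub>R A x" for x
    have "linear C" unfolding C_def by (intro linear_compose_add linear_id[unfolded id_def] linear_compose_scale_right A(1))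
    moreover have BC: "B x y = C x \<bullet> y" for x y by (simp add: B_def R_def C_def inner_add_left)
    ultimately show ?thesis
      unfolding BC linear_sum[OF \<open>linear C\<close>] linear_scale[OF \<open>linear C\<close>] inner_sum_left
      unfolding inner_sum_right by (intro sum.cong) (simp_all add: linear_scale)
  qed
  have expand: "x = (\<Sum>i\<in>UNIV. (x $ i) *\<^sub>R axis i 1)" for x :: "real^'a"
    by (simp add: vec_eq_iff axis_def if_distrib cong: if_cong)
  have "0 \<le> (\<Sum>i\<in>UNIV. \<Sum>j\<in>UNIV. c i * c j * B (axis i 1) (axis j 1))" for c
    using Bpsd[of "\<Sum>i\<in>UNIV. c i *\<^sub>R axis i 1"] by (simp add: Bsum)
  then obtain g :: "'a \<Rightarrow> real^'a" where g: "\<And>i j. g i \<bullet> g j = B (axis i 1) (axis j 1)"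
    using gram_factorization[of "\<lambda>i j. B (axis i 1) (axis j 1)"] Bsym by blast
  define T where "T x = (\<Sum>i\<in>UNIV. (x $ i) *\<^sub>R g i)" for x :: "real^'a"
  have linT: "linear T" unfolding T_def
    by (rule linearI) (simp_all add: scaleR_add_left sum.distrib scaleR_sum_right)
  have T: "T x \<bullet> T y = B x y" for x y
  proof -
    have "T x \<bullet> T y = (\<Sum>i\<in>UNIV. \<Sum>j\<in>UNIV. x $ i * y $ j * B (axis i 1) (axis j 1))"
      unfolding T_def inner_sum_left unfolding inner_sum_right by (intro sum.cong) (simp_all add: g)
    also have "\<dots> = B x y" using Bsum[of "\<lambda>i. x $ i" "\<lambda>i. axis i 1" "\<lambda>j. y $ j" "\<lambda>j. axis j 1"] expand[of x] expand[of y] by simp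
    finally show ?thesis .
  qed
  have "unit_config (T \<circ> p)"
    unfolding unit_config_def
  proof
    fix v
    have "T (p v) \<bullet> T (p v) = 1" using p diag by (simp add: T B_def R_def unit_config_inner_self)
    then show "norm ((T \<circ> p) v) = 1" by (simp add: norm_eq_sqrt_inner)
  qed
  moreover have "energy w (T \<circ> p) = energy w p + \<sigma> * L / \<mu>"
  proof -
    have "energy w (T \<circ> p) = (\<Sum>i\<in>UNIV. \<Sum>j\<in>UNIV. w {i, j} * (p i \<bullet> p j) + (\<sigma> / \<mu>) * (w {i, j} * (A (p i) \<bullet> p j)))"
      unfolding energy_def by (intro sum.cong) (simp_all add: T B_def R_def algebra_simps)
    then show ?thesis by (simp add: energy_def L_def sum.distrib sum_distrib_left sum_divide_distrib)
  qed
  then have "energy w p \<le> energy w (T \<circ> p)" using \<sigma> \<mu> by simp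
  moreover have "T x0 = 0" using T[of x0 x0] B0 by simp
  then have "dim (T ` range p) < dim (range p)"
    using x0(1) by (intro dim_image_less[OF linT \<open>x0 \<in> span (range p)\<close>]) auto
  then have "dim (range (T \<circ> p)) < dim (range p)" by (simp add: image_comp)
  ultimately show ?thesis using that linT by blast
qed

definition optimal :: "('a::finite set \<Rightarrow> real) \<Rightarrow> ('a \<Rightarrow> 'e::real_inner) \<Rightarrow> bool" where
  "optimal w p \<longleftrightarrow> unit_config p \<and> (\<forall>p' :: 'a \<Rightarrow> 'e. unit_config p' \<longrightarrow> energy w p' \<le> energy w p)"

lemma optimal_exists:
  obtains p :: "'a::finite \<Rightarrow> real^'a" where "optimal w p"
proof -
  have u0: "unit_config (\<lambda>v. axis v 1 :: real^'a)" by (simp add: unit_config_def)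
  obtain p :: "'a \<Rightarrow> real^'a" where "unit_config p"
      "\<And>p' :: 'a \<Rightarrow> real^'a. p' \<in> UNIV \<Longrightarrow> unit_config p' \<Longrightarrow> energy w p' \<le> energy w p"
    using optimal_config_exists[OF closed_UNIV UNIV_I u0, of w] by blast
  then have "optimal w p" by (simp add: optimal_def)
  then show ?thesis using that by blast
qed

text \<open>By induction on the dimension of an optimal configuration: from dimension three on, a
quadratic form vanishing at its vectors lowers the dimension, and the new configuration is again
optimal; the other alternative of the step is to flatten directly.  Up to dimension two the
configuration already fits into the plane.\<close>
lemma flattenable_by_perturbation:
  fixes E :: "'a::finite set set"
  assumes V: "V \<noteq> {}" "\<And>e. e \<in> E \<Longrightarrow> e \<subseteq> V"
    and step: "\<And>w (p :: 'a \<Rightarrow> real^'a). supported w E \<Longrightarrow> optimal w p \<Longrightarrow> range p = p ` V \<Longrightarrow> 3 \<le> dim (range p) \<Longrightarrow>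
      (\<exists>q :: 'a \<Rightarrow> complex. unit_config q \<and> energy w p \<le> energy w q) \<or>
      (\<exists>A z. linear A \<and> (\<forall>x y. A x \<bullet> y = x \<bullet> A y) \<and> range A \<subseteq> span (range p) \<and> (\<forall>v. A (p v) \<bullet> p v = 0) \<and>
        z \<in> span (range p) \<and> A z \<bullet> z \<noteq> 0)"
  shows "flattenable E"
  unfolding flattenable_def
proof (intro allI impI)
  fix w and p0 :: "'a \<Rightarrow> real^'a" assume w: "supported w E" and p0: "unit_config p0"
  obtain v0 where v0: "v0 \<in> V" using V by blast
  have main: "\<exists>q :: 'a \<Rightarrow> complex. unit_config q \<and> energy w p \<le> energy w q"
    if "optimal w p" "range p = p ` V" for p :: "'a \<Rightarrow> real^'a"
    using that
  proof (induction "dim (range p)" arbitrary: p rule: less_induct)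
    case less
    show ?case
    proof (cases "dim (range p) \<le> 2")
      case True
      then obtain f :: "real^'a \<Rightarrow> complex" where f: "\<And>x y. x \<in> range p \<Longrightarrow> y \<in> range p \<Longrightarrow> f x \<bullet> f y = x \<bullet> y"
        using plane_to_complex by blast
      have "unit_config (f \<circ> p)" using less.prems(1) f by (simp add: optimal_def unit_config_def norm_eq_sqrt_inner)
      moreover have "energy w (f \<circ> p) = energy w p" by (rule energy_cong) (simp add: f)
      ultimately show ?thesis by (metis order_refl)
    next
      case False
      then have "3 \<le> dim (range p)" by simp
      from step[OF w less.prems this] show ?thesis
      proof
        assume "\<exists>A z. linear A \<and> (\<forall>x y. A x \<bullet> y = x \<bullet> A y) \<and> range A \<subseteq> span (range p) \<and> (\<forall>v. A (p v) \<bullet> p v = 0) \<and>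
          z \<in> span (range p) \<and> A z \<bullet> z \<noteq> 0"
        then obtain A :: "real^'a \<Rightarrow> real^'a" and z where A: "linear A" "\<And>x y. A x \<bullet> y = x \<bullet> A y" "range A \<subseteq> span (range p)"
          "\<And>v. A (p v) \<bullet> p v = 0" "z \<in> span (range p)" "A z \<bullet> z \<noteq> 0" by blast
        have u: "unit_config p" using less.prems(1) by (simp add: optimal_def)
        obtain T :: "real^'a \<Rightarrow> real^'a" where T: "unit_config (T \<circ> p)" "energy w p \<le> energy w (T \<circ> p)"
          "dim (range (T \<circ> p)) < dim (range p)"
          using lower_dimension_by_perturbation[OF u A, of w] by blast
        have "optimal w (T \<circ> p)" using T(1,2) less.prems(1) unfolding optimal_def by (meson order_trans)
        moreover have "range (T \<circ> p) = (T \<circ> p) ` V" using less.prems(2) by (metis image_comp)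
        ultimately obtain q :: "'a \<Rightarrow> complex" where "unit_config q" "energy w (T \<circ> p) \<le> energy w q"
          using less.hyps[OF T(3)] by blast
        then show ?thesis using T(2) by (meson order_trans)
      qed
    qed
  qed
  obtain p1 :: "'a \<Rightarrow> real^'a" where p1: "optimal w p1" using optimal_exists by blast
  \<comment> \<open>Vertices outside \<open>V\<close> have no edges; giving them a vector used in \<open>V\<close> makes the range the
    image of \<open>V\<close>.\<close>
  define p where "p v = (if v \<in> V then p1 v else p1 v0)" for v
  have e: "energy w p = energy w p1"
    by (rule energy_cong) (use w V(2) in \<open>force simp: p_def supported_def\<close>)
  moreover have "unit_config p" using p1 by (simp add: p_def optimal_def unit_config_def)
  ultimately have "optimal w p" using p1 by (simp add: optimal_def)
  moreover have "range p = p ` V" using v0 by (auto simp: p_def image_def)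
  ultimately obtain q :: "'a \<Rightarrow> complex" where "unit_config q" "energy w p \<le> energy w q" using main by blast
  moreover have "energy w p0 \<le> energy w p" using p0 p1 e by (simp add: optimal_def)
  ultimately show "\<exists>q :: 'a \<Rightarrow> complex. unit_config q \<and> energy w p0 \<le> energy w q" by (meson order_trans)
qed

section \<open>Conics through the vectors of a configuration\<close>

lemma vector_orthogonal_to_two:
  fixes m1 m2 :: "real^3"
  obtains r :: "real^3" where "r \<noteq> 0" "m1 \<bullet> r = 0" "m2 \<bullet> r = 0"
proof -
  have "dim {m1, m2} \<le> card {m1, m2}" by (rule dim_le_card) (auto simp: span_superset)
  also have "\<dots> \<le> 2" by (simp add: card_insert_if)
  finally have "dim {m1, m2} < DIM(real^3)" by simp
  then obtain r where "r \<noteq> 0" "\<And>y. y \<in> span {m1, m2} \<Longrightarrow> orthogonal r y"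
    using orthogonal_to_subspace_exists by blast
  then have "m1 \<bullet> r = 0" "m2 \<bullet> r = 0"
    by (auto simp: orthogonal_def inner_commute span_base)
  then show ?thesis using that \<open>r \<noteq> 0\<close> by blast
qed

text \<open>The symmetric operator whose quadratic form vanishes exactly on the union of the two
hyperplanes orthogonal to \<open>m\<close> and to \<open>n\<close>.\<close>
definition outer_sym :: "'e::real_inner \<Rightarrow> 'e \<Rightarrow> 'e \<Rightarrow> 'e" where
  "outer_sym m n x = (m \<bullet> x) *\<^sub>R n + (n \<bullet> x) *\<^sub>R m"

lemma linear_outer_sym: "linear (outer_sym m n)"
  unfolding outer_sym_def by (rule linearI) (simp_all add: inner_add_right algebra_simps)

lemma outer_sym_self_adjoint: "outer_sym m n x \<bullet> y = x \<bullet> outer_sym m n y"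
  by (simp add: outer_sym_def inner_add_left inner_add_right inner_commute)

lemma outer_sym_quadratic: "outer_sym m n x \<bullet> x = 2 * (m \<bullet> x) * (n \<bullet> x)"
  by (simp add: outer_sym_def inner_add_left)

text \<open>The component of \<open>b\<close> orthogonal to the other vectors of \<open>B\<close>, up to a factor.\<close>
lemma dual_vector:
  fixes B :: "'e::euclidean_space set"
  assumes "independent B" "b \<in> B"
  obtains n where "n \<in> span B" "n \<bullet> b \<noteq> 0" "\<And>b'. b' \<in> B - {b} \<Longrightarrow> n \<bullet> b' = 0"
proof -
  have "b \<notin> span (B - {b})" using assms by (auto simp: dependent_def)
  moreover have "b \<in> span B" using assms(2) by (rule span_base)
  moreover have "span (B - {b}) \<subseteq> span B" by (rule span_mono) auto
  ultimately have "span (B - {b}) \<subset> span B" by blast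
  then obtain n where n: "n \<noteq> 0" "n \<in> span B" "\<And>y. y \<in> span (B - {b}) \<Longrightarrow> orthogonal n y"
    using orthogonal_to_subspace_exists_gen by blast
  have z: "n \<bullet> b' = 0" if "b' \<in> B - {b}" for b' using n(3) that by (auto simp: orthogonal_def span_base)
  have "n \<bullet> b \<noteq> 0"
  proof
    assume "n \<bullet> b = 0"
    then have "n \<bullet> y = 0" if "y \<in> B" for y using z that by auto
    then have "n \<bullet> n = 0" using n(2) span_induct[of n B "\<lambda>y. n \<bullet> y = 0"]
      by (auto simp: subspace_def inner_add_right)
    then show False using n(1) by simp
  qed
  then show ?thesis using that n(2) z by blast
qed

text \<open>Let \<open>x\<^sub>1\<close>, \<open>x\<^sub>2\<close>, \<open>x\<^sub>3\<close> be the coordinates for three of the basis vectors.  A form \<open>r\<^sub>1 x\<^sub>2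
x\<^sub>3 + r\<^sub>2 x\<^sub>1 x\<^sub>3 + r\<^sub>3 x\<^sub>1 x\<^sub>2\<close> vanishes at every basis vector, and vanishing at \<open>c1\<close> and \<open>c2\<close>
are two linear conditions on its three coefficients.\<close>
lemma conic_through_basis_and_two:
  fixes B :: "'e::euclidean_space set"
  assumes B: "independent B" "3 \<le> card B"
  obtains A z where "linear A" "\<And>x y. A x \<bullet> y = x \<bullet> A y" "range A \<subseteq> span B" "\<And>b. b \<in> B \<Longrightarrow> A b \<bullet> b = 0"
    "A c1 \<bullet> c1 = 0" "A c2 \<bullet> c2 = 0" "z \<in> span B" "A z \<bullet> z \<noteq> 0"
proof -
  obtain B3 where "B3 \<subseteq> B" "card B3 = 3" using B(2) by (meson obtain_subset_with_card_n)
  then obtain b1 b2 b3 where b: "b1 \<in> B" "b2 \<in> B" "b3 \<in> B" "b1 \<noteq> b2" "b1 \<noteq> b3" "b2 \<noteq> b3"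
    by (auto simp: card_3_iff)
  obtain n1 where n1: "n1 \<in> span B" "n1 \<bullet> b1 \<noteq> 0" "\<And>b'. b' \<in> B - {b1} \<Longrightarrow> n1 \<bullet> b' = 0"
    using dual_vector[OF B(1) b(1)] by blast
  obtain n2 where n2: "n2 \<in> span B" "n2 \<bullet> b2 \<noteq> 0" "\<And>b'. b' \<in> B - {b2} \<Longrightarrow> n2 \<bullet> b' = 0"
    using dual_vector[OF B(1) b(2)] by blast
  obtain n3 where n3: "n3 \<in> span B" "n3 \<bullet> b3 \<noteq> 0" "\<And>b'. b' \<in> B - {b3} \<Longrightarrow> n3 \<bullet> b' = 0"
    using dual_vector[OF B(1) b(3)] by blast
  define m :: "'e \<Rightarrow> real^3" where
    "m c = vector [(n2 \<bullet> c) * (n3 \<bullet> c), (n1 \<bullet> c) * (n3 \<bullet> c), (n1 \<bullet> c) * (n2 \<bullet> c)]" for c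
  obtain r :: "real^3" where r: "r \<noteq> 0" "m c1 \<bullet> r = 0" "m c2 \<bullet> r = 0" 
    using vector_orthogonal_to_two[of "m c1" "m c2"] by blast
  define A where "A x = (r $ 1) *\<^sub>R outer_sym n2 n3 x + (r $ 2) *\<^sub>R outer_sym n1 n3 x + (r $ 3) *\<^sub>R outer_sym n1 n2 x" for x
  have quad: "A x \<bullet> x = 2 * (m x \<bullet> r)" for x
    by (simp add: A_def inner_add_left outer_sym_quadratic m_def inner_vec_def sum_3 algebra_simps)
  have "linear A" unfolding A_def
    by (intro linear_compose_add linear_compose_scale_right linear_outer_sym)
  moreover have "A x \<bullet> y = x \<bullet> A y" for x y
    by (simp add: A_def inner_add_left inner_add_right outer_sym_self_adjoint)
  moreover have "range A \<subseteq> span B"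
    unfolding A_def outer_sym_def using n1(1) n2(1) n3(1) by (auto intro!: span_add span_scale)
  moreover have "A b' \<bullet> b' = 0" if "b' \<in> B" for b'
  proof -
    have "m b' = 0" using that n1(3)[of b'] n2(3)[of b'] n3(3)[of b'] b
      by (auto simp: m_def vec_eq_iff forall_3)
    then show ?thesis by (simp add: quad)
  qed
  moreover obtain z where "z \<in> span B" "A z \<bullet> z \<noteq> 0"
  proof -
  have "\<exists>z\<in>span B. A z \<bullet> z \<noteq> 0"
  proof -
    have n: "n1 \<bullet> b2 = 0" "n1 \<bullet> b3 = 0" "n2 \<bullet> b1 = 0" "n2 \<bullet> b3 = 0" "n3 \<bullet> b1 = 0" "n3 \<bullet> b2 = 0"
      using n1 n2 n3 b by auto
    have "r $ 1 \<noteq> 0 \<or> r $ 2 \<noteq> 0 \<or> r $ 3 \<noteq> 0" using r(1) by (auto simp: vec_eq_iff forall_3)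
    then consider "r $ 1 \<noteq> 0" | "r $ 2 \<noteq> 0" | "r $ 3 \<noteq> 0" by blast
    then show ?thesis
    proof cases
      case 1
      have "A (b2 + b3) \<bullet> (b2 + b3) = 2 * ((n2 \<bullet> b2) * (n3 \<bullet> b3) * r $ 1)"
        unfolding quad m_def by (simp add: inner_vec_def sum_3 inner_add_right n)
      then show ?thesis using 1 n1(2) n2(2) n3(2) b
        by (intro bexI[of _ "b2 + b3"]) (auto intro: span_add span_base)
    next
      case 2
      have "A (b1 + b3) \<bullet> (b1 + b3) = 2 * ((n1 \<bullet> b1) * (n3 \<bullet> b3) * r $ 2)"
        unfolding quad m_def by (simp add: inner_vec_def sum_3 inner_add_right n)
      then show ?thesis using 2 n1(2) n2(2) n3(2) b
        by (intro bexI[of _ "b1 + b3"]) (auto intro: span_add span_base)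
    next
      case 3
      have "A (b1 + b2) \<bullet> (b1 + b2) = 2 * ((n1 \<bullet> b1) * (n2 \<bullet> b2) * r $ 3)"
        unfolding quad m_def by (simp add: inner_vec_def sum_3 inner_add_right n)
      then show ?thesis using 3 n1(2) n2(2) n3(2) b
        by (intro bexI[of _ "b1 + b2"]) (auto intro: span_add span_base)
    qed
  qed
  then show ?thesis using that by blast
  qed
  moreover have "A c1 \<bullet> c1 = 0" "A c2 \<bullet> c2 = 0" using r(2,3) by (simp_all add: quad)
  ultimately show ?thesis using that[of A z] by blast
qed

lemma card_le_2_cases:
  assumes "finite S" "card S \<le> 2" obtains c1 c2 where "S \<subseteq> {c1, c2}"
proof -
  consider "card S = 0" | "card S = 1" | "card S = 2" using assms(2) by linarith
  then show ?thesis using assms(1) that by cases (auto simp: card_1_singleton_iff card_2_iff)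
qed

text \<open>A basis chosen among the vectors of the configuration leaves at most two of them.\<close>
lemma conic_through_few_points:
  fixes p :: "'a::finite \<Rightarrow> 'e::euclidean_space"
  assumes "card (range p) \<le> dim (range p) + 2" "3 \<le> dim (range p)"
  shows "\<exists>A z. linear A \<and> (\<forall>x y. A x \<bullet> y = x \<bullet> A y) \<and> range A \<subseteq> span (range p) \<and> (\<forall>v. A (p v) \<bullet> p v = 0) \<and>
        z \<in> span (range p) \<and> A z \<bullet> z \<noteq> 0"
proof -
  obtain B where B: "B \<subseteq> range p" "independent B" "range p \<subseteq> span B" "card B = dim (range p)"
    using basis_exists by blast
  have "finite (range p)" by simp
  then have "card (range p - B) \<le> 2" using B(1,4) assms(1) by (simp add: card_Diff_subset finite_subset)
  then obtain c1 c2 where c: "range p - B \<subseteq> {c1, c2}" using card_le_2_cases[of "range p - B"] by auto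
  have "3 \<le> card B" using B(4) assms(2) by simp
  from conic_through_basis_and_two[OF B(2) this, of c1 c2]
  obtain A z where A: "linear A" "\<And>x y. A x \<bullet> y = x \<bullet> A y" "range A \<subseteq> span B" "\<And>b. b \<in> B \<Longrightarrow> A b \<bullet> b = 0"
    "A c1 \<bullet> c1 = 0" "A c2 \<bullet> c2 = 0" "z \<in> span B" "A z \<bullet> z \<noteq> 0" by blast
  have "A (p v) \<bullet> p v = 0" for v using c A(4-6) by (cases "p v \<in> B") auto
  moreover have "span B = span (range p)" using B(1,3) span_mono span_superset by (metis span_minimal subspace_span subset_antisym)
  ultimately show ?thesis using A by metis
qed

text \<open>In dimension three or more, five vectors are at most two more than the dimension.\<close>
lemma flattenable_card_le_5:
  fixes E :: "'a::finite set set"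
  assumes "\<And>e. e \<in> E \<Longrightarrow> e \<subseteq> V" "card V \<le> 5"
  shows "flattenable E"
proof (cases "V = {}")
  case True
  then have "E \<subseteq> {{}}" using assms by auto
  then have "energy w p = 0" if w: "supported w E" for w and p :: "'a \<Rightarrow> 'e::real_inner"
  proof -
    have "w {i, j} = 0" for i j using w \<open>E \<subseteq> {{}}\<close> by (auto simp: supported_def)
    then show ?thesis by (simp add: energy_def)
  qed
  moreover have "unit_config (\<lambda>_::'a. 1::complex)" by (simp add: unit_config_def)
  ultimately show ?thesis unfolding flattenable_def by (metis order_refl)
next
  case False
  show ?thesis
  proof (rule flattenable_by_perturbation[OF False assms(1)])
    fix w and p :: "'a \<Rightarrow> real^'a" assume "range p = p ` V" "3 \<le> dim (range p)"
    moreover have "card (p ` V) \<le> card V" by (intro card_image_le) simp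
    ultimately have "card (range p) \<le> dim (range p) + 2" using assms(2) by simp
    from conic_through_few_points[OF this \<open>3 \<le> dim (range p)\<close>]
    show "(\<exists>q :: 'a \<Rightarrow> complex. unit_config q \<and> energy w p \<le> energy w q) \<or>
      (\<exists>A z. linear A \<and> (\<forall>x y. A x \<bullet> y = x \<bullet> A y) \<and> range A \<subseteq> span (range p) \<and> (\<forall>v. A (p v) \<bullet> p v = 0) \<and>
        z \<in> span (range p) \<and> A z \<bullet> z \<noteq> 0)" by blast
  qed
qed

text \<open>Half the gradient of the energy with respect to the vector at \<open>v\<close>.\<close>
definition field_at :: "('a::finite set \<Rightarrow> real) \<Rightarrow> ('a \<Rightarrow> 'e::real_vector) \<Rightarrow> 'a \<Rightarrow> 'e" where
  "field_at w p v = (\<Sum>j\<in>UNIV. w {v, j} *\<^sub>R p j)"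

text \<open>Turning \<open>p v\<close> into the direction of the field cannot increase the energy, so it already has
that direction.\<close>
lemma optimal_stationary:
  assumes "optimal w p" "w {v} = 0"
  shows "field_at w p v = norm (field_at w p v) *\<^sub>R p v"
proof (cases "field_at w p v = 0")
  case False
  define g where "g = field_at w p v"
  have u: "unit_config p" and n: "norm (p v) = 1" using assms(1) by (auto simp: optimal_def unit_config_def)
  have "unit_config (p(v := (1 / norm g) *\<^sub>R g))" using False by (intro unit_config_update u) (simp add: g_def)
  then have "energy w (p(v := (1 / norm g) *\<^sub>R g)) \<le> energy w p" using assms(1) by (simp add: optimal_def)
  then have "((1 / norm g) *\<^sub>R g - p v) \<bullet> g \<le> 0"
    using energy_update[of w v p] assms(2) by (simp add: g_def field_at_def)
  moreover have "((1 / norm g) *\<^sub>R g) \<bullet> g = norm g" using False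
    by (simp add: dot_square_norm power2_eq_square g_def)
  ultimately have "norm g \<le> p v \<bullet> g" by (simp add: inner_diff_left)
  moreover have "p v \<bullet> g \<le> norm g" using norm_cauchy_schwarz[of "p v" g] n by simp
  ultimately have "p v \<bullet> g = norm (p v) * norm g" using n by simp
  then have "norm (p v) *\<^sub>R g = norm g *\<^sub>R p v" by (simp only: norm_cauchy_schwarz_eq)
  then show ?thesis using n by (simp add: g_def)
qed simp

text \<open>If the neighbours exert no force on \<open>v\<close>, the energy is that of the graph without \<open>v\<close>.  After
flattening that graph, \<open>v\<close> can be placed with one of two opposite signs such that its edges do not
contribute negatively.\<close>
lemma drop_vertex_without_field:
  fixes p :: "'a::finite \<Rightarrow> real^'a"
  assumes "unit_config p" "supported w E" "w {v} = 0" "field_at w p v = 0" "flattenable {e \<in> E. v \<notin> e}"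
  shows "\<exists>q :: 'a \<Rightarrow> complex. unit_config q \<and> energy w p \<le> energy w q"
proof -
  define w' where "w' e = (if v \<in> e then 0 else w e)" for e
  have split: "energy w r = energy w' r + 2 * (r v \<bullet> field_at w r v)" for r :: "'a \<Rightarrow> 'e::real_inner"
  proof -
    let ?l = "\<lambda>i j. if i = v then w {v,j} * (r v \<bullet> r j) else 0"
    have eq: "w {i,j} * (r i \<bullet> r j) = w' {i,j} * (r i \<bullet> r j) + ?l i j + ?l j i" for i j
      using assms(3) by (auto simp: w'_def inner_commute insert_commute)
    have "energy w r = (\<Sum>i\<in>UNIV. \<Sum>j\<in>UNIV. w' {i,j} * (r i \<bullet> r j) + ?l i j + ?l j i)"
      unfolding energy_def by (rule sum.cong[OF HOL.refl], rule sum.cong[OF HOL.refl], rule eq)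
    also have "\<dots> = energy w' r + (\<Sum>i\<in>UNIV. \<Sum>j\<in>UNIV. ?l i j) + (\<Sum>i\<in>UNIV. \<Sum>j\<in>UNIV. ?l j i)"
      by (simp only: energy_def sum.distrib)
    also have "(\<Sum>i\<in>UNIV. \<Sum>j\<in>UNIV. ?l j i) = r v \<bullet> field_at w r v" by (simp add: field_at_def inner_sum_right)
    also have "(\<Sum>i\<in>UNIV. \<Sum>j\<in>UNIV. ?l i j) = r v \<bullet> field_at w r v" by (subst sum.swap) (simp add: field_at_def inner_sum_right)
    finally show ?thesis by simp
  qed
  have "supported w' {e \<in> E. v \<notin> e}" using assms(2) by (auto simp: supported_def w'_def)
  then obtain q :: "'a \<Rightarrow> complex" where q: "unit_config q" "energy w' p \<le> energy w' q"
    using assms(1,5) unfolding flattenable_def by blast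
  \<comment> \<open>turns \<open>q v\<close> around if its edges would lower the energy\<close>
  define s :: real where "s = (if q v \<bullet> field_at w q v \<ge> 0 then 1 else - 1)"
  define q' where "q' = q(v := s *\<^sub>R q v)"
  have "field_at w q' v = field_at w q v"
    unfolding field_at_def using assms(3) by (intro sum.cong) (auto simp: q'_def)
  moreover have "energy w' q' = energy w' q" by (rule energy_cong) (auto simp: q'_def w'_def)
  ultimately have "energy w q' = energy w' q + 2 * (q' v \<bullet> field_at w q v)" using split[of q'] by simp
  moreover have "0 \<le> q' v \<bullet> field_at w q v" by (simp add: q'_def s_def)
  ultimately have "energy w q' \<ge> energy w' q" by simp
  moreover have "unit_config q'" unfolding q'_def
    by (intro unit_config_update q(1)) (use q(1) in \<open>simp add: s_def unit_config_def\<close>)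
  moreover have "energy w p = energy w' p" using assms(4) by (simp add: split[of p])
  ultimately show ?thesis using q(2) by (metis order_trans)
qed

section \<open>Two families of graphs on six vertices\<close>

lemma in_span_of_field:
  assumes "field_at w p v = y *\<^sub>R p v" "y \<noteq> 0" "\<And>j. w {v, j} \<noteq> 0 \<Longrightarrow> p j \<in> span S"
  shows "p v \<in> span S"
proof -
  have "field_at w p v \<in> span S" unfolding field_at_def
    using assms(3) by (intro span_sum) (metis scale_eq_0_iff span_scale span_zero)
  moreover have "p v = (1 / y) *\<^sub>R field_at w p v" using assms(1,2) by simp
  ultimately show ?thesis by (metis span_scale)
qed

text \<open>A six-vector configuration of dimension four or more has a conic by counting.  In dimension
three the equilibrium of forces places the vectors of \<open>Q\<close> in the span of those of \<open>P\<close>, which thus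
form a basis.  Take a symmetric form \<open>A\<close> vanishing at this basis and at two vectors of \<open>Q\<close>.
Pairing the equilibrium equations \<open>y v * p v = (\<Sum>j. w {v, j} * p j)\<close> with \<open>A (p v)\<close> and summing
over one class of the bipartition gives the same sum over the edges for both classes; hence
\<open>(\<Sum>v\<in>P. y v * (A (p v) \<bullet> p v)) = (\<Sum>v\<in>Q. y v * (A (p v) \<bullet> p v))\<close>, and \<open>A\<close> vanishes at the last
vector too.\<close>
lemma flattenable_K33:
  fixes E :: "'a::finite set set"
  assumes card: "card P = 3" "card Q = 3" "P \<inter> Q = {}" and E: "\<And>e. e \<in> E \<Longrightarrow> \<exists>a\<in>P. \<exists>b\<in>Q. e = {a, b}"
  shows "flattenable E"
proof (rule flattenable_by_perturbation[of "P \<union> Q"])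
  have sub: "e \<subseteq> P \<union> Q" if "e \<in> E" for e using E[OF that] by auto
  show "P \<union> Q \<noteq> {}" using card by auto
  show "e \<subseteq> P \<union> Q" if "e \<in> E" for e using sub that .
  fix w and p :: "'a \<Rightarrow> real^'a"
  assume w: "supported w E" and opt: "optimal w p" and ran: "range p = p ` (P \<union> Q)" and d3: "3 \<le> dim (range p)"
  let ?goal = "\<exists>A z. linear A \<and> (\<forall>x y. A x \<bullet> y = x \<bullet> A y) \<and> range A \<subseteq> span (range p) \<and> (\<forall>v. A (p v) \<bullet> p v = 0) \<and>
        z \<in> span (range p) \<and> A z \<bullet> z \<noteq> 0"
  have cPQ: "card (P \<union> Q) = 6" using card by (simp add: card_Un_disjoint)
  have sing: "w {v} = 0" for v
  proof -
    have "{v} \<notin> E" using E[of "{v}"] card(3) by (metis IntI doubleton_eq_iff empty_iff insert_absorb2)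
    then show ?thesis using w by (simp add: supported_def)
  qed
  define y where "y v = norm (field_at w p v)" for v
  have st: "field_at w p v = y v *\<^sub>R p v" for v
    unfolding y_def by (rule optimal_stationary[where p = p, OF opt sing])
  show "(\<exists>q :: 'a \<Rightarrow> complex. unit_config q \<and> energy w p \<le> energy w q) \<or> ?goal"
  proof (cases "\<exists>v\<in>P \<union> Q. y v = 0")
    case True
    then obtain v where v: "v \<in> P \<union> Q" "field_at w p v = 0" using y_def by auto
    have "flattenable {e \<in> E. v \<notin> e}"
    proof (rule flattenable_card_le_5)
      show "card (P \<union> Q - {v}) \<le> 5" using v(1) cPQ by simp
    qed (use sub in auto)
    moreover have "unit_config p" using opt by (simp add: optimal_def)
    ultimately show ?thesis using drop_vertex_without_field[OF _ w sing v(2)] by blast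
  next
    case False
    then have y0: "y v \<noteq> 0" if "v \<in> P \<union> Q" for v using that by blast
    have "?goal"
    proof (cases "dim (range p) = 3")
      case False
      then have "4 \<le> dim (range p)" using d3 by simp
      moreover have "card (range p) \<le> 6" using card_image_le[of "P \<union> Q" p] cPQ ran by simp
      ultimately show ?thesis by (intro conic_through_few_points) auto
    next
      case True
      have "p b \<in> span (p ` P)" if b: "b \<in> Q" for b
      proof (rule in_span_of_field[OF st y0])
        show "b \<in> P \<union> Q" using b by simp
        show "p j \<in> span (p ` P)" if j: "w {b, j} \<noteq> 0" for j
        proof -
          have "{b, j} \<in> E" using w j by (auto simp: supported_def)
          then have "j \<in> P" using E[of "{b, j}"] b card(3) by (auto simp: doubleton_eq_iff)
          then show ?thesis by (intro span_base) simp
        qed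
      qed
      then have ranP: "range p \<subseteq> span (p ` P)" unfolding ran by (auto intro: span_base)
      have "dim (range p) \<le> dim (p ` P)" using ranP dim_subset[of "range p" "span (p ` P)"] by simp
      then have dP: "3 \<le> dim (p ` P)" using True by simp
      have "card (p ` P) \<le> 3" using card_image_le[of P p] card(1) by simp
      moreover have "dim (p ` P) \<le> card (p ` P)" by (rule dim_le_card) (auto simp: span_superset)
      ultimately have cP: "card (p ` P) = 3" and "dim (p ` P) = card (p ` P)" using dP by auto
      then have ind: "independent (p ` P)"
        by (intro card_le_dim_spanning[of _ "span (p ` P)"]) (auto simp: span_superset)
      have inj: "inj_on p P" using cP card(1) by (intro eq_card_imp_inj_on) (auto intro: card_ge_0_finite)
      obtain b1 b2 b3 where Q: "Q = {b1, b2, b3}" "b1 \<noteq> b2" "b1 \<noteq> b3" "b2 \<noteq> b3" using card(2) by (auto simp: card_3_iff)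
      obtain A z where A: "linear A" "\<And>x y. A x \<bullet> y = x \<bullet> A y" "range A \<subseteq> span (p ` P)" "\<And>b. b \<in> p ` P \<Longrightarrow> A b \<bullet> b = 0"
        "A (p b1) \<bullet> p b1 = 0" "A (p b2) \<bullet> p b2 = 0" "z \<in> span (p ` P)" "A z \<bullet> z \<noteq> 0"
        using conic_through_basis_and_two[OF ind, of "p b1" "p b2"] cP by auto
      have quad: "y v * (A (p v) \<bullet> p v) = (\<Sum>j\<in>UNIV. w {v, j} * (A (p v) \<bullet> p j))" for v
      proof -
        have "y v * (A (p v) \<bullet> p v) = A (p v) \<bullet> field_at w p v" by (simp add: st)
        then show ?thesis by (simp add: field_at_def inner_sum_right)
      qed
      have wP: "w {a, j} = 0" if "a \<in> P" "j \<notin> Q" for a j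
      proof -
        have "{a, j} \<notin> E" using E[of "{a, j}"] card(3) that by (auto simp: doubleton_eq_iff)
        then show ?thesis using w by (simp add: supported_def)
      qed
      have wQ: "w {b, j} = 0" if "b \<in> Q" "j \<notin> P" for b j
      proof -
        have "{b, j} \<notin> E" using E[of "{b, j}"] card(3) that by (auto simp: doubleton_eq_iff)
        then show ?thesis using w by (simp add: supported_def)
      qed
      have "(\<Sum>a\<in>P. y a * (A (p a) \<bullet> p a)) = (\<Sum>a\<in>P. \<Sum>b\<in>Q. w {a, b} * (A (p a) \<bullet> p b))"
      proof (rule sum.cong[OF HOL.refl])
        fix a assume "a \<in> P"
        then show "y a * (A (p a) \<bullet> p a) = (\<Sum>b\<in>Q. w {a, b} * (A (p a) \<bullet> p b))"
          unfolding quad by (intro sum.mono_neutral_right) (auto simp: wP)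
      qed
      also have "\<dots> = (\<Sum>b\<in>Q. \<Sum>a\<in>P. w {b, a} * (A (p b) \<bullet> p a))"
      proof -
        have "w {a, b} * (A (p a) \<bullet> p b) = w {b, a} * (A (p b) \<bullet> p a)" for a b
          using A(2)[of "p a" "p b"] by (simp add: inner_commute insert_commute)
        then show ?thesis by (subst sum.swap) (rule sum.cong[OF HOL.refl], rule sum.cong[OF HOL.refl])
      qed
      also have "\<dots> = (\<Sum>b\<in>Q. y b * (A (p b) \<bullet> p b))"
      proof (rule sum.cong[OF HOL.refl])
        fix b assume "b \<in> Q"
        then show "(\<Sum>a\<in>P. w {b, a} * (A (p b) \<bullet> p a)) = y b * (A (p b) \<bullet> p b)"
          unfolding quad by (intro sum.mono_neutral_left) (auto simp: wQ)
      qed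
      finally have "(\<Sum>b\<in>Q. y b * (A (p b) \<bullet> p b)) = 0" using A(4) by simp
      then have "y b3 * (A (p b3) \<bullet> p b3) = 0" using A(5,6) Q by simp
      then have "A (p b3) \<bullet> p b3 = 0" using y0[of b3] Q by simp
      then have "A (p v) \<bullet> p v = 0" if "v \<in> P \<union> Q" for v using that A(4,5,6) Q by auto
      then have "A (p v) \<bullet> p v = 0" for v
      proof -
        have "p v \<in> p ` (P \<union> Q)" using ran by blast
        then show ?thesis using \<open>\<And>v. v \<in> P \<union> Q \<Longrightarrow> A (p v) \<bullet> p v = 0\<close> by auto
      qed
      moreover have "span (p ` P) \<subseteq> span (range p)" by (intro span_mono) auto
      ultimately show ?thesis using A by (intro exI[of _ A] exI[of _ z]) auto
    qed
    then show ?thesis by blast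
  qed
qed

lemma normal_to_pair:
  fixes S :: "'e::euclidean_space set"
  assumes "3 \<le> dim S" "u1 \<in> S" "u2 \<in> S"
  obtains n where "n \<in> span S" "n \<noteq> 0" "n \<bullet> u1 = 0" "n \<bullet> u2 = 0"
proof -
  have "dim {u1, u2} \<le> card {u1, u2}" by (rule dim_le_card) (auto simp: span_superset)
  also have "\<dots> \<le> 2" by (simp add: card_insert_if)
  finally have "span {u1, u2} \<noteq> span S" using assms(1) dim_span by (metis Suc_1 eval_nat_numeral(3) not_less_eq_eq)
  moreover have "span {u1, u2} \<subseteq> span S" using assms(2,3) by (intro span_mono) auto
  ultimately have "span {u1, u2} \<subset> span S" by blast
  then obtain n where "n \<noteq> 0" "n \<in> span S" "\<And>y. y \<in> span {u1, u2} \<Longrightarrow> orthogonal n y"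
    using orthogonal_to_subspace_exists_gen by blast
  then show ?thesis using that by (auto simp: orthogonal_def span_base)
qed

text \<open>Equilibrium places \<open>p x\<close> in the span of \<open>p a\<close>, \<open>p b\<close>, and \<open>p y\<close> in that of \<open>p c\<close>, \<open>p d\<close>.  So
the six vectors lie on two hyperplanes of their span, whose union is the zero set of a quadratic
form.\<close>
lemma flattenable_two_triangle_caps:
  fixes E :: "'a::finite set set"
  assumes V: "V = {a, b, x, c, d, y}" and E: "\<And>e. e \<in> E \<Longrightarrow> e \<subseteq> V \<and> card e = 2"
    and x: "\<And>v. {x, v} \<in> E \<Longrightarrow> v \<in> {a, b}" and y: "\<And>v. {y, v} \<in> E \<Longrightarrow> v \<in> {c, d}"
  shows "flattenable E"
proof (rule flattenable_by_perturbation[of V])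
  show "V \<noteq> {}" using V by auto
  show "e \<subseteq> V" if "e \<in> E" for e using E[OF that] by simp
  fix w and p :: "'a \<Rightarrow> real^'a"
  assume w: "supported w E" and opt: "optimal w p" and ran: "range p = p ` V" and d3: "3 \<le> dim (range p)"
  let ?goal = "\<exists>A z. linear A \<and> (\<forall>x y. A x \<bullet> y = x \<bullet> A y) \<and> range A \<subseteq> span (range p) \<and> (\<forall>v. A (p v) \<bullet> p v = 0) \<and>
        z \<in> span (range p) \<and> A z \<bullet> z \<noteq> 0"
  have sing: "w {v} = 0" for v
  proof -
    have "{v} \<notin> E" using E[of "{v}"] by auto
    then show ?thesis using w by (simp add: supported_def)
  qed
  have st: "field_at w p v = norm (field_at w p v) *\<^sub>R p v" for v
    by (rule optimal_stationary[where p = p, OF opt sing])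
  show "(\<exists>q :: 'a \<Rightarrow> complex. unit_config q \<and> energy w p \<le> energy w q) \<or> ?goal"
  proof (cases "\<exists>v\<in>{x, y}. field_at w p v = 0")
    case True
    then obtain v where v: "v \<in> V" "field_at w p v = 0" using V by auto
    have "flattenable {e \<in> E. v \<notin> e}"
    proof (rule flattenable_card_le_5)
      have "card V \<le> 6" unfolding V by (simp add: card_insert_if)
      then show "card (V - {v}) \<le> 5" using v(1) V by simp
    qed (use E in auto)
    moreover have "unit_config p" using opt by (simp add: optimal_def)
    ultimately show ?thesis using drop_vertex_without_field[OF _ w sing v(2)] by blast
  next
    case False
    have px: "p x \<in> span {p a, p b}"
    proof (rule in_span_of_field[OF st])
      show "p j \<in> span {p a, p b}" if j: "w {x, j} \<noteq> 0" for j
      proof -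
        have "{x, j} \<in> E" using w j by (auto simp: supported_def)
        then have "j = a \<or> j = b" using x by auto
        then show ?thesis by (auto intro: span_base)
      qed
    qed (use False in auto)
    have py: "p y \<in> span {p c, p d}"
    proof (rule in_span_of_field[OF st])
      show "p j \<in> span {p c, p d}" if j: "w {y, j} \<noteq> 0" for j
      proof -
        have "{y, j} \<in> E" using w j by (auto simp: supported_def)
        then have "j = c \<or> j = d" using y by auto
        then show ?thesis by (auto intro: span_base)
      qed
    qed (use False in auto)
    have orth: "n \<bullet> z = 0" if "n \<bullet> u1 = 0" "n \<bullet> u2 = 0" "z \<in> span {u1, u2}" for n z u1 u2 :: "real^'a"
      using that(3) span_induct[of z "{u1, u2}" "\<lambda>y. n \<bullet> y = 0"] that(1,2) by (auto simp: subspace_def inner_add_right)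
    obtain m where m: "m \<in> span (range p)" "m \<noteq> 0" "m \<bullet> p a = 0" "m \<bullet> p b = 0" using normal_to_pair[OF d3, of "p a" "p b"] by blast
    obtain n where n: "n \<in> span (range p)" "n \<noteq> 0" "n \<bullet> p c = 0" "n \<bullet> p d = 0" using normal_to_pair[OF d3, of "p c" "p d"] by blast
    have diagV: "outer_sym m n (p v) \<bullet> p v = 0" if "v \<in> V" for v
      using that V orth[OF m(3,4) px] orth[OF n(3,4) py] m(3,4) n(3,4) by (auto simp: outer_sym_quadratic)
    have diag: "outer_sym m n (p v) \<bullet> p v = 0" for v
    proof -
      have "p v \<in> p ` V" using ran by blast
      then show ?thesis using diagV by auto
    qed
    \<comment> \<open>the form does not vanish at \<open>m\<close>, or, if \<open>m\<close> and \<open>n\<close> are orthogonal, at \<open>m + n\<close>\<close>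
    have "\<exists>z\<in>span (range p). outer_sym m n z \<bullet> z \<noteq> 0"
    proof (cases "m \<bullet> n = 0")
      case False
      then have "outer_sym m n m \<bullet> m \<noteq> 0" unfolding outer_sym_quadratic using m(2) by (simp add: inner_commute)
      then show ?thesis using m(1) by blast
    next
      case True
      then have "m \<bullet> (m + n) = m \<bullet> m" "n \<bullet> (m + n) = n \<bullet> n" by (simp_all add: inner_add_right inner_commute)
      then have "outer_sym m n (m + n) \<bullet> (m + n) \<noteq> 0" unfolding outer_sym_quadratic using m(2) n(2) by simp
      then show ?thesis using span_add[OF m(1) n(1)] by blast
    qed
    moreover have "range (outer_sym m n) \<subseteq> span (range p)"
      using m(1) n(1) by (auto simp: outer_sym_def intro!: span_add span_scale)
    ultimately have ?goal using linear_outer_sym[of m n] outer_sym_self_adjoint[of m n] diag by metis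
    then show ?thesis by blast
  qed
qed

section \<open>Adjacent vertices of degree two\<close>

lemma span_pairE:
  assumes "x \<in> span {a, b}" obtains \<alpha> \<beta> where "x = \<alpha> *\<^sub>R a + \<beta> *\<^sub>R b"
proof -
  obtain \<alpha> where "x - \<alpha> *\<^sub>R a \<in> span {b}" using assms by (auto simp: span_insert)
  then obtain \<beta> where "x - \<alpha> *\<^sub>R a = \<beta> *\<^sub>R b" by (auto simp: span_singleton)
  then have "x = \<alpha> *\<^sub>R a + \<beta> *\<^sub>R b" by (simp add: algebra_simps)
  then show ?thesis using that by blast
qed

lemma scaleR_eq_divide:
  fixes x a :: "'e::real_vector"
  assumes "k *\<^sub>R x = c *\<^sub>R a" "k \<noteq> 0" shows "x = (c / k) *\<^sub>R a"
proof -
  have "x = (1 / k) *\<^sub>R (k *\<^sub>R x)" using assms(2) by simp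
  then show ?thesis using assms(1) by simp
qed

lemma field_at_degree_two:
  assumes "i \<noteq> j" "\<And>k. k \<noteq> i \<Longrightarrow> k \<noteq> j \<Longrightarrow> w {v, k} = 0"
  shows "field_at w p v = w {v, i} *\<^sub>R p i + w {v, j} *\<^sub>R p j"
proof -
  have "field_at w p v = (\<Sum>k\<in>{i, j}. w {v, k} *\<^sub>R p k)"
    unfolding field_at_def using assms(2) by (intro sum.mono_neutral_right) auto
  then show ?thesis using assms(1) by simp
qed

text \<open>The premises are the equilibrium conditions at the inner vertices of a path with end
vertices \<open>a\<close> and \<open>b\<close>.  If the force at \<open>x\<close> vanishes, \<open>y\<close> is parallel to \<open>a\<close>; otherwise \<open>x\<close> is a
combination of \<open>a\<close> and \<open>y\<close>.\<close>
lemma two_step_path_coplanar: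
  fixes a b x y :: "'e::real_vector"
  assumes eqs: "s *\<^sub>R a + t *\<^sub>R y = \<gamma> *\<^sub>R x" "t *\<^sub>R x + u *\<^sub>R b = \<delta> *\<^sub>R y" and nz: "t \<noteq> 0" "u \<noteq> 0"
  shows "(x \<in> span {a, b} \<and> y \<in> span {a, b}) \<or> (b \<in> span {a, y} \<and> x \<in> span {a, y})"
proof (cases "\<gamma> = 0")
  case True
  then have "y = (1 / t) *\<^sub>R (t *\<^sub>R y)" "t *\<^sub>R y = (- s) *\<^sub>R a" using eqs(1) nz by (auto simp: algebra_simps eq_neg_iff_add_eq_0)
  then have y: "y \<in> span {a, b}" by (metis insertI1 span_base span_scale)
  have "x = (1 / t) *\<^sub>R (\<delta> *\<^sub>R y - u *\<^sub>R b)" using eqs(2)[symmetric] nz by simp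
  then have "x \<in> span {a, b}" using y by (auto intro!: span_scale span_diff intro: span_base)
  then show ?thesis using y by blast
next
  case False
  then have "x = (1 / \<gamma>) *\<^sub>R (s *\<^sub>R a + t *\<^sub>R y)" using eqs(1) by simp
  then have x: "x \<in> span {a, y}" by (auto intro!: span_scale span_add intro: span_base)
  have "b = (1 / u) *\<^sub>R (\<delta> *\<^sub>R y - t *\<^sub>R x)" using eqs(2)[symmetric] nz by simp
  then have "b \<in> span {a, y}" using x by (auto intro!: span_scale span_diff intro: span_base)
  then show ?thesis using x by blast
qed

text \<open>The first-order condition at \<open>t = 0\<close> for the left-hand side of the premise, whose right-hand
side is its value there.\<close>
lemma derivative_condition_from_max:
  fixes m n y d D k :: real
  assumes y: "\<bar>y\<bar> < 1" and le: "\<And>t. 0 < t \<Longrightarrow> t < 1 \<Longrightarrow>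
     t * D + k * (m * (y + t * d) + n * sqrt (1 - (y + t * d)\<^sup>2)) \<le> k * (m * y + n * sqrt (1 - y\<^sup>2))"
  shows "D + k * (m - n * y / sqrt (1 - y\<^sup>2)) * d \<le> 0"
proof (rule ccontr)
  assume "\<not> ?thesis"
  then have pos: "0 < D + k * (m - n * y / sqrt (1 - y\<^sup>2)) * d" by simp
  define f where "f t = t * D + k * (m * (y + t * d) + n * sqrt (1 - (y + t * d)\<^sup>2))" for t
  have "y\<^sup>2 < 1" using y by (simp add: abs_square_less_1)
  then have der: "(f has_real_derivative (D + k * (m - n * y / sqrt (1 - y\<^sup>2)) * d)) (at 0)"
    unfolding f_def
    by (auto intro!: derivative_eq_intros simp: field_simps)
  obtain e where e: "0 < e" "\<And>h. 0 < h \<Longrightarrow> h < e \<Longrightarrow> f 0 < f (0 + h)"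
    using DERIV_pos_inc_right[OF der pos] by blast
  define h where "h = min (e / 2) (1 / 2)"
  have "0 < h" "h < e" "h < 1" using e(1) by (auto simp: h_def)
  then have "f 0 < f h" "f h \<le> f 0" using e(2)[of h] le[of h] by (simp_all add: f_def)
  then show False by simp
qed

text \<open>In an optimal configuration the path from \<open>a\<close> through \<open>x\<close> and \<open>y\<close> to \<open>b\<close> is coplanar, by
equilibrium at \<open>x\<close> and \<open>y\<close>.  It remains to flatten the rest of the graph with the same inner
product of \<open>a\<close> and \<open>b\<close>. For this, \<open>rigid_pair_by_path\<close> needs a supporting line of nonzero slope
\<open>\<sigma>\<close>.  The path itself provides it: turning \<open>a\<close> in the plane while \<open>x\<close>, \<open>y\<close>, \<open>b\<close> stay fixed changes
the energy of the path at some rate in terms of the inner product of \<open>a\<close> and \<open>b\<close>, and optimality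
of the whole configuration makes the negative of this rate a supergradient for the rest.  The rate
is nonzero, since otherwise \<open>x\<close> would be parallel to \<open>a\<close>, and by equilibrium so would be \<open>y\<close> and
\<open>b\<close>.\<close>
lemma flattenable_adjacent_degree_two:
  fixes E :: "'a::finite set set"
  assumes E: "\<And>e. e \<in> E \<Longrightarrow> card e = 2" and d: "distinct [a, x, y, b]"
    and edges: "{a, x} \<in> E" "{x, y} \<in> E" "{y, b} \<in> E"
    and nx: "\<And>v. {x, v} \<in> E \<Longrightarrow> v \<in> {a, y}" and ny: "\<And>v. {y, v} \<in> E \<Longrightarrow> v \<in> {x, b}"
    and contr: "flattenable ({e \<in> E. x \<notin> e \<and> y \<notin> e} \<union> {{a, x}, {b, x}})"
    and del: "\<And>e. e \<in> E \<Longrightarrow> flattenable (E - {e})"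
  shows "flattenable E"
  unfolding flattenable_def
proof (intro allI impI)
  fix w and p0 :: "'a \<Rightarrow> real^'a" assume w: "supported w E" and p0: "unit_config p0"
  show "\<exists>q :: 'a \<Rightarrow> complex. unit_config q \<and> energy w p0 \<le> energy w q"
  proof (cases "\<exists>e\<in>E. w e = 0")
    case True
    then obtain e where e: "e \<in> E" "w e = 0" by blast
    \<comment> \<open>an edge of weight 0 may be deleted\<close>
    then have "supported w (E - {e})" using w by (auto simp: supported_def)
    then show ?thesis using del[OF e(1)] p0 unfolding flattenable_def by blast
  next
    case False
    define E1 where "E1 = {e \<in> E. x \<notin> e \<and> y \<notin> e}"
    define E2 where "E2 = {{a, x}, {x, y}, {y, b}}"
    have E12: "E = E1 \<union> E2"
    proof -
      have "e \<in> E2" if e: "e \<in> E" "x \<in> e \<or> y \<in> e" for e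
      proof -
        obtain i j where ij: "e = {i, j}" using E[OF e(1)] by (auto simp: card_2_iff)
        then have "(\<exists>v. e = {x, v}) \<or> (\<exists>v. e = {y, v})" using e(2) by auto
        then show ?thesis using nx ny e(1) unfolding E2_def by (auto simp: insert_commute)
      qed
      then show ?thesis using edges by (auto simp: E1_def E2_def)
    qed
    define s t u where "s = w {a, x}" and "t = w {x, y}" and "u = w {y, b}"
    have nz: "s \<noteq> 0" "t \<noteq> 0" "u \<noteq> 0" using False edges by (auto simp: s_def t_def u_def)
    define w1 where "w1 = restrict_weight w E1"
    have w1s: "supported w1 E1" by (simp add: w1_def supported_restrict_weight)
    have E2E1: "E2 - E1 = E2" by (auto simp: E1_def E2_def)
    have en2: "energy (restrict_weight w E2) r = 2 * s * (r a \<bullet> r x) + (2 * t * (r x \<bullet> r y) + 2 * u * (r y \<bullet> r b))"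
      for r :: "'a \<Rightarrow> 'e::real_inner"
    proof -
      have "restrict_weight w E2 = (\<lambda>e. s * edge_weight {a,x} e + (t * edge_weight {x,y} e + u * edge_weight {y,b} e))"
        using d by (auto simp: restrict_weight_def E2_def edge_weight_def s_def t_def u_def fun_eq_iff doubleton_eq_iff)
      then show ?thesis using d by (simp add: energy_add energy_scale energy_edge_weight)
    qed
    have en: "energy w r = energy w1 r + (2 * s * (r a \<bullet> r x) + (2 * t * (r x \<bullet> r y) + 2 * u * (r y \<bullet> r b)))"
      for r :: "'a \<Rightarrow> 'e::real_inner"
      using energy_split[of w E1 E2 r] w E12 by (simp add: w1_def E2E1 en2)
    obtain p :: "'a \<Rightarrow> real^'a" where opt: "optimal w p" using optimal_exists by blast
    have p: "unit_config p" using opt by (simp add: optimal_def)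
    have pn: "p v \<bullet> p v = 1" for v using p by (rule unit_config_inner_self)
    have sing: "w {v} = 0" for v using E[of "{v}"] w by (auto simp: supported_def)
    have fx: "field_at w p x = s *\<^sub>R p a + t *\<^sub>R p y"
    proof -
      have "w {x, k} = 0" if "k \<noteq> a" "k \<noteq> y" for k using nx[of k] w that by (auto simp: supported_def)
      then show ?thesis using field_at_degree_two[of a y w x p] d by (auto simp: s_def t_def insert_commute)
    qed
    have fy: "field_at w p y = t *\<^sub>R p x + u *\<^sub>R p b"
    proof -
      have "w {y, k} = 0" if "k \<noteq> x" "k \<noteq> b" for k using ny[of k] w that by (auto simp: supported_def)
      then show ?thesis using field_at_degree_two[of x b w y p] d by (auto simp: u_def t_def insert_commute)
    qed
    obtain \<gamma> \<delta> where st: "s *\<^sub>R p a + t *\<^sub>R p y = \<gamma> *\<^sub>R p x" "t *\<^sub>R p x + u *\<^sub>R p b = \<delta> *\<^sub>R p y"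
      using optimal_stationary[where p = p, OF opt sing, of x] optimal_stationary[where p = p, OF opt sing, of y]
      unfolding fx fy by metis
    note copl = two_step_path_coplanar[OF st nz(2,3)]
    have "\<exists>v. {p a, p x, p y, p b} \<subseteq> span {p a, v}"
      using copl by (auto intro: span_base exI[of _ "p b"] exI[of _ "p y"])
    then obtain v where v: "{p a, p x, p y, p b} \<subseteq> span {p a, v}" by blast
    have "dim {p a, p x, p y, p b} \<le> card {p a, v}" by (rule dim_le_card[OF v]) simp
    also have "\<dots> \<le> 2" by (simp add: card_insert_if)
    finally obtain f :: "real^'a \<Rightarrow> complex" where f: "\<And>v v'. v \<in> {p a, p x, p y, p b} \<Longrightarrow> v' \<in> {p a, p x, p y, p b} \<Longrightarrow> f v \<bullet> f v' = v \<bullet> v'"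
      using plane_to_complex by blast
    define q2 where "q2 v = (if v \<in> {a, x, y, b} then f (p v) else 1)" for v
    have q2: "unit_config q2" unfolding unit_config_def q2_def using f pn by (auto simp: norm_eq_sqrt_inner)
    have q2i: "q2 i \<bullet> q2 j = p i \<bullet> p j" if "i \<in> {a, x, y, b}" "j \<in> {a, x, y, b}" for i j
      using that f by (auto simp: q2_def)
    have q2e: "energy (restrict_weight w (E2 - E1)) p \<le> energy (restrict_weight w (E2 - E1)) q2"
      unfolding E2E1 en2 by (simp add: q2i)
    have abx: "flattenable (E1 \<union> {{a, x}, {b, x}})" using contr by (simp add: E1_def)
    have xE1: "x \<notin> \<Union>E1" by (auto simp: E1_def)
    have "\<exists>q1 :: 'a \<Rightarrow> complex. unit_config q1 \<and> q1 a \<bullet> q1 b = p a \<bullet> p b \<and> energy w1 p \<le> energy w1 q1"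
    proof (cases "\<bar>p a \<bullet> p b\<bar> < 1")
      case True
      define c where "c = p a \<bullet> p b"
      define r where "r = sqrt (1 - c\<^sup>2)"
      have c1: "\<bar>c\<bar> < 1" using True by (simp add: c_def)
      then have "c\<^sup>2 < 1" by (simp add: abs_square_less_1)
      then have r: "r > 0" "r\<^sup>2 = 1 - c\<^sup>2" by (simp_all add: r_def)
      have notpar: "p b \<noteq> k *\<^sub>R p a" for k
      proof
        assume "p b = k *\<^sub>R p a"
        then have "p b \<bullet> p b = k * k" "c = k" using pn by (simp_all add: c_def)
        then have "c * c = 1" using pn by simp
        then show False using \<open>c\<^sup>2 < 1\<close> by (simp add: power2_eq_square)
      qed
      have xy: "p x \<in> span {p a, p b} \<and> p y \<in> span {p a, p b}"
      proof (rule disjE[OF copl])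
        assume A: "p b \<in> span {p a, p y} \<and> p x \<in> span {p a, p y}"
        then obtain \<alpha> \<beta> where ab: "p b = \<alpha> *\<^sub>R p a + \<beta> *\<^sub>R p y" using span_pairE by blast
        have "\<beta> \<noteq> 0" using ab notpar[of \<alpha>] by auto
        then have "p y = (1 / \<beta>) *\<^sub>R (p b - \<alpha> *\<^sub>R p a)" using ab by simp
        then have y: "p y \<in> span {p a, p b}" by (auto intro!: span_scale span_diff intro: span_base)
        have "span {p a, p y} \<subseteq> span {p a, p b}" using y by (intro span_minimal) (auto intro: span_base)
        then show ?thesis using A y by blast
      qed
      \<comment> \<open>the unit vector orthogonal to \<open>p b\<close> in the plane of the path\<close>
      define e where "e = (1 / r) *\<^sub>R (p a - c *\<^sub>R p b)"
      have ae: "p a = c *\<^sub>R p b + r *\<^sub>R e" using r(1) by (simp add: e_def)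
      have coord: "\<exists>m n. z = m *\<^sub>R p b + n *\<^sub>R e" if z: "z \<in> span {p a, p b}" for z
      proof -
        obtain \<alpha> \<beta> where "z = \<alpha> *\<^sub>R p a + \<beta> *\<^sub>R p b" using span_pairE[OF z] by blast
        then have "z = (\<alpha> * c + \<beta>) *\<^sub>R p b + (\<alpha> * r) *\<^sub>R e" by (subst (asm) ae) (simp add: algebra_simps)
        then show ?thesis by blast
      qed
      obtain m n where x: "p x = m *\<^sub>R p b + n *\<^sub>R e" using coord xy by blast
      obtain m' n' where y: "p y = m' *\<^sub>R p b + n' *\<^sub>R e" using coord xy by blast
      \<comment> \<open>The energy of the path depends on \<open>p a\<close> through \<open>2 * s * (m * c + n * sqrt (1 - c\<^sup>2))\<close>;
        this is minus its derivative in \<open>c\<close>.\<close>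
      define \<sigma> where "\<sigma> = - (2 * s * (m - n * c / r))"
      have \<sigma>0: "\<sigma> \<noteq> 0"
      proof
        assume "\<sigma> = 0"
        then have "m * r = n * c" using nz(1) r(1) by (simp add: \<sigma>_def field_simps)
        then have "r *\<^sub>R p x = n *\<^sub>R p a" unfolding x by (subst ae) (simp add: algebra_simps)
        then have xa: "p x = (n / r) *\<^sub>R p a" using r(1) by (intro scaleR_eq_divide) auto
        have "t *\<^sub>R p y = (\<gamma> * (n / r) - s) *\<^sub>R p a" using st(1) unfolding xa by (simp add: algebra_simps)
        then have ya: "p y = ((\<gamma> * (n / r) - s) / t) *\<^sub>R p a" using nz(2) by (intro scaleR_eq_divide)
        have "u *\<^sub>R p b = (\<delta> * ((\<gamma> * (n / r) - s) / t) - t * (n / r)) *\<^sub>R p a"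
          using st(2) unfolding xa ya by (simp add: algebra_simps)
        then have "p b = ((\<delta> * ((\<gamma> * (n / r) - s) / t) - t * (n / r)) / u) *\<^sub>R p a"
          using nz(3) by (intro scaleR_eq_divide)
        then show False using notpar by blast
      qed
      have slope: "energy w1 p' \<le> energy w1 p + \<sigma> * (p' a \<bullet> p' b - p a \<bullet> p b)" if p': "unit_config p'" for p' :: "'a \<Rightarrow> real^'a"
      proof -
        define D where "D = energy w1 p' - energy w1 p"
        define dd where "dd = p' a \<bullet> p' b - c"
        have e1: "p b \<bullet> e = 0" "e \<bullet> p b = 0" "e \<bullet> e = 1"
        proof -
          have "p b \<bullet> e = (1 / r) * (p b \<bullet> p a - c)" by (simp add: e_def inner_diff_right pn)
          then show *: "p b \<bullet> e = 0" by (simp add: c_def inner_commute)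
          then show "e \<bullet> p b = 0" by (simp add: inner_commute)
          have "1 = c * c + r * r * (e \<bullet> e)" using pn[of a] * pn[of b] unfolding ae
            by (simp add: inner_add_left inner_add_right inner_commute)
          then have "(r * r) * (e \<bullet> e) = r * r" using r(2) unfolding power2_eq_square by linarith
          then show "e \<bullet> e = 1" using r(1) by simp
        qed
        have xn: "m * m + n * n = 1" using pn[of x] unfolding x
          by (simp add: inner_add_left inner_add_right e1 pn)
        have yn: "m' * m' + n' * n' = 1" using pn[of y] unfolding y
          by (simp add: inner_add_left inner_add_right e1 pn)
        have old: "p a \<bullet> p x = m * c + n * r" "p x \<bullet> p y = m * m' + n * n'" "p y \<bullet> p b = m'"
          unfolding x y ae by (simp_all add: inner_add_left inner_add_right e1 pn)
        have "D + 2 * s * (m - n * c / sqrt (1 - c\<^sup>2)) * dd \<le> 0"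
        proof (rule derivative_condition_from_max[OF c1])
          fix \<tau> :: real assume \<tau>: "0 < \<tau>" "\<tau> < 1"
          \<comment> \<open>The rest of the graph moves towards \<open>p'\<close>, which changes its energy at the constant
            rate \<open>D\<close>, and the inner product of \<open>a\<close> and \<open>b\<close> at the rate \<open>dd\<close>.\<close>
          obtain g :: "'a \<Rightarrow> real^'a" where g: "\<And>i j. g i \<bullet> g j = (1 - \<tau>) * (p i \<bullet> p j) + \<tau> * (p' i \<bullet> p' j)"
            using convex_combination_config[of \<tau> p p'] \<tau> by auto
          define c' where "c' = c + \<tau> * dd"
          have gc: "g a \<bullet> g b = c'" by (simp add: g c'_def dd_def c_def algebra_simps)
          have gn: "g i \<bullet> g i = 1" for i using p' pn by (simp add: g unit_config_inner_self)
          have "\<bar>c'\<bar> < 1"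
          proof -
            have "c' = (1 - \<tau>) * c + \<tau> * (p' a \<bullet> p' b)" by (simp add: c'_def dd_def algebra_simps)
            then have "\<bar>c'\<bar> \<le> (1 - \<tau>) * \<bar>c\<bar> + \<tau> * \<bar>p' a \<bullet> p' b\<bar>"
              using abs_triangle_ineq[of "(1 - \<tau>) * c" "\<tau> * (p' a \<bullet> p' b)"] \<tau> by (simp add: abs_mult)
            also have "\<dots> < (1 - \<tau>) * 1 + \<tau> * 1"
              using \<tau> c1 inner_unit_bounds[OF p', of a b] by (intro add_less_le_mono mult_strict_left_mono mult_left_mono) auto
            finally show ?thesis by simp
          qed
          then have "c'\<^sup>2 < 1" by (simp add: abs_square_less_1)
          define r' where "r' = sqrt (1 - c'\<^sup>2)"
          have r': "r' > 0" "r' * r' = 1 - c' * c'" using \<open>c'\<^sup>2 < 1\<close> by (simp_all add: r'_def power2_eq_square)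
          define e' where "e' = (1 / r') *\<^sub>R (g a - c' *\<^sub>R g b)"
          have ge: "g a = c' *\<^sub>R g b + r' *\<^sub>R e'" using r'(1) by (simp add: e'_def)
          have be: "g b \<bullet> e' = 0" "e' \<bullet> g b = 0"
            using gc by (simp_all add: e'_def inner_diff_right inner_diff_left gn inner_commute)
          have ee: "e' \<bullet> e' = 1"
          proof -
            have "1 = c' * c' + r' * r' * (e' \<bullet> e')" using gn[of a] gn[of b] be unfolding ge
              by (simp add: inner_add_left inner_add_right)
            then have "(r' * r') * (e' \<bullet> e') = r' * r'" using r'(2) by linarith
            then show ?thesis using r'(1) by simp
          qed
          have ae': "g a \<bullet> e' = r'" unfolding ge by (simp add: inner_add_left be ee)
          \<comment> \<open>\<open>x\<close> and \<open>y\<close> keep their coordinates with respect to \<open>b\<close>, in the plane of the new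
            vectors at \<open>a\<close> and \<open>b\<close>\<close>
          define h where "h = g(x := m *\<^sub>R g b + n *\<^sub>R e', y := m' *\<^sub>R g b + n' *\<^sub>R e')"
          have hv: "h a = g a" "h b = g b" "h x = m *\<^sub>R g b + n *\<^sub>R e'" "h y = m' *\<^sub>R g b + n' *\<^sub>R e'"
            using d by (auto simp: h_def)
          have "h v \<bullet> h v = 1" for v
            by (auto simp: h_def gn inner_add_left inner_add_right be ee xn yn)
          then have "unit_config h" by (simp add: unit_config_def norm_eq_sqrt_inner)
          then have "energy w h \<le> energy w p" using opt by (simp add: optimal_def)
          moreover have "energy w1 h = energy w1 g"
            by (rule energy_cong) (use w1s in \<open>auto simp: h_def supported_def E1_def\<close>)
          moreover have "energy w1 g = energy w1 p + \<tau> * D"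
          proof -
            have "energy w1 g = (1 - \<tau>) * energy w1 p + \<tau> * energy w1 p'"
              unfolding energy_def g sum_distrib_left sum.distrib[symmetric]
              by (intro sum.cong) (simp_all add: algebra_simps)
            then show ?thesis by (simp add: D_def algebra_simps)
          qed
          moreover have "h a \<bullet> h x = m * c' + n * r'" "h x \<bullet> h y = m * m' + n * n'" "h y \<bullet> h b = m'"
            unfolding hv by (simp_all add: inner_add_left inner_add_right be ee gn gc ae')
          ultimately have "\<tau> * D + 2 * s * (m * c' + n * r') \<le> 2 * s * (m * c + n * r)"
            unfolding en[of h] en[of p] old by simp
          then show "\<tau> * D + 2 * s * (m * (c + \<tau> * dd) + n * sqrt (1 - (c + \<tau> * dd)\<^sup>2)) \<le> 2 * s * (m * c + n * sqrt (1 - c\<^sup>2))"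
            by (simp add: c'_def r'_def r_def)
        qed
        then have "D \<le> \<sigma> * dd" unfolding \<sigma>_def r_def by simp
        then show ?thesis by (simp add: D_def dd_def c_def)
      qed
      have "x \<noteq> a" "x \<noteq> b" "a \<noteq> b" using d by auto
      from rigid_pair_by_path[OF abx xE1 this w1s p True \<sigma>0 slope] show ?thesis by blast
    next
      case False
      define k where "k = p a \<bullet> p b"
      have k: "\<bar>k\<bar> = 1" using False inner_unit_bounds[OF p, of a b] by (simp add: k_def)
      have "(norm (p b - k *\<^sub>R p a))\<^sup>2 = 2 - 2 * (p b \<bullet> (k *\<^sub>R p a))"
        by (rule norm_diff_unit) (use p k in \<open>auto simp: unit_config_def\<close>)
      also have "\<dots> = 2 - 2 * (k * k)" by (simp add: k_def inner_commute)
      also have "\<dots> = 0" using k abs_mult_self_eq[of k] by simp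
      finally have pb: "p b = k *\<^sub>R p a" by simp
      \<comment> \<open>contracting one of the two edges at \<open>x\<close> gives the edge \<open>{a, b}\<close>, along which \<open>a\<close> and \<open>b\<close>
        can be kept parallel\<close>
      define E' where "E' = E1 \<union> {{a, x}, {b, x}}"
      have "flattenable ((\<lambda>e. (\<lambda>z. if z = x then a else z) ` e) ` (E' - {{a, x}}))"
        by (rule flattenable_contract) (use abx E d in \<open>auto simp: E'_def E1_def\<close>)
      moreover have "E1 \<union> {{a, b}} \<subseteq> (\<lambda>e. (\<lambda>z. if z = x then a else z) ` e) ` (E' - {{a, x}})"
      proof -
        let ?h = "\<lambda>e. (\<lambda>z. if z = x then a else z) ` e"
        have "e \<in> ?h ` (E' - {{a, x}})" if e: "e \<in> E1" for e
        proof (rule image_eqI)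
          show "e \<in> E' - {{a, x}}" using e xE1 by (auto simp: E'_def)
          show "e = ?h e" using e by (force simp: E1_def)
        qed
        moreover have "{a, b} \<in> ?h ` (E' - {{a, x}})"
        proof (rule image_eqI)
          show "{b, x} \<in> E' - {{a, x}}" using d by (auto simp: E'_def doubleton_eq_iff)
          show "{a, b} = ?h {b, x}" using d by auto
        qed
        ultimately show ?thesis by blast
      qed
      ultimately have "flattenable (E1 \<union> {{a, b}})" by (rule flattenable_mono)
      moreover have "card e = 2" if "e \<in> E1 \<union> {{a, b}}" for e using that E d by (auto simp: E1_def)
      moreover have "supported w1 (E1 \<union> {{a, b}})" using supported_mono[OF w1s] by blast
      ultimately obtain q1 :: "'a \<Rightarrow> complex" where q1: "unit_config q1" "q1 b = k *\<^sub>R q1 a" "energy w1 p \<le> energy w1 q1"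
        using tight_edge[of "E1 \<union> {{a, b}}" a b w1 p k] p pb k by blast
      then have "q1 a \<bullet> q1 b = p a \<bullet> p b" by (simp add: unit_config_inner_self k_def[symmetric])
      then show ?thesis using q1 by blast
    qed
    then obtain q1 :: "'a \<Rightarrow> complex" where q1: "unit_config q1" "q1 a \<bullet> q1 b = p a \<bullet> p b" "energy w1 p \<le> energy w1 q1" by blast
    have "\<exists>q :: 'a \<Rightarrow> complex. unit_config q \<and> energy w p \<le> energy w q"
    proof (rule glue_along_pair[where ?E1.0 = E1 and ?E2.0 = E2 and ?U1.0 = "UNIV - {x, y}" and ?U2.0 = "{a, x, y, b}" and a = a and b = b])
      show "supported w (E1 \<union> E2)" using w E12 by simp
      show "q1 a \<bullet> q1 b = q2 a \<bullet> q2 b" using q1(2) q2i[of a b] by simp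
      show "energy (restrict_weight w E1) p \<le> energy (restrict_weight w E1) q1" using q1(3) by (simp add: w1_def)
    qed (use q1 q2 q2e in \<open>auto simp: E1_def E2_def\<close>)
    then show ?thesis using opt p0 unfolding optimal_def by (meson order_trans)
  qed
qed

section \<open>Separations and rooted triangles\<close>

definition separation :: "'a set \<Rightarrow> 'a set set \<Rightarrow> 'a set \<Rightarrow> 'a set \<Rightarrow> 'a set \<Rightarrow> bool" where
  "separation V E A B S \<longleftrightarrow> A \<union> B \<union> S = V \<and> A \<inter> B = {} \<and> A \<inter> S = {} \<and> B \<inter> S = {} \<and>
     (\<forall>a\<in>A. \<forall>b\<in>B. {a, b} \<notin> E)"

lemma separation_sym: "separation V E A B S \<Longrightarrow> separation V E B A S"
  unfolding separation_def by (metis Int_commute Un_commute insert_commute)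

definition two_connected :: "'a set \<Rightarrow> 'a set set \<Rightarrow> bool" where
  "two_connected V E \<longleftrightarrow> (\<forall>A B S. separation V E A B S \<longrightarrow> card S \<le> 1 \<longrightarrow> A = {} \<or> B = {})"

definition touch :: "'a set set \<Rightarrow> 'a set \<Rightarrow> 'a set \<Rightarrow> bool" where
  "touch E A B \<longleftrightarrow> (\<exists>s\<in>A. \<exists>t\<in>B. {s, t} \<in> E)"

lemma touch_sym: "touch E A B \<Longrightarrow> touch E B A"
  unfolding touch_def by (metis insert_commute)

text \<open>A triangle minor whose branch sets lie in \<open>C\<close>, except that two of them also contain the
roots \<open>a\<close> and \<open>b\<close>, respectively.\<close>
definition rooted_triangle :: "'a set set \<Rightarrow> 'a set \<Rightarrow> 'a \<Rightarrow> 'a \<Rightarrow> bool" where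
  "rooted_triangle E C a b \<longleftrightarrow> (\<exists>A B X. conn E A \<and> conn E B \<and> conn E X \<and> a \<in> A \<and> b \<in> B \<and>
     A \<subseteq> insert a C \<and> B \<subseteq> insert b C \<and> X \<subseteq> C \<and> A \<inter> B = {} \<and> A \<inter> X = {} \<and> B \<inter> X = {} \<and>
     touch E A B \<and> touch E A X \<and> touch E B X)"

lemma rooted_triangleI:
  "conn E A \<Longrightarrow> conn E B \<Longrightarrow> conn E X \<Longrightarrow> a \<in> A \<Longrightarrow> b \<in> B \<Longrightarrow>
     A \<subseteq> insert a C \<Longrightarrow> B \<subseteq> insert b C \<Longrightarrow> X \<subseteq> C \<Longrightarrow> A \<inter> B = {} \<Longrightarrow> A \<inter> X = {} \<Longrightarrow> B \<inter> X = {} \<Longrightarrow>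
     touch E A B \<Longrightarrow> touch E A X \<Longrightarrow> touch E B X \<Longrightarrow> rooted_triangle E C a b"
  unfolding rooted_triangle_def by blast

lemma rooted_triangle_sym:
  assumes "rooted_triangle E C a b" shows "rooted_triangle E C b a"
proof -
  obtain A B X where *: "conn E A" "conn E B" "conn E X" "a \<in> A" "b \<in> B"
     "A \<subseteq> insert a C" "B \<subseteq> insert b C" "X \<subseteq> C" "A \<inter> B = {}" "A \<inter> X = {}" "B \<inter> X = {}"
     "touch E A B" "touch E A X" "touch E B X" using assms unfolding rooted_triangle_def by blast
  have "B \<inter> A = {}" using *(9) by blast
  from rooted_triangleI[OF *(2) *(1) *(3) *(5) *(4) *(7) *(6) *(8) this *(11) *(10) touch_sym[OF *(12)] *(14) *(13)]
  show ?thesis .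
qed

definition adjacent_degree_two :: "'a set set \<Rightarrow> bool" where
  "adjacent_degree_two E \<longleftrightarrow> (\<exists>a x y b. distinct [a, x, y, b] \<and> {a, x} \<in> E \<and> {x, y} \<in> E \<and> {y, b} \<in> E \<and>
     (\<forall>v. {x, v} \<in> E \<longrightarrow> v \<in> {a, y}) \<and> (\<forall>v. {y, v} \<in> E \<longrightarrow> v \<in> {x, b}))"

text \<open>Otherwise the single vertex \<open>b\<close> would separate \<open>U\<close> from \<open>a\<close>.\<close>
lemma neighbour_in_closed_set:
  assumes "two_connected V E" "U \<subseteq> V" "U \<noteq> {}" "a \<in> V - U" "b \<in> V - U" "a \<noteq> b"
    and closed: "\<And>u v. u \<in> U \<Longrightarrow> {u, v} \<in> E \<Longrightarrow> v \<in> U \<union> {a, b}"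
  shows "touch E {a} U"
proof (rule ccontr)
  assume no: "\<not> touch E {a} U"
  have "separation V E U (V - U - {b}) {b}"
    unfolding separation_def
  proof (intro conjI ballI)
    fix u v assume "u \<in> U" "v \<in> V - U - {b}"
    then show "{u, v} \<notin> E" using closed[of u v] no by (auto simp: touch_def insert_commute)
  qed (use assms(2,5) in auto)
  then have "U = {} \<or> V - U - {b} = {}" using assms(1) unfolding two_connected_def by fastforce
  then show False using assms(3,4,6) by auto
qed

text \<open>Every component of \<open>K - {c}\<close> is attached to \<open>c\<close>, so removing one of them leaves the others
connected through \<open>c\<close>.\<close>
lemma component_complement:
  assumes K: "conn E K" "c \<in> K" "b \<in> K" "b \<noteq> c"
    and B: "conn E B" "b \<in> B" "B \<subseteq> K - {c}" "\<And>k v. k \<in> B \<Longrightarrow> v \<in> K - {c} - B \<Longrightarrow> {k, v} \<notin> E"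
  shows "conn E (K - B)" "touch E B {c}"
proof -
  have "B \<subset> K" using B(3) K(2) by blast
  then obtain s t where st: "s \<in> B" "t \<in> K - B" "{s, t} \<in> E" using K(1) B(2) unfolding conn_def by blast
  then have "t = c" using B(4)[of s t] by blast
  then show "touch E B {c}" using st by (auto simp: touch_def)
  have cut: "\<exists>s\<in>S. \<exists>t\<in>K - B - S. {s, t} \<in> E" if S: "S \<subseteq> K - B" "S \<noteq> {}" "c \<notin> S" for S
  proof -
    have "S \<subset> K" using S K(2) by blast
    then obtain s t where st: "s \<in> S" "t \<in> K - S" "{s, t} \<in> E" using K(1) S(2) unfolding conn_def by blast
    have "t \<notin> B"
    proof
      assume "t \<in> B"
      moreover have "s \<in> K - {c} - B" using st(1) S by blast
      ultimately have "{t, s} \<notin> E" by (rule B(4))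
      then show False using st(3) by (simp add: insert_commute)
    qed
    then show ?thesis using st by blast
  qed
  show "conn E (K - B)" unfolding conn_def
  proof (intro conjI allI impI)
    show "K - B \<noteq> {}" using K(2) B(3) by blast
    fix S assume S: "S \<subset> K - B" "S \<noteq> {}"
    show "\<exists>s\<in>S. \<exists>t\<in>K - B - S. {s, t} \<in> E"
    proof (cases "c \<in> S")
      case False then show ?thesis using cut[of S] S by blast
    next
      case True
      have "K - B - S \<noteq> {}" "K - B - S \<subseteq> K - B" "c \<notin> K - B - S" using S True by auto
      then obtain s t where "s \<in> K - B - S" "t \<in> K - B - (K - B - S)" "{s, t} \<in> E" using cut[of "K - B - S"] by blast
      then have "t \<in> S" "{t, s} \<in> E" by (auto simp: insert_commute)
      then show ?thesis using \<open>s \<in> K - B - S\<close> by blast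
    qed
  qed
qed

text \<open>Remove the neighbour \<open>c2\<close> of \<open>a\<close> from the connected set \<open>C \<union> {b}\<close>.  If the component \<open>B\<close> of
\<open>b\<close> contains the neighbour \<open>c1\<close>, then \<open>{a}\<close>, \<open>B\<close> and the rest of the set are the branch sets.
Otherwise the two neighbours change roles: \<open>B\<close> avoids \<open>c1\<close> and is attached to \<open>c2\<close>, so removing
\<open>c1\<close> leaves \<open>c2\<close> connected to \<open>b\<close>.\<close>
lemma rooted_triangle_if_two_neighbours:
  assumes fin: "finite C" and C: "conn E C" and ab: "a \<notin> C" "b \<notin> C" "a \<noteq> b"
    and c: "c1 \<in> C" "c2 \<in> C" "c1 \<noteq> c2" "{a, c1} \<in> E" "{a, c2} \<in> E" and b: "touch E {b} C"
  shows "rooted_triangle E C a b"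
proof -
  define K where "K = insert b C"
  obtain c0 where "c0 \<in> C" "{c0, b} \<in> E" using b by (auto simp: touch_def insert_commute)
  then have K: "conn E K" unfolding K_def using conn_insert[OF C] by blast
  have bK: "b \<in> K" by (simp add: K_def)
  have main: "rooted_triangle E C a b"
    if d: "d1 \<in> C" "d2 \<in> C" "{a, d1} \<in> E" "{a, d2} \<in> E" and B: "conn E B" "b \<in> B" "B \<subseteq> K - {d2}"
      "\<And>k v. k \<in> B \<Longrightarrow> v \<in> K - {d2} - B \<Longrightarrow> {k, v} \<notin> E" "d1 \<in> B" for d1 d2 B
  proof -
    have d2: "d2 \<in> K" "b \<noteq> d2" using d ab by (auto simp: K_def)
    note cc = component_complement[OF K d2(1) bK d2(2) B(1-4)]
    show ?thesis
    proof (rule rooted_triangleI[OF conn_singleton B(1) cc(1)])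
      show "touch E {a} B" "touch E {a} (K - B)" using d B d2 by (auto simp: touch_def)
      show "touch E B (K - B)" using cc(2) d2 B(3) by (auto simp: touch_def)
    qed (use B ab in \<open>auto simp: K_def\<close>)
  qed
  have "finite (K - {c2})" "finite (K - {c1})" using fin by (auto simp: K_def)
  moreover have "b \<in> K - {c2}" "b \<in> K - {c1}" using ab c by (auto simp: K_def)
  ultimately obtain B B' where B: "conn E B" "b \<in> B" "B \<subseteq> K - {c2}" "\<And>k v. k \<in> B \<Longrightarrow> v \<in> K - {c2} - B \<Longrightarrow> {k, v} \<notin> E"
    and B': "conn E B'" "b \<in> B'" "B' \<subseteq> K - {c1}" "\<And>k v. k \<in> B' \<Longrightarrow> v \<in> K - {c1} - B' \<Longrightarrow> {k, v} \<notin> E"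
    using component_exists[of "K - {c2}" b E] component_exists[of "K - {c1}" b E] by metis
  show ?thesis
  proof (cases "c1 \<in> B")
    case True
    show ?thesis by (rule main[OF c(1,2,4,5) B True])
  next
    case False
    \<comment> \<open>\<open>B\<close> is connected, contains \<open>b\<close> and avoids \<open>c1\<close>\<close>
    have "B \<subseteq> B'"
    proof (rule ccontr)
      assume "\<not> B \<subseteq> B'"
      then have "B \<inter> B' \<subset> B" "B \<inter> B' \<noteq> {}" using B(2) B'(2) by auto
      then obtain s t where st: "s \<in> B \<inter> B'" "t \<in> B - B \<inter> B'" "{s, t} \<in> E" using B(1) unfolding conn_def by blast
      then have "t \<in> K - {c1} - B'" using B(3) False by blast
      then show False using B'(4)[of s t] st by blast
    qed
    have c2K: "c2 \<in> K" "b \<noteq> c2" using c ab by (auto simp: K_def)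
    obtain s where s: "s \<in> B" "{s, c2} \<in> E" using component_complement(2)[OF K c2K(1) bK c2K(2) B] by (auto simp: touch_def)
    then have "c2 \<in> B'" using B'(4)[of s c2] \<open>B \<subseteq> B'\<close> c2K c(3) by blast
    from main[OF c(2,1,5,4) B' this] show ?thesis .
  qed
qed

text \<open>Two components of \<open>C\<close> give a rooted triangle directly, and so does a root with two
neighbours in a connected \<open>C\<close>.  Otherwise \<open>a\<close> has a single neighbour \<open>a1\<close> in \<open>C\<close>, which can take
over as a root for \<open>C - {a1}\<close>; its branch set is then extended by \<open>a\<close>.  This ends when \<open>C\<close> has
only two vertices, which form a path from \<open>a\<close> to \<open>b\<close>.\<close>
lemma rooted_triangle_or_adjacent_degree_two:
  assumes V: "finite V" "two_connected V E" "\<And>e. e \<in> E \<Longrightarrow> card e = 2"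
    and "C \<subseteq> V" "a \<in> V - C" "b \<in> V - C" "a \<noteq> b" "2 \<le> card C" "V - C - {a, b} \<noteq> {}"
    "\<And>u v. u \<in> C \<Longrightarrow> {u, v} \<in> E \<Longrightarrow> v \<in> C \<union> {a, b}"
  shows "rooted_triangle E C a b \<or> adjacent_degree_two E"
  using assms(4-)
proof (induction "card C" arbitrary: C a b rule: less_induct)
  case less
  note CV = less.prems(1) and a = less.prems(2) and b = less.prems(3) and ab = less.prems(4)
    and card = less.prems(5) and out = less.prems(6) and closed = less.prems(7)
  have fin: "finite C" using CV V(1) finite_subset by blast
  have C0: "C \<noteq> {}" using card by auto
  have tch: "touch E {a} U \<and> touch E {b} U" if U: "U \<subseteq> C" "U \<noteq> {}" "\<And>u v. u \<in> U \<Longrightarrow> {u, v} \<in> E \<Longrightarrow> v \<in> U \<union> {a, b}" for U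
  proof -
    have "{u, v} \<in> E \<Longrightarrow> v \<in> U \<union> {b, a}" if "u \<in> U" for u v using U(3)[OF that] by blast
    then show ?thesis
      using neighbour_in_closed_set[OF V(2), of U a b] neighbour_in_closed_set[OF V(2), of U b a] U CV a b ab by blast
  qed
  have ta: "touch E {a} C" and tb: "touch E {b} C" using tch[OF _ C0 closed] by auto
  show ?case
  proof (cases "conn E C")
    case False
    obtain c where c: "c \<in> C" using C0 by blast
    obtain K where K: "conn E K" "c \<in> K" "K \<subseteq> C" "\<And>k v. k \<in> K \<Longrightarrow> v \<in> C - K \<Longrightarrow> {k, v} \<notin> E"
      using component_exists[OF fin c] by metis
    have "K \<noteq> C" using K(1) False by blast
    then obtain c' where c': "c' \<in> C - K" using K(3) by blast
    have "finite (C - K)" using fin by simp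
    from component_exists[OF this c'] obtain X where X: "conn E X" "c' \<in> X" "X \<subseteq> C - K"
      "\<And>k v. k \<in> X \<Longrightarrow> v \<in> C - K - X \<Longrightarrow> {k, v} \<notin> E" by metis
    have tK: "touch E {a} K \<and> touch E {b} K"
      by (rule tch) (use K closed in blast)+
    have tX: "touch E {a} X \<and> touch E {b} X"
    proof (rule tch)
      fix u v assume uv: "u \<in> X" "{u, v} \<in> E"
      then have "v \<in> C \<union> {a, b}" using closed X(3) by blast
      moreover have "v \<notin> C - K - X" using X(4) uv by blast
      moreover have "v \<notin> K"
      proof
        assume "v \<in> K"
        then have "{v, u} \<notin> E" using K(4) uv(1) X(3) by blast
        then show False using uv(2) by (simp add: insert_commute)
      qed
      ultimately show "v \<in> X \<union> {a, b}" by blast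
    qed (use X in auto)
    \<comment> \<open>both components touch both roots; one of them is merged with \<open>a\<close>\<close>
    obtain k where "k \<in> K" "{k, a} \<in> E" using tK by (auto simp: touch_def insert_commute)
    then have "conn E (insert a K)" by (rule conn_insert[OF K(1)])
    then have "rooted_triangle E C a b"
    proof (rule rooted_triangleI[OF _ conn_singleton X(1)])
      show "touch E (insert a K) {b}" using touch_sym[of E "{b}" K] tK by (auto simp: touch_def)
      show "touch E (insert a K) X" using tX by (auto simp: touch_def)
      show "touch E {b} X" using tX by blast
    qed (use K X a b ab in auto)
    then show ?thesis by blast
  next
    case True
    show ?thesis
    proof (cases "(\<exists>c1\<in>C. \<exists>c2\<in>C. c1 \<noteq> c2 \<and> {a, c1} \<in> E \<and> {a, c2} \<in> E) \<or> (\<exists>c1\<in>C. \<exists>c2\<in>C. c1 \<noteq> c2 \<and> {b, c1} \<in> E \<and> {b, c2} \<in> E)")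
      case two: True
      then have "rooted_triangle E C a b"
      proof
        assume "\<exists>c1\<in>C. \<exists>c2\<in>C. c1 \<noteq> c2 \<and> {a, c1} \<in> E \<and> {a, c2} \<in> E"
        then show ?thesis using rooted_triangle_if_two_neighbours[OF fin True, of a b] a b ab tb by blast
      next
        assume "\<exists>c1\<in>C. \<exists>c2\<in>C. c1 \<noteq> c2 \<and> {b, c1} \<in> E \<and> {b, c2} \<in> E"
        then have "rooted_triangle E C b a" using rooted_triangle_if_two_neighbours[OF fin True, of b a] a b ab ta by blast
        then show ?thesis by (rule rooted_triangle_sym)
      qed
      then show ?thesis by blast
    next
      case one: False
      obtain a1 where a1: "a1 \<in> C" "{a, a1} \<in> E" using ta by (auto simp: touch_def)
      obtain b1 where b1: "b1 \<in> C" "{b, b1} \<in> E" using tb by (auto simp: touch_def)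
      have a1u: "c = a1" if "c \<in> C" "{a, c} \<in> E" for c using one a1 that by blast
      have b1u: "c = b1" if "c \<in> C" "{b, c} \<in> E" for c using one b1 that by blast
      have loop: "{v} \<notin> E" for v using V(3)[of "{v}"] by auto
      \<comment> \<open>otherwise this vertex would separate the rest of \<open>C\<close> from the vertices outside\<close>
      have "a1 \<noteq> b1"
      proof
        assume eq: "a1 = b1"
        have "separation V E (C - {a1}) (V - C) {a1}" unfolding separation_def
        proof (intro conjI ballI)
          fix u v assume u: "u \<in> C - {a1}" and v: "v \<in> V - C"
          show "{u, v} \<notin> E"
          proof
            assume e: "{u, v} \<in> E"
            then have "v = a \<or> v = b" using closed[of u v] u v by blast
            then show False using a1u[of u] b1u[of u] e u eq by (auto simp: insert_commute)
          qed
        qed (use CV a1 in auto)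
        then have "C - {a1} = {} \<or> V - C = {}" using V(2) unfolding two_connected_def by fastforce
        moreover have "C - {a1} \<noteq> {}"
        proof
          assume "C - {a1} = {}"
          then have "C = {a1}" using a1 by blast
          then show False using card by simp
        qed
        ultimately show False using a by blast
      qed
      show ?thesis
      proof (cases "C = {a1, b1}")
        case C2: True
        have e: "{a1, b1} \<in> E"
        proof -
          have "{a1} \<subset> C" using C2 \<open>a1 \<noteq> b1\<close> by auto
          then obtain t where "t \<in> C - {a1}" "{a1, t} \<in> E" using True unfolding conn_def by blast
          then show ?thesis using C2 by auto
        qed
        have n1: "v \<in> {a, b1}" if "{a1, v} \<in> E" for v
        proof -
          have "v \<in> C \<union> {a, b}" using closed[OF a1(1) that] .
          moreover have "v \<noteq> a1" using that loop[of a1] by auto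
          moreover have "v \<noteq> b" using that b1u[OF a1(1)] \<open>a1 \<noteq> b1\<close> by (auto simp: insert_commute)
          ultimately show ?thesis using C2 by auto
        qed
        have n2: "v \<in> {a1, b}" if "{b1, v} \<in> E" for v
        proof -
          have "v \<in> C \<union> {a, b}" using closed[OF b1(1) that] .
          moreover have "v \<noteq> b1" using that loop[of b1] by auto
          moreover have "v \<noteq> a" using that a1u[OF b1(1)] \<open>a1 \<noteq> b1\<close> by (auto simp: insert_commute)
          ultimately show ?thesis using C2 by auto
        qed
        have "distinct [a, a1, b1, b]" using a b ab a1 b1 \<open>a1 \<noteq> b1\<close> by auto
        moreover have "{b1, b} \<in> E" using b1(2) by (simp add: insert_commute)
        ultimately have "adjacent_degree_two E" unfolding adjacent_degree_two_def using a1(2) e n1 n2 by blast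
        then show ?thesis by blast
      next
        case C3: False
        define C' where "C' = C - {a1}"
        have cC': "card C' < card C" unfolding C'_def using fin a1(1) by (rule card_Diff1_less)
        have "{a1, b1} \<subset> C" using C3 a1 b1 by blast
        then have "card {a1, b1} < card C" using fin psubset_card_mono by blast
        then have c2: "2 \<le> card C'" using \<open>a1 \<noteq> b1\<close> fin a1(1) by (simp add: C'_def)
        have cl: "v \<in> C' \<union> {a1, b}" if "u \<in> C'" "{u, v} \<in> E" for u v
        proof -
          have "v \<in> C \<union> {a, b}" using closed that by (auto simp: C'_def)
          moreover have "v \<noteq> a" using a1u[of u] that by (auto simp: C'_def insert_commute)
          ultimately show ?thesis by (auto simp: C'_def)
        qed
        have "rooted_triangle E C' a1 b \<or> adjacent_degree_two E"
        proof (rule less.hyps[OF cC' _ _ _ _ c2 _ cl])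
          show "V - C' - {a1, b} \<noteq> {}" using a ab a1 by (auto simp: C'_def)
        qed (use CV a1 b in \<open>auto simp: C'_def\<close>)
        then show ?thesis
        proof
          assume "rooted_triangle E C' a1 b"
          then obtain A B X where *: "conn E A" "conn E B" "conn E X" "a1 \<in> A" "b \<in> B"
             "A \<subseteq> insert a1 C'" "B \<subseteq> insert b C'" "X \<subseteq> C'" "A \<inter> B = {}" "A \<inter> X = {}" "B \<inter> X = {}"
             "touch E A B" "touch E A X" "touch E B X" unfolding rooted_triangle_def by blast
          have "{a1, a} \<in> E" using a1(2) by (simp add: insert_commute)
          then have "conn E (insert a A)" by (rule conn_insert[OF *(1,4)])
          then have "rooted_triangle E C a b"
          proof (rule rooted_triangleI[OF _ *(2,3)])
            show "touch E (insert a A) B" "touch E (insert a A) X" using *(12,13) by (auto simp: touch_def)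
          qed (use * a ab a1 in \<open>auto simp: C'_def\<close>)
          then show ?thesis by blast
        qed blast
      qed
    qed
  qed
qed

section \<open>Contractions preserving connectivity\<close>

definition three_connected :: "'a set \<Rightarrow> 'a set set \<Rightarrow> bool" where
  "three_connected V E \<longleftrightarrow> (\<forall>A B S. separation V E A B S \<longrightarrow> card S \<le> 2 \<longrightarrow> A = {} \<or> B = {})"

text \<open>A cut of two vertices may still split off a single vertex.  Cuts with more vertices on both
sides are those along which a graph can be taken apart.\<close>
definition nearly_three_connected :: "'a set \<Rightarrow> 'a set set \<Rightarrow> bool" where
  "nearly_three_connected V E \<longleftrightarrow> two_connected V E \<and>
     (\<forall>A B S. separation V E A B S \<longrightarrow> card S \<le> 2 \<longrightarrow> card A \<le> 1 \<or> card B \<le> 1)"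

lemma three_connected_imp_nearly: "three_connected V E \<Longrightarrow> nearly_three_connected V E"
  unfolding three_connected_def nearly_three_connected_def two_connected_def
  by (metis card.empty le_numeral_extra(3) one_le_numeral order_trans zero_le)

lemma edge_in_V: "simple_graph (V, E) \<Longrightarrow> {u, v} \<in> E \<Longrightarrow> u \<in> V \<and> v \<in> V \<and> u \<noteq> v"
  unfolding simple_graph_def by fastforce

text \<open>Since \<open>{a, b}\<close> is an edge of the new graph, no separation of it has \<open>a\<close> and \<open>b\<close> on opposite
sides, and \<open>x\<close> can join a side without getting a neighbour on the other one.\<close>
lemma nearly_three_connected_suppress:
  assumes G: "simple_graph (V, E)" "nearly_three_connected V E" and x: "x \<in> V" "{x, a} \<in> E"
    and N: "\<And>v. {x, v} \<in> E \<Longrightarrow> v \<in> {a, b}"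
    and E': "\<And>e. e \<in> E \<Longrightarrow> x \<notin> e \<Longrightarrow> e \<in> E'" "{a, b} \<in> E'"
  shows "nearly_three_connected (V - {x}) E'"
proof -
  have key: "(separation V E (insert x A) B S) \<or> separation V E A (insert x B) S"
    if sep: "separation (V - {x}) E' A B S" for A B S
  proof -
    have ab: "\<not> (a \<in> A \<and> b \<in> B)" "\<not> (a \<in> B \<and> b \<in> A)"
      using sep E'(2) unfolding separation_def by (auto simp: insert_commute)
    have eAB: "{u, v} \<notin> E" if "u \<in> A" "v \<in> B" for u v
    proof
      assume "{u, v} \<in> E"
      moreover have "x \<notin> {u, v}" using sep that unfolding separation_def by auto
      ultimately have "{u, v} \<in> E'" by (rule E'(1))
      then show False using sep that unfolding separation_def by blast
    qed
    have "(a \<notin> B \<and> b \<notin> B) \<or> (a \<notin> A \<and> b \<notin> A)" using ab sep unfolding separation_def by blast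
    then show ?thesis
    proof
      assume *: "a \<notin> B \<and> b \<notin> B"
      have "{x, v} \<notin> E" if "v \<in> B" for v using N[of v] * that by auto
      then have "separation V E (insert x A) B S" using sep eAB x(1) unfolding separation_def by auto
      then show ?thesis by blast
    next
      assume *: "a \<notin> A \<and> b \<notin> A"
      have "{v, x} \<notin> E" if "v \<in> A" for v using N[of v] * that by (auto simp: insert_commute)
      then have "separation V E A (insert x B) S" using sep eAB x(1) unfolding separation_def by auto
      then show ?thesis by blast
    qed
  qed
  have fin: "finite V" using G(1) by (simp add: simple_graph_def)
  have two: "two_connected V E" and q: "\<And>A B S. separation V E A B S \<Longrightarrow> card S \<le> 2 \<Longrightarrow> card A \<le> 1 \<or> card B \<le> 1"
    using G(2) unfolding nearly_three_connected_def by auto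
  have ins: "card A \<le> 1" if "card (insert x A) \<le> 1" "separation (V - {x}) E' A B S \<or> separation (V - {x}) E' B A S" for A B S
  proof -
    have "finite A" "x \<notin> A" using that(2) fin unfolding separation_def by (auto intro: finite_subset[OF _ fin])
    then show ?thesis using that(1) by simp
  qed
  show ?thesis unfolding nearly_three_connected_def
  proof (intro conjI allI impI)
    show "two_connected (V - {x}) E'" unfolding two_connected_def
    proof (intro allI impI)
      fix A B S assume "separation (V - {x}) E' A B S" "card S \<le> 1"
      then show "A = {} \<or> B = {}" using key[of A B S] two unfolding two_connected_def by blast
    qed
    fix A B S assume sep: "separation (V - {x}) E' A B S" and S: "card S \<le> 2"
    show "card A \<le> 1 \<or> card B \<le> 1"
      using key[OF sep]
    proof
      assume "separation V E (insert x A) B S"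
      then show ?thesis using q[OF _ S] ins[of A B S] sep by blast
    next
      assume "separation V E A (insert x B) S"
      then show ?thesis using q[OF _ S] ins[of B A S] sep by blast
    qed
  qed
qed

text \<open>Tutte's argument.  If every edge lay in a separating set of three vertices, take an edge
\<open>{x, y}\<close> and such a set \<open>S = {x, y, z}\<close> with the smallest possible side \<open>A\<close>.  The vertex \<open>z\<close> has a
neighbour \<open>v\<close> in \<open>A\<close>, and \<open>{z, v}\<close> lies in a separating set \<open>S1\<close>.  The adjacent vertices \<open>x\<close>, \<open>y\<close>
miss one of its sides, \<open>A2\<close>.  This side has a neighbour of \<open>v\<close>, and \<open>A2 \<inter> A\<close> is a side of \<open>S1\<close>
smaller than \<open>A\<close>.\<close>
lemma three_connected_contractible_edge:
  assumes fin: "finite V" and E: "\<And>e. e \<in> E \<Longrightarrow> e \<subseteq> V" "\<And>e. e \<in> E \<Longrightarrow> card e = 2"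
    and three: "three_connected V E" and ne: "E \<noteq> {}"
  obtains x y where "{x, y} \<in> E" "\<And>A B S. separation V E A B S \<Longrightarrow> {x, y} \<subseteq> S \<Longrightarrow> card S \<le> 3 \<Longrightarrow> A = {} \<or> B = {}"
proof -
  let ?P = "\<lambda>n. \<exists>x y A B S. {x, y} \<in> E \<and> separation V E A B S \<and> {x, y} \<subseteq> S \<and> card S \<le> 3 \<and> A \<noteq> {} \<and> B \<noteq> {} \<and> card A = n"
  have "\<exists>x y. {x, y} \<in> E \<and> (\<forall>A B S. separation V E A B S \<longrightarrow> {x, y} \<subseteq> S \<longrightarrow> card S \<le> 3 \<longrightarrow> A = {} \<or> B = {})"
  proof (rule ccontr)
    assume "\<not> ?thesis"
    then have bad: "\<exists>A B S. separation V E A B S \<and> {x, y} \<subseteq> S \<and> card S \<le> 3 \<and> A \<noteq> {} \<and> B \<noteq> {}" if "{x, y} \<in> E" for x y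
      using that by blast
    obtain e where "e \<in> E" using ne by blast
    then obtain x0 y0 where "{x0, y0} \<in> E" using E(2) by (metis card_2_iff)
    then have "\<exists>n. ?P n" using bad by blast
    define n where "n = (LEAST n. ?P n)"
    have n: "?P n" "\<And>m. m < n \<Longrightarrow> \<not> ?P m"
      unfolding n_def by (rule LeastI_ex[OF \<open>\<exists>n. ?P n\<close>], rule not_less_Least)
    obtain x y A B S where *: "{x, y} \<in> E" "separation V E A B S" "{x, y} \<subseteq> S" "card S \<le> 3" "A \<noteq> {}" "B \<noteq> {}" "card A = n"
      using n(1) by blast
    have sets: "A \<union> B \<union> S = V" "A \<inter> B = {}" "A \<inter> S = {}" "B \<inter> S = {}" and nAB: "\<And>a b. a \<in> A \<Longrightarrow> b \<in> B \<Longrightarrow> {a, b} \<notin> E"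
      using *(2) unfolding separation_def by auto
    have finS: "finite S" "finite A" using sets(1) fin by (auto intro: finite_subset)
    have xy: "x \<noteq> y" using E(2)[OF *(1)] by auto
    have three': "A' = {} \<or> B' = {}" if "separation V E A' B' S'" "card S' \<le> 2" for A' B' S'
      using three that unfolding three_connected_def by blast
    have "\<not> card S \<le> 2" using three'[OF *(2)] *(5,6) by blast
    then have "card S = 3" using *(4) by simp
    then have "card (S - {x, y}) = 1" using *(3) xy finS by (simp add: card_Diff_subset)
    then obtain z where "S - {x, y} = {z}" by (auto simp: card_1_singleton_iff)
    then have S: "S = {x, y, z}" "z \<noteq> x" "z \<noteq> y" using *(3) by auto
    have "\<exists>v\<in>A. {z, v} \<in> E"
    proof (rule ccontr)
      assume no: "\<not> ?thesis"
      have "separation V E A (insert z B) {x, y}" unfolding separation_def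
      proof (intro conjI ballI)
        fix a b assume "a \<in> A" "b \<in> insert z B"
        then show "{a, b} \<notin> E" using nAB no by (auto simp: insert_commute)
      qed (use sets S in auto)
      moreover have "card {x, y} \<le> 2" by (simp add: card_insert_if)
      ultimately show False using three' *(5) by blast
    qed
    then obtain v where v: "v \<in> A" "{z, v} \<in> E" by blast
    obtain A1 B1 S1 where 1: "separation V E A1 B1 S1" "{z, v} \<subseteq> S1" "card S1 \<le> 3" "A1 \<noteq> {}" "B1 \<noteq> {}"
      using bad[OF v(2)] by blast
    have "\<exists>A2 B2. separation V E A2 B2 S1 \<and> A2 \<noteq> {} \<and> B2 \<noteq> {} \<and> x \<notin> A2 \<and> y \<notin> A2"
    proof (cases "x \<in> A1 \<or> y \<in> A1")
      case False then show ?thesis using 1 by blast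
    next
      case True
      have "A1 \<inter> B1 = {}" "{x, y} \<in> E" "\<And>a b. a \<in> A1 \<Longrightarrow> b \<in> B1 \<Longrightarrow> {a, b} \<notin> E" using 1(1) *(1) unfolding separation_def by auto
      then have "x \<notin> B1 \<and> y \<notin> B1" using True by (metis IntI empty_iff insert_commute)
      then show ?thesis using separation_sym[OF 1(1)] 1 by blast
    qed
    then obtain A2 B2 where 2: "separation V E A2 B2 S1" "A2 \<noteq> {}" "B2 \<noteq> {}" "x \<notin> A2" "y \<notin> A2" by blast
    have sets2: "A2 \<union> B2 \<union> S1 = V" "A2 \<inter> B2 = {}" "A2 \<inter> S1 = {}" "B2 \<inter> S1 = {}" and n2: "\<And>a b. a \<in> A2 \<Longrightarrow> b \<in> B2 \<Longrightarrow> {a, b} \<notin> E"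
      using 2(1) unfolding separation_def by auto
    have finS1: "finite S1" using sets2(1) fin by (auto intro: finite_subset)
    have "\<exists>u\<in>A2. {u, v} \<in> E"
    proof (rule ccontr)
      assume no: "\<not> ?thesis"
      have "separation V E A2 (insert v B2) (S1 - {v})" unfolding separation_def
      proof (intro conjI ballI)
        fix a b assume "a \<in> A2" "b \<in> insert v B2"
        then show "{a, b} \<notin> E" using n2 no by auto
      qed (use sets2 1(2) in auto)
      moreover have "card (S1 - {v}) \<le> 2" using 1(2,3) finS1 by (simp add: card_Diff_singleton_if)
      ultimately show False using three' 2(2) by blast
    qed
    then obtain u where u: "u \<in> A2" "{u, v} \<in> E" by blast
    have "u \<in> A"
    proof -
      have "u \<in> V" using u(2) E(1) by blast
      moreover have "u \<notin> B" using nAB[OF v(1)] u(2) by (auto simp: insert_commute)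
      moreover have "u \<notin> S" using u(1) 2(4,5) 1(2) sets2(3) S(1) by auto
      ultimately show ?thesis using sets(1) by blast
    qed
    \<comment> \<open>the new, smaller side: \<open>A2\<close> meets \<open>S\<close> at most in \<open>z\<close>, which belongs to \<open>S1\<close>, so \<open>D\<close> has no
      neighbours outside \<open>D \<union> S1\<close>\<close>
    define D where "D = A2 \<inter> A"
    have "separation V E D (V - D - S1) S1" unfolding separation_def
    proof (intro conjI ballI)
      fix a b assume a: "a \<in> D" and b: "b \<in> V - D - S1"
      then consider "b \<in> B2" | "b \<in> A2" "b \<in> B" | "b \<in> A2" "b \<in> S" using sets2(1) sets(1) by (auto simp: D_def)
      then show "{a, b} \<notin> E"
      proof cases
        case 1 then show ?thesis using n2 a by (auto simp: D_def)
      next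
        case 2 then show ?thesis using nAB a by (auto simp: D_def)
      next
        case 3
        then have "b = z" using S(1) \<open>x \<notin> A2\<close> \<open>y \<notin> A2\<close> by auto
        then show ?thesis using 3 1(2) sets2(3) by auto
      qed
    qed (use sets2 sets in \<open>auto simp: D_def\<close>)
    moreover have "D \<noteq> {}" using u(1) \<open>u \<in> A\<close> by (auto simp: D_def)
    moreover have "V - D - S1 \<noteq> {}"
    proof -
      have "B2 \<subseteq> V - D - S1" using sets2 by (auto simp: D_def)
      then show ?thesis using 2(3) by blast
    qed
    ultimately have "?P (card D)" using v(2) 1(2,3) by blast
    moreover have "card D < n"
    proof -
      have "v \<notin> D" using 1(2) sets2(3) by (auto simp: D_def)
      then have "D \<subset> A" using v(1) by (auto simp: D_def)
      then show ?thesis using *(7) finS(2) psubset_card_mono by blast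
    qed
    ultimately show False using n(2) by blast
  qed
  then show ?thesis using that by blast
qed

text \<open>A cut of two vertices in the contracted graph either contains the new vertex, and becomes a
separating set of three vertices containing \<open>{x, y}\<close>, or it is a cut of the original graph.\<close>
lemma three_connected_contract:
  assumes G: "simple_graph (V, E)" and three: "three_connected V E" and xy: "{x, y} \<in> E"
    and no: "\<And>A B S. separation V E A B S \<Longrightarrow> {x, y} \<subseteq> S \<Longrightarrow> card S \<le> 3 \<Longrightarrow> A = {} \<or> B = {}"
    and E': "\<And>u v. {u, v} \<in> E \<Longrightarrow> {u, v} \<noteq> {x, y} \<Longrightarrow> {if u = y then x else u, if v = y then x else v} \<in> E'"
  shows "three_connected (V - {y}) E'"
  unfolding three_connected_def
proof (intro allI impI)
  fix A B S assume sep: "separation (V - {y}) E' A B S" and S: "card S \<le> 2"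
  have V: "x \<in> V" "y \<in> V" "x \<noteq> y" using edge_in_V[OF G xy] by auto
  have fin: "finite V" using G by (simp add: simple_graph_def)
  have sets: "A \<union> B \<union> S = V - {y}" "A \<inter> B = {}" "A \<inter> S = {}" "B \<inter> S = {}" and nAB: "\<And>a b. a \<in> A \<Longrightarrow> b \<in> B \<Longrightarrow> {a, b} \<notin> E'"
    using sep unfolding separation_def by auto
  have yn: "y \<notin> A" "y \<notin> B" "y \<notin> S" using sets(1) by auto
  have nE: "{a, b} \<notin> E" if "a \<in> A" "b \<in> B" for a b
  proof
    assume e: "{a, b} \<in> E"
    have "{a, b} \<noteq> {x, y}" using that yn by (auto simp: doubleton_eq_iff)
    then have "{a, b} \<in> E'" using E'[OF e] that yn by (auto split: if_splits)
    then show False using nAB that by blast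
  qed
  have three': "A' = {} \<or> B' = {}" if "separation V E A' B' S" for A' B'
    using three that S unfolding three_connected_def by blast
  have yedge: "{x, b} \<in> E'" if "{y, b} \<in> E" "b \<noteq> x" for b
  proof -
    have "b \<noteq> y" using edge_in_V[OF G that(1)] by auto
    moreover have "{y, b} \<noteq> {x, y}" using that(2) V by (auto simp: doubleton_eq_iff)
    ultimately show ?thesis using E'[OF that(1)] by auto
  qed
  consider "x \<in> S" | "x \<in> A" | "x \<in> B" using sets(1) V by blast
  then show "A = {} \<or> B = {}"
  proof cases
    case 1
    have "separation V E A B (insert y S)" unfolding separation_def using sets yn V nE by auto
    moreover have "{x, y} \<subseteq> insert y S" using 1 by simp
    moreover have "card (insert y S) \<le> 3"
    proof -
      have "finite S" using sets(1) fin by (auto intro: finite_subset[of S V])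
      then show ?thesis using S by (simp add: card_insert_if)
    qed
    ultimately show ?thesis by (rule no)
  next
    case 2
    have "{y, b} \<notin> E" if "b \<in> B" for b using yedge[of b] nAB[OF 2 that] 2 that sets(2) by blast
    then have "separation V E (insert y A) B S" unfolding separation_def using sets yn V nE by auto
    then show ?thesis using three' by blast
  next
    case 3
    have "{a, y} \<notin> E" if "a \<in> A" for a
    proof
      assume "{a, y} \<in> E"
      then have "{x, a} \<in> E'" using yedge[of a] 3 that sets(2) by (auto simp: insert_commute)
      then show False using nAB[OF that 3] by (simp add: insert_commute)
    qed
    then have "separation V E A (insert y B) S" unfolding separation_def using sets yn V nE by auto
    then show ?thesis using three' by blast
  qed
qed

text \<open>Otherwise \<open>a\<close> would separate \<open>x\<close> from the other vertices.\<close>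
lemma degree_at_least_two:
  assumes "two_connected V E" "finite V" "3 \<le> card V" "x \<in> V" "a \<in> V" "a \<noteq> x"
  shows "\<exists>v. {x, v} \<in> E \<and> v \<noteq> a"
proof (rule ccontr)
  assume no: "\<not> ?thesis"
  have "separation V E {x} (V - {x, a}) {a}" unfolding separation_def using assms no by auto
  then have "V - {x, a} = {}" using assms(1) unfolding two_connected_def by fastforce
  then have "card V \<le> card {x, a}" by (intro card_mono) auto
  then show False using assms(3,6) by simp
qed

text \<open>A side consisting of a single vertex would have all its neighbours in a set of at most two
vertices.\<close>
lemma nearly_three_connected_min_degree_three:
  assumes G: "simple_graph (V, E)" "nearly_three_connected V E" "a0 \<in> V"
    and deg: "\<And>x a b. x \<in> V \<Longrightarrow> a \<in> V \<Longrightarrow> b \<in> V \<Longrightarrow> \<exists>v. {x, v} \<in> E \<and> v \<noteq> a \<and> v \<noteq> b"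
  shows "three_connected V E"
  unfolding three_connected_def
proof (intro allI impI)
  fix A B S assume sep: "separation V E A B S" and S: "card S \<le> 2"
  have fin: "finite V" using G by (simp add: simple_graph_def)
  have small: "A = {}" if sm: "card A \<le> 1" "separation V E A B S" for A B
  proof (rule ccontr)
    assume "A \<noteq> {}"
    have AV: "A \<subseteq> V" "S \<subseteq> V" using sm(2) by (auto simp: separation_def)
    then have "finite A" "finite S" using fin finite_subset by auto
    then have "card A = 1" using sm(1) \<open>A \<noteq> {}\<close> card_gt_0_iff[of A] by simp
    then obtain x where x: "A = {x}" by (rule card_1_singletonE)
    obtain c1 c2 where c: "S \<subseteq> {c1, c2}" "c1 \<in> V" "c2 \<in> V"
    proof -
      consider "card S = 0" | "card S = 1" | "card S = 2" using S by linarith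
      then show ?thesis
      proof cases
        \<comment> \<open>any vertices may serve as \<open>c1\<close> and \<open>c2\<close> when \<open>S\<close> is empty\<close>
        case 1 then show ?thesis using that[of a0 a0] \<open>finite S\<close> G(3) by auto
      next
        case 2 then show ?thesis using that AV by (auto simp: card_1_singleton_iff)
      next
        case 3 then show ?thesis using that AV by (auto simp: card_2_iff)
      qed
    qed
    obtain v where v: "{x, v} \<in> E" "v \<noteq> c1" "v \<noteq> c2" using deg[of x c1 c2] x AV c by auto
    then have "v \<in> V" "v \<noteq> x" using edge_in_V[OF G(1) v(1)] by auto
    then have "v \<in> B" using sm(2) c v x by (auto simp: separation_def)
    then show False using sm(2) x v(1) by (auto simp: separation_def)
  qed
  have "card A \<le> 1 \<or> card B \<le> 1" using G(2) sep S unfolding nearly_three_connected_def by blast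
  then show "A = {} \<or> B = {}" using small sep separation_sym by blast
qed

section \<open>Small graphs containing H3 or F3\<close>

definition complete_bipartite_33 :: "'a set \<Rightarrow> 'a set set \<Rightarrow> bool" where
  "complete_bipartite_33 V E \<longleftrightarrow> (\<exists>P Q. V = P \<union> Q \<and> P \<inter> Q = {} \<and> card P = 3 \<and> card Q = 3 \<and>
     (\<forall>e\<in>E. \<exists>p\<in>P. \<exists>q\<in>Q. e = {p, q}) \<and> (\<forall>p\<in>P. \<forall>q\<in>Q. {p, q} \<in> E))"

text \<open>Two vertices \<open>x\<close> and \<open>y\<close> of degree two are attached to disjoint pairs; the edges among \<open>a\<close>,
\<open>b\<close>, \<open>c\<close>, \<open>d\<close> are left open.\<close>
definition two_caps :: "'a set \<Rightarrow> 'a set set \<Rightarrow> bool" where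
  "two_caps V E \<longleftrightarrow> (\<exists>a b x c d y. distinct [a, b, x, c, d, y] \<and> V = {a, b, x, c, d, y} \<and>
     (\<forall>v. {x, v} \<in> E \<longleftrightarrow> v = a \<or> v = b) \<and> (\<forall>v. {y, v} \<in> E \<longleftrightarrow> v = c \<or> v = d))"

lemma H3_minorI:
  fixes B :: "node \<Rightarrow> 'a set"
  assumes simple: "simple_graph (V, E)" and B: "\<And>n. conn E (B n)" "\<And>n. B n \<subseteq> V" "\<And>m n. m \<noteq> n \<Longrightarrow> B m \<inter> B n = {}"
    and t: "touch E (B V1) (B V12)" "touch E (B V12) (B V2)" "touch E (B V2) (B V23)" "touch E (B V23) (B V3)"
      "touch E (B V1) (B V3)" "touch E (B V1) (B V13)" "touch E (B V2) (B V13)" "touch E (B V3) (B V13)"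
  shows "has_minor_iso (V, E) H3"
proof (rule has_minor_isoI[OF simple, where B = B])
  have fst: "n \<in> fst H3" for n by (cases n) (simp_all add: H3_def)
  fix e assume "e \<in> snd H3"
  then have "\<exists>x y. e = {x, y} \<and> x \<noteq> y \<and> touch E (B x) (B y)"
    unfolding H3_def using t by fastforce
  then show "\<exists>x y s t. e = {x, y} \<and> x \<in> fst H3 \<and> y \<in> fst H3 \<and> x \<noteq> y \<and> s \<in> B x \<and> t \<in> B y \<and> {s, t} \<in> E"
    using fst unfolding touch_def by blast
qed (use B in auto)

lemma F3_minorI:
  fixes B :: "node \<Rightarrow> 'a set"
  assumes simple: "simple_graph (V, E)" and B: "\<And>n. conn E (B n)" "\<And>n. B n \<subseteq> V" "\<And>m n. m \<noteq> n \<Longrightarrow> B m \<inter> B n = {}"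
    and t: "touch E (B V1) (B V2)" "touch E (B V1) (B V3)" "touch E (B V2) (B V3)" "touch E (B V1) (B V12)"
      "touch E (B V2) (B V12)" "touch E (B V1) (B V13)" "touch E (B V3) (B V13)" "touch E (B V2) (B V23)" "touch E (B V3) (B V23)"
  shows "has_minor_iso (V, E) F3"
proof (rule has_minor_isoI[OF simple, where B = B])
  have fst: "n \<in> fst F3" for n by (cases n) (simp_all add: F3_def)
  fix e assume "e \<in> snd F3"
  then have "\<exists>x y. e = {x, y} \<and> x \<noteq> y \<and> touch E (B x) (B y)"
    unfolding F3_def using t by fastforce
  then show "\<exists>x y s t. e = {x, y} \<and> x \<in> fst F3 \<and> y \<in> fst F3 \<and> x \<noteq> y \<and> s \<in> B x \<and> t \<in> B y \<and> {s, t} \<in> E"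
    using fst unfolding touch_def by blast
qed (use B in auto)

text \<open>Lists branch sets for the nodes of F3 and H3, in the order of the constructors.\<close>
fun node_table :: "'b \<Rightarrow> 'b \<Rightarrow> 'b \<Rightarrow> 'b \<Rightarrow> 'b \<Rightarrow> 'b \<Rightarrow> node \<Rightarrow> 'b" where
  "node_table v1 v2 v3 v12 v13 v23 V1 = v1"
| "node_table v1 v2 v3 v12 v13 v23 V2 = v2"
| "node_table v1 v2 v3 v12 v13 v23 V3 = v3"
| "node_table v1 v2 v3 v12 v13 v23 V12 = v12"
| "node_table v1 v2 v3 v12 v13 v23 V13 = v13"
| "node_table v1 v2 v3 v12 v13 v23 V23 = v23"

lemma conn_pair: "{u, v} \<in> E \<Longrightarrow> conn E {u, v}"
  using conn_Un[of E "{u}" "{v}" u v] conn_singleton[of E u] conn_singleton[of E v] by (simp add: insert_commute)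

lemma node_table_disjoint:
  assumes "A1 \<inter> A2 = {}" "A1 \<inter> A3 = {}" "A1 \<inter> A12 = {}" "A1 \<inter> A13 = {}" "A1 \<inter> A23 = {}"
    "A2 \<inter> A3 = {}" "A2 \<inter> A12 = {}" "A2 \<inter> A13 = {}" "A2 \<inter> A23 = {}"
    "A3 \<inter> A12 = {}" "A3 \<inter> A13 = {}" "A3 \<inter> A23 = {}" "A12 \<inter> A13 = {}" "A12 \<inter> A23 = {}" "A13 \<inter> A23 = {}"
    and "m \<noteq> n"
  shows "node_table A1 A2 A3 A12 A13 A23 m \<inter> node_table A1 A2 A3 A12 A13 A23 n = {}"
  using assms by (cases m; cases n) (simp_all add: Int_commute)

lemma H3_subgraph:
  assumes simple: "simple_graph (V, E)" and d: "distinct [v1, v2, v3, v12, v13, v23]"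
    and e: "{v1,v12} \<in> E" "{v12,v2} \<in> E" "{v2,v23} \<in> E" "{v23,v3} \<in> E" "{v1,v3} \<in> E" "{v1,v13} \<in> E" "{v2,v13} \<in> E" "{v3,v13} \<in> E"
  shows "has_minor_iso (V, E) H3"
proof (rule H3_minorI[OF simple, where B = "node_table {v1} {v2} {v3} {v12} {v13} {v23}"])
  have V: "v1 \<in> V" "v2 \<in> V" "v3 \<in> V" "v12 \<in> V" "v13 \<in> V" "v23 \<in> V"
    using edge_in_V[OF simple e(1)] edge_in_V[OF simple e(3)] edge_in_V[OF simple e(8)] by auto
  show "conn E (node_table {v1} {v2} {v3} {v12} {v13} {v23} n)" for n by (cases n) (simp_all add: conn_singleton)
  show "node_table {v1} {v2} {v3} {v12} {v13} {v23} n \<subseteq> V" for n using V by (cases n) simp_all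
  show "node_table {v1} {v2} {v3} {v12} {v13} {v23} m \<inter> node_table {v1} {v2} {v3} {v12} {v13} {v23} n = {}" if "m \<noteq> n" for m n
    by (rule node_table_disjoint) (use d that in auto)
qed (use e in \<open>simp_all add: touch_def\<close>)

lemma F3_subgraph:
  assumes simple: "simple_graph (V, E)" and d: "distinct [v1, v2, v3, v12, v13, v23]"
    and e: "{v1,v2} \<in> E" "{v1,v3} \<in> E" "{v2,v3} \<in> E" "{v1,v12} \<in> E" "{v2,v12} \<in> E" "{v1,v13} \<in> E" "{v3,v13} \<in> E" "{v2,v23} \<in> E" "{v3,v23} \<in> E"
  shows "has_minor_iso (V, E) F3"
proof (rule F3_minorI[OF simple, where B = "node_table {v1} {v2} {v3} {v12} {v13} {v23}"])
  have V: "v1 \<in> V" "v2 \<in> V" "v3 \<in> V" "v12 \<in> V" "v13 \<in> V" "v23 \<in> V"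
    using edge_in_V[OF simple e(1)] edge_in_V[OF simple e(5)] edge_in_V[OF simple e(7)] edge_in_V[OF simple e(8)] by auto
  show "conn E (node_table {v1} {v2} {v3} {v12} {v13} {v23} n)" for n by (cases n) (simp_all add: conn_singleton)
  show "node_table {v1} {v2} {v3} {v12} {v13} {v23} n \<subseteq> V" for n using V by (cases n) simp_all
  show "node_table {v1} {v2} {v3} {v12} {v13} {v23} m \<inter> node_table {v1} {v2} {v3} {v12} {v13} {v23} n = {}" if "m \<noteq> n" for m n
    by (rule node_table_disjoint) (use d that in auto)
qed (use e in \<open>simp_all add: touch_def\<close>)

text \<open>Contract \<open>{a1, b2}\<close>.  The new vertex, \<open>b1\<close>, \<open>b3\<close> and \<open>a2\<close> are the corners of the complete
graph on four vertices; \<open>x\<close> subdivides its edge from the new vertex to \<open>b1\<close>, and \<open>a3\<close> the one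
between \<open>b1\<close> and \<open>b3\<close>.\<close>
lemma K33_subdivided_has_H3_minor:
  assumes simple: "simple_graph (V, E)" and d: "distinct [a1, a2, a3, b1, b2, b3, x]"
    and e: "{a1,x} \<in> E" "{x,b1} \<in> E" "{a1,b2} \<in> E" "{a1,b3} \<in> E" "{a2,b1} \<in> E" "{a2,b2} \<in> E" "{a2,b3} \<in> E"
      "{a3,b1} \<in> E" "{a3,b2} \<in> E" "{a3,b3} \<in> E"
  shows "has_minor_iso (V, E) H3"
proof (rule H3_minorI[OF simple, where B = "node_table {a1, b2} {b1} {b3} {x} {a2} {a3}"])
  have V: "a1 \<in> V" "a2 \<in> V" "a3 \<in> V" "b1 \<in> V" "b2 \<in> V" "b3 \<in> V" "x \<in> V"
    using edge_in_V[OF simple e(1)] edge_in_V[OF simple e(3)] edge_in_V[OF simple e(5)] edge_in_V[OF simple e(10)] by auto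
  have "conn E {a1, b2}" using e(3) by (rule conn_pair)
  then show "conn E (node_table {a1, b2} {b1} {b3} {x} {a2} {a3} n)" for n by (cases n) (simp_all add: conn_singleton)
  show "node_table {a1, b2} {b1} {b3} {x} {a2} {a3} n \<subseteq> V" for n using V by (cases n) simp_all
  show "node_table {a1, b2} {b1} {b3} {x} {a2} {a3} m \<inter> node_table {a1, b2} {b1} {b3} {x} {a2} {a3} n = {}" if "m \<noteq> n" for m n
    by (rule node_table_disjoint) (use d that in auto)
qed (use e in \<open>auto simp: touch_def insert_commute\<close>)

text \<open>Contract \<open>{r, y'}\<close>.  The corners are \<open>q\<close>, \<open>p\<close>, the new vertex and \<open>s\<close>; the cap \<open>x'\<close>
subdivides the edge from \<open>q\<close> to \<open>p\<close>, and \<open>x\<close> the one from \<open>p\<close> to the new vertex.\<close>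
lemma K4_caps_subdivided_has_H3_minor:
  assumes simple: "simple_graph (V, E)" and d: "distinct [p, q, r, s, x', y', x]"
    and e: "{x',p} \<in> E" "{x',q} \<in> E" "{y',r} \<in> E" "{y',s} \<in> E" "{p,s} \<in> E" "{q,r} \<in> E" "{q,s} \<in> E" "{p,x} \<in> E" "{x,r} \<in> E"
  shows "has_minor_iso (V, E) H3"
proof (rule H3_minorI[OF simple, where B = "node_table {q} {p} {r, y'} {x'} {s} {x}"])
  have V: "p \<in> V" "q \<in> V" "r \<in> V" "s \<in> V" "x' \<in> V" "y' \<in> V" "x \<in> V"
    using edge_in_V[OF simple e(1)] edge_in_V[OF simple e(2)] edge_in_V[OF simple e(3)] edge_in_V[OF simple e(5)] edge_in_V[OF simple e(8)] by auto
  have "conn E {r, y'}" using e(3) by (intro conn_pair) (simp add: insert_commute)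
  then show "conn E (node_table {q} {p} {r, y'} {x'} {s} {x} n)" for n by (cases n) (simp_all add: conn_singleton)
  show "node_table {q} {p} {r, y'} {x'} {s} {x} n \<subseteq> V" for n using V by (cases n) simp_all
  show "node_table {q} {p} {r, y'} {x'} {s} {x} m \<inter> node_table {q} {p} {r, y'} {x'} {s} {x} n = {}" if "m \<noteq> n" for m n
    by (rule node_table_disjoint) (use d that in auto)
qed (use e in \<open>auto simp: touch_def insert_commute\<close>)

text \<open>Otherwise the other two vertices would be a cut with two vertices on both sides.\<close>
lemma edge_between_pairs:
  assumes Q: "nearly_three_connected V E" and V: "card V = 6" "{u1, u2, w1, w2} \<subseteq> V" and d: "distinct [u1, u2, w1, w2]"
  shows "{u1, w1} \<in> E \<or> {u1, w2} \<in> E \<or> {u2, w1} \<in> E \<or> {u2, w2} \<in> E"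
proof (rule ccontr)
  assume no: "\<not> ?thesis"
  have fin: "finite V" using V(1) by (intro card_ge_0_finite) simp
  have "separation V E {u1, u2} {w1, w2} (V - {u1, u2, w1, w2})"
    unfolding separation_def using no V(2) d by auto
  moreover have "card (V - {u1, u2, w1, w2}) \<le> 2"
    using card_Diff_subset[OF _ V(2)] V(1) d by simp
  ultimately have "card {u1, u2} \<le> 1 \<or> card {w1, w2} \<le> 1" using Q unfolding nearly_three_connected_def by blast
  then show False using d by simp
qed

lemma six_element_enum:
  assumes "card V = 6" "distinct [x, a, b]" "{x, a, b} \<subseteq> V"
  obtains r1 r2 r3 where "distinct [x, a, b, r1, r2, r3]" "V = {x, a, b, r1, r2, r3}"
proof -
  have "card (V - {x, a, b}) = 3" using card_Diff_subset[OF _ assms(3)] assms(1,2) by simp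
  then obtain r1 r2 r3 where r: "V - {x, a, b} = {r1, r2, r3}" "r1 \<noteq> r2" "r1 \<noteq> r3" "r2 \<noteq> r3" by (auto simp: card_3_iff)
  then have "distinct [x, a, b, r1, r2, r3]" using assms(2) by (auto simp: set_eq_iff) 
  moreover have "V = {x, a, b, r1, r2, r3}" using r(1) assms(3) by blast
  ultimately show ?thesis using that by blast
qed

text \<open>Let \<open>x\<close> have the neighbours \<open>a\<close>, \<open>b\<close>.  A further vertex adjacent to neither \<open>a\<close> nor \<open>b\<close> is
the second cap.  If there is none, then the edges that \<open>edge_between_pairs\<close> provides and the
absence of the two minors are contradictory, which is a finite propositional check over the
possible edges.\<close>
lemma six_vertices_degree_two:
  assumes simple: "simple_graph (V, E)" and Q: "nearly_three_connected V E" and V: "card V = 6"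
    and x: "x \<in> V" "a \<in> V" "b \<in> V" "\<And>v. {x, v} \<in> E \<Longrightarrow> v = a \<or> v = b"
    and noF: "\<not> has_minor_iso (V, E) F3" and noH: "\<not> has_minor_iso (V, E) H3"
  shows "two_caps V E"
proof -
  have fin: "finite V" using simple by (simp add: simple_graph_def)
  have two: "two_connected V E" using Q by (simp add: nearly_three_connected_def)
  have deg: "\<exists>v. {u, v} \<in> E \<and> v \<noteq> c" if "u \<in> V" "c \<in> V" "c \<noteq> u" for u c
    using degree_at_least_two[OF two fin, of u c] that V by simp
  obtain c where c: "c \<in> V" "c \<noteq> x"
  proof -
    have "\<not> V \<subseteq> {x}" using card_mono[of "{x}" V] V by auto
    then show ?thesis using that by blast
  qed
  obtain v1 where v1: "{x, v1} \<in> E" using deg[OF x(1) c] by blast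
  then have "v1 \<in> V" "v1 \<noteq> x" using edge_in_V[OF simple v1] by auto
  then obtain v2 where v2: "{x, v2} \<in> E" "v2 \<noteq> v1" using deg[of x v1] x(1) by blast
  then have "v2 \<noteq> x" using edge_in_V[OF simple v2(1)] by auto
  then have xa: "x \<noteq> a \<and> x \<noteq> b \<and> {x, a} \<in> E \<and> {x, b} \<in> E \<and> a \<noteq> b"
    using x(4)[OF v1] x(4)[OF v2(1)] v1 v2 \<open>v1 \<noteq> x\<close> by auto
  then obtain r1 r2 r3 where d: "distinct [x, a, b, r1, r2, r3]" and Ve: "V = {x, a, b, r1, r2, r3}"
    using six_element_enum[of V x a b] V x by auto
  have sym: "{u, v} \<in> E \<Longrightarrow> {v, u} \<in> E" for u v by (simp add: insert_commute)
  have cap: "two_caps V E"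
    if r: "distinct [x, a, b, i, j, k]" "V = {x, a, b, i, j, k}" "{a, i} \<notin> E" "{b, i} \<notin> E" for i j k
  proof -
    have sub: "v = j \<or> v = k" if "{i, v} \<in> E" for v
    proof -
      have "v \<in> V" "v \<noteq> i" using edge_in_V[OF simple that] by auto
      moreover have "v \<noteq> x" using x(4)[of i] sym[OF that] r(1) by auto
      moreover have "v \<noteq> a" "v \<noteq> b" using sym[OF that] r by auto
      ultimately show ?thesis using r(2) by auto
    qed
    have "{i, j} \<in> E" "{i, k} \<in> E" using deg[of i k] deg[of i j] sub r(1,2) by auto
    then have "\<forall>v. {i, v} \<in> E \<longleftrightarrow> v = j \<or> v = k" using sub by blast
    moreover have "\<forall>v. {x, v} \<in> E \<longleftrightarrow> v = a \<or> v = b" using xa x(4) by blast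
    moreover have "distinct [a, b, x, j, k, i]" "V = {a, b, x, j, k, i}" using r by auto
    ultimately show ?thesis unfolding two_caps_def by blast
  qed
  show ?thesis
  proof (rule ccontr)
    assume no: "\<not> ?thesis"
    have c1: "{a, r1} \<in> E \<or> {b, r1} \<in> E" using cap[of r1 r2 r3] no d Ve by blast
    have c2: "{a, r2} \<in> E \<or> {b, r2} \<in> E" using cap[of r2 r1 r3] no d Ve by (auto simp: insert_commute)
    have c3: "{a, r3} \<in> E \<or> {b, r3} \<in> E" using cap[of r3 r1 r2] no d Ve by (auto simp: insert_commute)
    have nx: "{x, r1} \<notin> E" "{x, r2} \<notin> E" "{x, r3} \<notin> E" using x(4) d by auto
    note cross = edge_between_pairs[OF Q V]
    have A: "{a, r1} \<in> E \<or> {a, r2} \<in> E" "{a, r1} \<in> E \<or> {a, r3} \<in> E" "{a, r2} \<in> E \<or> {a, r3} \<in> E"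
      using cross[of x a r1 r2] cross[of x a r1 r3] cross[of x a r2 r3] nx d Ve by auto
    have B: "{b, r1} \<in> E \<or> {b, r2} \<in> E" "{b, r1} \<in> E \<or> {b, r3} \<in> E" "{b, r2} \<in> E \<or> {b, r3} \<in> E"
      using cross[of x b r1 r2] cross[of x b r1 r3] cross[of x b r2 r3] nx d Ve by auto
    have R: "{r1, r2} \<in> E \<or> {r1, r3} \<in> E" "{r1, r2} \<in> E \<or> {r2, r3} \<in> E" "{r1, r3} \<in> E \<or> {r2, r3} \<in> E"
      using cross[of x r1 r2 r3] cross[of x r2 r1 r3] cross[of x r3 r1 r2] nx d Ve by (auto simp: insert_commute)
    have C: "{i, j} \<in> E \<or> {b, i} \<in> E \<or> {a, j} \<in> E \<or> {a, b} \<in> E"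
      if "i \<in> {r1, r2, r3}" "j \<in> {r1, r2, r3}" "i \<noteq> j" for i j
      using cross[of i a j b] that d Ve by (auto simp: insert_commute)
    \<comment> \<open>In both cases \<open>x\<close> subdivides the edge between \<open>a\<close> and \<open>b\<close> of a complete graph on four
      vertices, and one of \<open>i\<close>, \<open>k\<close> subdivides a second edge.\<close>
    have H: "\<not> ({a, i} \<in> E \<and> {i, k} \<in> E \<and> {b, k} \<in> E \<and> {a, j} \<in> E \<and> {b, j} \<in> E \<and> ({i, j} \<in> E \<or> {j, k} \<in> E))"
      if "distinct [i, j, k]" "{i, j, k} \<subseteq> {r1, r2, r3}" for i j k
    proof
      assume *: "{a, i} \<in> E \<and> {i, k} \<in> E \<and> {b, k} \<in> E \<and> {a, j} \<in> E \<and> {b, j} \<in> E \<and> ({i, j} \<in> E \<or> {j, k} \<in> E)"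
      have dd: "distinct [x, a, b, i, j, k]" using that d by auto
      from * have "{i, j} \<in> E \<or> {j, k} \<in> E" by blast
      then have "has_minor_iso (V, E) H3"
      proof
        assume "{i, j} \<in> E"
        then show ?thesis using H3_subgraph[OF simple, of i b a k j x] dd * xa by (auto simp: insert_commute)
      next
        assume "{j, k} \<in> E"
        then show ?thesis using H3_subgraph[OF simple, of k a b i j x] dd * xa by (auto simp: insert_commute)
      qed
      then show False using noH by blast
    qed
    have F: "\<not> ({a, i} \<in> E \<and> {a, j} \<in> E \<and> {b, j} \<in> E \<and> {b, k} \<in> E \<and> {a, b} \<in> E \<and> {i, j} \<in> E \<and> {j, k} \<in> E)"
      if "distinct [i, j, k]" "{i, j, k} \<subseteq> {r1, r2, r3}" for i j k
    proof
      assume *: "{a, i} \<in> E \<and> {a, j} \<in> E \<and> {b, j} \<in> E \<and> {b, k} \<in> E \<and> {a, b} \<in> E \<and> {i, j} \<in> E \<and> {j, k} \<in> E"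
      have dd: "distinct [x, a, b, i, j, k]" using that d by auto
      then have "has_minor_iso (V, E) F3"
        using F3_subgraph[OF simple, of a b j x i k] * xa by (auto simp: insert_commute)
      then show False using noF by blast
    qed
    have swap: "{r2, r1} = {r1, r2}" "{r3, r1} = {r1, r3}" "{r3, r2} = {r2, r3}" by auto
    have dr: "r1 \<noteq> r2" "r1 \<noteq> r3" "r2 \<noteq> r3" using d by auto
    note inst = H[of r1 r2 r3] H[of r1 r3 r2] H[of r2 r1 r3] H[of r2 r3 r1] H[of r3 r1 r2] H[of r3 r2 r1]
       F[of r1 r2 r3] F[of r1 r3 r2] F[of r2 r1 r3] F[of r2 r3 r1] F[of r3 r1 r2] F[of r3 r2 r1]
       C[of r1 r2] C[of r1 r3] C[of r2 r1] C[of r2 r3] C[of r3 r1] C[of r3 r2]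
    show False
      using inst[simplified swap, simplified dr dr[symmetric] insert_subset insert_iff distinct.simps list.set, simplified] c1 c2 c3 A B R by sat
  qed
qed

text \<open>Without a triangle, the three neighbours of a vertex are independent, so each of them is
adjacent to all other three vertices; these are independent for the same reason.  If there is a
triangle, Hall's condition yields a perfect matching from it to the other three vertices, and
together with the degrees and the edges between pairs this always produces H3.\<close>
lemma six_vertices_min_degree_three:
  assumes simple: "simple_graph (V, E)" and Q: "nearly_three_connected V E" and V: "card V = 6"
    and deg: "\<And>x a b. x \<in> V \<Longrightarrow> a \<in> V \<Longrightarrow> b \<in> V \<Longrightarrow> \<exists>v. {x, v} \<in> E \<and> v \<noteq> a \<and> v \<noteq> b"
    and noH: "\<not> has_minor_iso (V, E) H3"
  shows "complete_bipartite_33 V E"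
proof (cases "\<exists>a b c. {a, b} \<in> E \<and> {a, c} \<in> E \<and> {b, c} \<in> E")
  case True
  then obtain a b c where t: "{a, b} \<in> E" "{a, c} \<in> E" "{b, c} \<in> E" by blast
  have abc: "distinct [a, b, c]" "{a, b, c} \<subseteq> V" using edge_in_V[OF simple t(1)] edge_in_V[OF simple t(2)] edge_in_V[OF simple t(3)] by auto
  then obtain d e f where d: "distinct [a, b, c, d, e, f]" and Ve: "V = {a, b, c, d, e, f}"
    using six_element_enum[OF V abc] by blast
  note cross = edge_between_pairs[OF Q V]
  have nb: "{u, u1} \<in> E \<or> {u, u2} \<in> E \<or> {u, u3} \<in> E"
    if u: "distinct [u, u1, u2, u3, u4, u5]" "V = {u, u1, u2, u3, u4, u5}" for u u1 u2 u3 u4 u5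
  proof -
    obtain v where v: "{u, v} \<in> E" "v \<noteq> u4" "v \<noteq> u5" using deg[of u u4 u5] u(2) by blast
    then have "v \<in> V" "v \<noteq> u" using edge_in_V[OF simple v(1)] by auto
    then show ?thesis using v u(2) by auto
  qed
  have H: "\<not> ({v1,v12} \<in> E \<and> {v12,v2} \<in> E \<and> {v2,v23} \<in> E \<and> {v23,v3} \<in> E \<and> {v1,v3} \<in> E \<and> {v1,v13} \<in> E \<and> {v2,v13} \<in> E \<and> {v3,v13} \<in> E)"
    if "distinct [v1, v2, v3, v12, v13, v23]" for v1 v2 v3 v12 v13 v23
    using H3_subgraph[OF simple that] noH by blast
  have matched: False
    if dd: "distinct [a, b, c, d, e, f]" and Vd: "V = {a, b, c, d, e, f}" and m: "{a, d} \<in> E" "{b, e} \<in> E" "{c, f} \<in> E" for d e f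
  proof -
    have swap: "{b, a} = {a, b}" "{c, a} = {a, c}" "{d, a} = {a, d}" "{e, a} = {a, e}" "{f, a} = {a, f}" "{c, b} = {b, c}" "{d, b} = {b, d}" "{e, b} = {b, e}" "{f, b} = {b, f}" "{d, c} = {c, d}" "{e, c} = {c, e}" "{f, c} = {c, f}" "{e, d} = {d, e}" "{f, d} = {d, f}" "{f, e} = {e, f}"
      by auto
    \<comment> \<open>Here \<open>n1\<close> to \<open>n6\<close> express degree three, \<open>c1\<close> to \<open>c3\<close> edges between pairs, and \<open>H1\<close> to \<open>H10\<close>
      the absence of some copies of H3.\<close>
    have n1: "{b, d} \<in> E \<or> {c, d} \<in> E \<or> {d, f} \<in> E" using nb[of d b c f a e] dd Vd swap by auto
    have n2: "{c, d} \<in> E \<or> {d, e} \<in> E \<or> {d, f} \<in> E" using nb[of d c e f a b] dd Vd swap by auto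
    have n3: "{a, e} \<in> E \<or> {c, e} \<in> E \<or> {d, e} \<in> E" using nb[of e a c d b f] dd Vd swap by auto
    have n4: "{a, e} \<in> E \<or> {d, e} \<in> E \<or> {e, f} \<in> E" using nb[of e a d f b c] dd Vd swap by auto
    have n5: "{c, e} \<in> E \<or> {d, e} \<in> E \<or> {e, f} \<in> E" using nb[of e c d f a b] dd Vd swap by auto
    have n6: "{b, f} \<in> E \<or> {d, f} \<in> E \<or> {e, f} \<in> E" using nb[of f b d e a c] dd Vd swap by auto
    have c1: "{a, e} \<in> E \<or> {a, f} \<in> E \<or> {d, e} \<in> E \<or> {d, f} \<in> E" using cross[of a d e f] dd Vd swap by auto
    have c2: "{b, d} \<in> E \<or> {b, f} \<in> E \<or> {d, e} \<in> E \<or> {e, f} \<in> E" using cross[of b e d f] dd Vd swap by auto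
    have c3: "{c, d} \<in> E \<or> {c, e} \<in> E \<or> {d, f} \<in> E \<or> {e, f} \<in> E" using cross[of c f d e] dd Vd swap by auto
    have H1: "\<not> ({a, d} \<in> E \<and> {c, d} \<in> E \<and> {c, f} \<in> E \<and> {b, f} \<in> E \<and> {a, b} \<in> E \<and> {a, e} \<in> E \<and> {c, e} \<in> E \<and> {b, e} \<in> E)" using H[of a c b d e f] dd swap by auto
    have H2: "\<not> ({a, d} \<in> E \<and> {c, d} \<in> E \<and> {c, f} \<in> E \<and> {e, f} \<in> E \<and> {a, e} \<in> E \<and> {a, b} \<in> E \<and> {b, c} \<in> E \<and> {b, e} \<in> E)" using H[of a c e d b f] dd swap by auto
    have H3: "\<not> ({a, d} \<in> E \<and> {d, e} \<in> E \<and> {e, f} \<in> E \<and> {c, f} \<in> E \<and> {a, c} \<in> E \<and> {a, b} \<in> E \<and> {b, e} \<in> E \<and> {b, c} \<in> E)" using H[of a e c d b f] dd swap by auto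
    have H4: "\<not> ({a, d} \<in> E \<and> {d, f} \<in> E \<and> {e, f} \<in> E \<and> {b, e} \<in> E \<and> {a, b} \<in> E \<and> {a, c} \<in> E \<and> {c, f} \<in> E \<and> {b, c} \<in> E)" using H[of a f b d c e] dd swap by auto
    have H5: "\<not> ({b, e} \<in> E \<and> {a, e} \<in> E \<and> {a, d} \<in> E \<and> {d, f} \<in> E \<and> {b, f} \<in> E \<and> {b, c} \<in> E \<and> {a, c} \<in> E \<and> {c, f} \<in> E)" using H[of b a f e c d] dd swap by auto
    have H6: "\<not> ({b, e} \<in> E \<and> {c, e} \<in> E \<and> {c, f} \<in> E \<and> {d, f} \<in> E \<and> {b, d} \<in> E \<and> {a, b} \<in> E \<and> {a, c} \<in> E \<and> {a, d} \<in> E)" using H[of b c d e a f] dd swap by auto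
    have H7: "\<not> ({b, f} \<in> E \<and> {c, f} \<in> E \<and> {c, e} \<in> E \<and> {d, e} \<in> E \<and> {b, d} \<in> E \<and> {a, b} \<in> E \<and> {a, c} \<in> E \<and> {a, d} \<in> E)" using H[of b c d f a e] dd swap by auto
    have H8: "\<not> ({b, e} \<in> E \<and> {d, e} \<in> E \<and> {d, f} \<in> E \<and> {c, f} \<in> E \<and> {b, c} \<in> E \<and> {a, b} \<in> E \<and> {a, d} \<in> E \<and> {a, c} \<in> E)" using H[of b d c e a f] dd swap by auto
    have H9: "\<not> ({c, d} \<in> E \<and> {a, d} \<in> E \<and> {a, f} \<in> E \<and> {e, f} \<in> E \<and> {c, e} \<in> E \<and> {b, c} \<in> E \<and> {a, b} \<in> E \<and> {b, e} \<in> E)" using H[of c a e d b f] dd swap by auto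
    have H10: "\<not> ({c, f} \<in> E \<and> {b, f} \<in> E \<and> {b, e} \<in> E \<and> {d, e} \<in> E \<and> {c, d} \<in> E \<and> {a, c} \<in> E \<and> {a, b} \<in> E \<and> {a, d} \<in> E)" using H[of c b d f a e] dd swap by auto
    show False using t m n1 n2 n3 n4 n5 n6 c1 c2 c3 H1 H2 H3 H4 H5 H6 H7 H8 H9 H10 by sat
  qed
  have r0: "{a, d} \<in> E \<or> {a, e} \<in> E \<or> {a, f} \<in> E" using nb[of a d e f b c] d Ve by auto
  have r1: "{b, d} \<in> E \<or> {b, e} \<in> E \<or> {b, f} \<in> E" using nb[of b d e f a c] d Ve by auto
  have r2: "{c, d} \<in> E \<or> {c, e} \<in> E \<or> {c, f} \<in> E" using nb[of c d e f a b] d Ve by auto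
  have s0: "{a, d} \<in> E \<or> {b, d} \<in> E \<or> {c, d} \<in> E" using nb[of d a b c e f] d Ve by (auto simp: insert_commute)
  have s1: "{a, e} \<in> E \<or> {b, e} \<in> E \<or> {c, e} \<in> E" using nb[of e a b c d f] d Ve by (auto simp: insert_commute)
  have s2: "{a, f} \<in> E \<or> {b, f} \<in> E \<or> {c, f} \<in> E" using nb[of f a b c d e] d Ve by (auto simp: insert_commute)
  have c00: "{a, d} \<in> E \<or> {a, e} \<in> E \<or> {b, d} \<in> E \<or> {b, e} \<in> E" using cross[of a b d e] d Ve by auto
  have c01: "{a, d} \<in> E \<or> {a, f} \<in> E \<or> {b, d} \<in> E \<or> {b, f} \<in> E" using cross[of a b d f] d Ve by auto
  have c02: "{a, e} \<in> E \<or> {a, f} \<in> E \<or> {b, e} \<in> E \<or> {b, f} \<in> E" using cross[of a b e f] d Ve by auto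
  have c10: "{a, d} \<in> E \<or> {a, e} \<in> E \<or> {c, d} \<in> E \<or> {c, e} \<in> E" using cross[of a c d e] d Ve by auto
  have c11: "{a, d} \<in> E \<or> {a, f} \<in> E \<or> {c, d} \<in> E \<or> {c, f} \<in> E" using cross[of a c d f] d Ve by auto
  have c12: "{a, e} \<in> E \<or> {a, f} \<in> E \<or> {c, e} \<in> E \<or> {c, f} \<in> E" using cross[of a c e f] d Ve by auto
  have c20: "{b, d} \<in> E \<or> {b, e} \<in> E \<or> {c, d} \<in> E \<or> {c, e} \<in> E" using cross[of b c d e] d Ve by auto
  have c21: "{b, d} \<in> E \<or> {b, f} \<in> E \<or> {c, d} \<in> E \<or> {c, f} \<in> E" using cross[of b c d f] d Ve by auto
  have c22: "{b, e} \<in> E \<or> {b, f} \<in> E \<or> {c, e} \<in> E \<or> {c, f} \<in> E" using cross[of b c e f] d Ve by auto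
  \<comment> \<open>Hall's theorem for three vertices on either side: each vertex has a neighbour on the other
    side, and two vertices of the triangle together have at least two.\<close>
  have "({a, d} \<in> E \<and> {b, e} \<in> E \<and> {c, f} \<in> E) \<or> ({a, d} \<in> E \<and> {b, f} \<in> E \<and> {c, e} \<in> E) \<or> ({a, e} \<in> E \<and> {b, d} \<in> E \<and> {c, f} \<in> E) \<or> ({a, e} \<in> E \<and> {b, f} \<in> E \<and> {c, d} \<in> E) \<or> ({a, f} \<in> E \<and> {b, d} \<in> E \<and> {c, e} \<in> E) \<or> ({a, f} \<in> E \<and> {b, e} \<in> E \<and> {c, d} \<in> E)"
    using r0 r1 r2 s0 s1 s2 c00 c01 c02 c10 c11 c12 c20 c21 c22 by sat
  then have False
  proof (elim disjE conjE)
    assume m: "{a, d} \<in> E" "{b, e} \<in> E" "{c, f} \<in> E"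
    show False by (rule matched[OF _ _ m]) (use d Ve in auto)
  next
    assume m: "{a, d} \<in> E" "{b, f} \<in> E" "{c, e} \<in> E"
    show False by (rule matched[OF _ _ m]) (use d Ve in auto)
  next
    assume m: "{a, e} \<in> E" "{b, d} \<in> E" "{c, f} \<in> E"
    show False by (rule matched[OF _ _ m]) (use d Ve in auto)
  next
    assume m: "{a, e} \<in> E" "{b, f} \<in> E" "{c, d} \<in> E"
    show False by (rule matched[OF _ _ m]) (use d Ve in auto)
  next
    assume m: "{a, f} \<in> E" "{b, d} \<in> E" "{c, e} \<in> E"
    show False by (rule matched[OF _ _ m]) (use d Ve in auto)
  next
    assume m: "{a, f} \<in> E" "{b, e} \<in> E" "{c, d} \<in> E"
    show False by (rule matched[OF _ _ m]) (use d Ve in auto)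
  qed
  then show ?thesis by blast
next
  case False
  then have tri: "\<not> ({a, b} \<in> E \<and> {a, c} \<in> E \<and> {b, c} \<in> E)" for a b c by blast
  have sym: "{u, v} \<in> E \<longleftrightarrow> {v, u} \<in> E" for u v by (simp add: insert_commute)
  obtain v where v: "v \<in> V" using V by (metis card.empty ex_in_conv zero_neq_numeral)
  obtain p1 where p1: "{v, p1} \<in> E" using deg[OF v v v] by blast
  then have p1V: "p1 \<in> V" "p1 \<noteq> v" using edge_in_V[OF simple p1] by auto
  obtain p2 where p2: "{v, p2} \<in> E" "p2 \<noteq> p1" using deg[OF v p1V(1) p1V(1)] by blast
  then have p2V: "p2 \<in> V" "p2 \<noteq> v" using edge_in_V[OF simple p2(1)] by auto
  obtain p3 where p3: "{v, p3} \<in> E" "p3 \<noteq> p1" "p3 \<noteq> p2" using deg[OF v p1V(1) p2V(1)] by blast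
  then have p3V: "p3 \<in> V" "p3 \<noteq> v" using edge_in_V[OF simple p3(1)] by auto
  have ppp: "distinct [p1, p2, p3]" "{p1, p2, p3} \<subseteq> V" using p1V p2V p3V p2 p3 by auto
  then obtain r1 r2 r3 where r: "distinct [p1, p2, p3, r1, r2, r3]" "V = {p1, p2, p3, r1, r2, r3}"
    using six_element_enum[OF V ppp] by blast
  then have vr: "v \<in> {r1, r2, r3}" using v p1V p2V p3V by auto
  have "card {r1, r2, r3} = 3" using r(1) by simp
  then have "card ({r1, r2, r3} - {v}) = 2" using vr by (simp add: card_Diff_singleton_if)
  then obtain s1 s2 where ss12: "{r1, r2, r3} - {v} = {s1, s2}" "s1 \<noteq> s2" by (auto simp: card_2_iff)
  then have s: "{r1, r2, r3} = {v, s1, s2}" "s1 \<noteq> s2" "s1 \<noteq> v" "s2 \<noteq> v" using vr by blast+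
  have Ve: "V = {v, s1, s2} \<union> {p1, p2, p3}" using r(2) s(1) by auto
  have disj: "{v, s1, s2} \<inter> {p1, p2, p3} = {}" using r(1) s(1) by auto
  have pp: "{p, p'} \<notin> E" if "p \<in> {p1, p2, p3}" "p' \<in> {p1, p2, p3}" for p p'
    using tri[of v p p'] p1 p2(1) p3(1) that by auto
  have full: "{p, v} \<in> E \<and> {p, s1} \<in> E \<and> {p, s2} \<in> E" if p: "p \<in> {p1, p2, p3}" for p
  proof -
    have pV: "p \<in> V" "v \<in> V" "s1 \<in> V" "s2 \<in> V" using p Ve by auto
    have nbr: "u \<in> {v, s1, s2}" if "{p, u} \<in> E" for u using edge_in_V[OF simple that] pp[OF p, of u] that Ve by auto
    obtain u1 u2 u3 where "{p, u1} \<in> E \<and> u1 \<noteq> s1 \<and> u1 \<noteq> s2" "{p, u2} \<in> E \<and> u2 \<noteq> v \<and> u2 \<noteq> s2" "{p, u3} \<in> E \<and> u3 \<noteq> v \<and> u3 \<noteq> s1"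
      using deg[OF pV(1,3,4)] deg[OF pV(1,2,4)] deg[OF pV(1,2,3)] by blast
    then show ?thesis using nbr by fastforce
  qed
  have ss: "{u, u'} \<notin> E" if "u \<in> {v, s1, s2}" "u' \<in> {v, s1, s2}" for u u'
  proof -
    have "{p1, u} \<in> E" "{p1, u'} \<in> E" using full[of p1] that by auto
    then show ?thesis using tri[of p1 u u'] by blast
  qed
  show ?thesis unfolding complete_bipartite_33_def
  proof (rule exI[of _ "{v, s1, s2}"], rule exI[of _ "{p1, p2, p3}"], intro conjI ballI)
    show "card {v, s1, s2} = 3" using s by simp
    show "card {p1, p2, p3} = 3" using r(1) by simp
    fix u p assume "u \<in> {v, s1, s2}" "p \<in> {p1, p2, p3}"
    then have "{p, u} \<in> E" using full[of p] by auto
    then show "{u, p} \<in> E" by (simp add: insert_commute)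
  next
    fix e assume e: "e \<in> E"
    then have "card e = 2" using simple by (simp add: simple_graph_def)
    then obtain u w where uw: "e = {u, w}" unfolding card_2_iff by blast
    have "u \<in> V" "w \<in> V" using edge_in_V[OF simple, of u w] e uw by auto
    then have "(u \<in> {v, s1, s2} \<and> w \<in> {p1, p2, p3}) \<or> (w \<in> {v, s1, s2} \<and> u \<in> {p1, p2, p3})"
      using pp[of u w] ss[of u w] e uw Ve by blast
    then show "\<exists>p\<in>{v, s1, s2}. \<exists>q\<in>{p1, p2, p3}. e = {p, q}" using uw insert_commute[of u w "{}"] by blast
  qed (use Ve disj in auto)
qed

text \<open>For \<open>u\<close> in \<open>{p, q}\<close> and \<open>w\<close> in \<open>{r, s}\<close>, the pairs \<open>{x', u}\<close> and \<open>{y', w}\<close> are joined by an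
edge, which can only be \<open>{u, w}\<close>.\<close>
lemma nearly_three_connected_two_caps_cross:
  assumes simple: "simple_graph (V, E)" and Q: "nearly_three_connected V E" and V: "card V = 6"
    and d: "distinct [p, q, x', r, s, y']" "V = {p, q, x', r, s, y'}"
    and x': "\<And>v. {x', v} \<in> E \<longleftrightarrow> v = p \<or> v = q" and y': "\<And>v. {y', v} \<in> E \<longleftrightarrow> v = r \<or> v = s"
  shows "{p, r} \<in> E \<and> {p, s} \<in> E \<and> {q, r} \<in> E \<and> {q, s} \<in> E"
proof -
  have c: "{u, w} \<in> E" if "u \<in> {p, q}" "w \<in> {r, s}" for u w
  proof -
    have "{x', w} \<notin> E" "{x', y'} \<notin> E" "{u, y'} \<notin> E"
      using x'[of w] x'[of y'] y'[of u] that d(1) by (auto simp: insert_commute)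
    then show ?thesis using edge_between_pairs[OF Q V, of x' u y' w] that d by auto
  qed
  then show ?thesis by simp
qed

text \<open>The vertex \<open>x\<close> subdivides the edge \<open>{a, b}\<close> of a graph with two caps.  If both ends of this
edge were in \<open>{p, q, x'}\<close>, say, then \<open>{p, q}\<close> would separate \<open>x\<close> and \<open>x'\<close> from the other three
vertices.  So the edge joins \<open>{p, q}\<close> and \<open>{r, s}\<close>, and by symmetry it is \<open>{p, r}\<close>.\<close>
lemma two_caps_plus_degree_two:
  assumes simple: "simple_graph (V, E)" and Q: "nearly_three_connected V E" and x: "x \<in> V" "{x, a} \<in> E" "{x, b} \<in> E" "a \<noteq> b"
    and N: "\<And>v. {x, v} \<in> E \<Longrightarrow> v = a \<or> v = b"
    and E': "\<And>e. e \<in> E' \<longleftrightarrow> e \<in> E \<and> x \<notin> e \<or> e = {a, b}"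
    and G': "simple_graph (V - {x}, E')" "nearly_three_connected (V - {x}) E'" "card (V - {x}) = 6"
    and caps: "two_caps (V - {x}) E'"
  shows "has_minor_iso (V, E) H3"
proof -
  obtain p q x' r s y' where d: "distinct [p, q, x', r, s, y']" and Ve: "V - {x} = {p, q, x', r, s, y'}"
    and x': "\<And>v. {x', v} \<in> E' \<longleftrightarrow> v = p \<or> v = q" and y': "\<And>v. {y', v} \<in> E' \<longleftrightarrow> v = r \<or> v = s"
    using caps unfolding two_caps_def by metis
  have fin: "finite V" using simple by (simp add: simple_graph_def)
  have xn: "x \<notin> {p, q, x', r, s, y'}" using Ve by blast
  have VV: "V = insert x {p, q, x', r, s, y'}" using Ve x(1) by blast
  have cr: "{p, r} \<in> E' \<and> {p, s} \<in> E' \<and> {q, r} \<in> E' \<and> {q, s} \<in> E'"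
    by (rule nearly_three_connected_two_caps_cross[OF G' d Ve x' y'])
  have abE: "{a, b} \<in> E'" using E' by blast
  have abV: "a \<in> V - {x}" "b \<in> V - {x}" using edge_in_V[OF G'(1) abE] by auto
  \<comment> \<open>the edge \<open>{a, b}\<close> cannot lie within a cap\<close>
  have bad: False if P: "distinct [p, q, x', r, s, y']" "V - {x} = {p, q, x', r, s, y'}"
      "\<And>v. {x', v} \<in> E' \<longleftrightarrow> v = p \<or> v = q" and ab: "a \<in> {p, q, x'}" "b \<in> {p, q, x'}" for p q x' r s y'
  proof -
    have xn': "x \<notin> {p, q, x', r, s, y'}" using P(2) by blast
    have 1: "{x, v} \<notin> E" if "v \<in> {r, s, y'}" for v using N[of v] ab that P(1) by auto
    have 2: "{x', v} \<notin> E" if v: "v \<in> {r, s, y'}" for v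
    proof
      assume "{x', v} \<in> E"
      moreover have "x \<notin> {x', v}" using xn' v by auto
      ultimately have "{x', v} \<in> E'" using E' by blast
      then show False using P(3)[of v] v P(1) by auto
    qed
    have "separation V E {x, x'} {r, s, y'} {p, q}" unfolding separation_def
    proof (intro conjI ballI)
      show "{x, x'} \<union> {r, s, y'} \<union> {p, q} = V" using P(2) x(1) by blast
      fix u w assume "u \<in> {x, x'}" "w \<in> {r, s, y'}"
      then show "{u, w} \<notin> E" using 1 2 by blast
    qed (use P(1) xn' in auto)
    moreover have "card {p, q} \<le> 2" by (simp add: card_insert_if)
    ultimately have "card {x, x'} \<le> 1 \<or> card {r, s, y'} \<le> 1" using Q unfolding nearly_three_connected_def by blast
    then show False using P(1) xn' by simp
  qed
  have "\<not> (a \<in> {p, q, x'} \<and> b \<in> {p, q, x'})" using bad[OF d Ve x'] by blast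
  moreover have "\<not> (a \<in> {r, s, y'} \<and> b \<in> {r, s, y'})"
  proof -
    have "distinct [r, s, y', p, q, x']" "V - {x} = {r, s, y', p, q, x'}" using d Ve by auto
    from bad[OF this y'] show ?thesis by blast
  qed
  moreover have "a \<in> {p, q, x', r, s, y'}" "b \<in> {p, q, x', r, s, y'}" using abV Ve by auto
  ultimately have "(a \<in> {p, q, x'} \<and> b \<in> {r, s, y'}) \<or> (b \<in> {p, q, x'} \<and> a \<in> {r, s, y'})" by blast
  moreover have "a \<noteq> x'" "a \<noteq> y'" "b \<noteq> x'" "b \<noteq> y'"
    using calculation x'[of a] x'[of b] y'[of a] y'[of b] abE d by (auto simp: insert_commute)
  ultimately have pos: "(a \<in> {p, q} \<and> b \<in> {r, s}) \<or> (b \<in> {p, q} \<and> a \<in> {r, s})" by blast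
  have inE: "e \<in> E" if "e \<in> E'" "e \<noteq> {a, b}" for e using E' that by blast
  have main: "has_minor_iso (V, E) H3"
    if P: "distinct [p, q, x', r, s, y']" "V - {x} = {p, q, x', r, s, y'}"
      "\<And>v. {x', v} \<in> E' \<longleftrightarrow> v = p \<or> v = q" "\<And>v. {y', v} \<in> E' \<longleftrightarrow> v = r \<or> v = s"
      and c: "{p, s} \<in> E'" "{q, r} \<in> E'" "{q, s} \<in> E'" and ab: "{a, b} = {p, r}" for p q x' r s y'
  proof (rule K4_caps_subdivided_has_H3_minor[OF simple, of p q r s x' y' x])
    show "distinct [p, q, r, s, x', y', x]" using P(1,2) by auto
    have keep: "{u, w} \<in> E" if "{u, w} \<in> E'" "p \<notin> {u, w} \<or> r \<notin> {u, w}" for u w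
    proof (rule inE[OF that(1)])
      show "{u, w} \<noteq> {a, b}" unfolding ab using that(2) by blast
    qed
    show "{x',p} \<in> E" "{x',q} \<in> E" using P(3)[of p] P(3)[of q] P(1) by (auto intro!: keep)
    show "{y',r} \<in> E" "{y',s} \<in> E" using P(4)[of r] P(4)[of s] P(1) by (auto intro!: keep)
    show "{p,s} \<in> E" "{q,r} \<in> E" "{q,s} \<in> E" using c P(1) by (auto intro!: keep)
    show "{p, x} \<in> E" "{x, r} \<in> E" using ab x(2,3) by (auto simp: doubleton_eq_iff insert_commute)
  qed
  consider "{a, b} = {p, r}" | "{a, b} = {p, s}" | "{a, b} = {q, r}" | "{a, b} = {q, s}" using pos by auto
  then show ?thesis
  proof cases
    case 1
    from main[OF d Ve x' y' _ _ _ 1] cr show ?thesis by blast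
  next
    case 2
    have "distinct [p, q, x', s, r, y']" "V - {x} = {p, q, x', s, r, y'}" "\<And>v. {y', v} \<in> E' \<longleftrightarrow> v = s \<or> v = r" using d Ve y' by auto
    from main[OF this(1,2) x' this(3) _ _ _ 2] cr show ?thesis by blast
  next
    case 3
    have "distinct [q, p, x', r, s, y']" "V - {x} = {q, p, x', r, s, y'}" "\<And>v. {x', v} \<in> E' \<longleftrightarrow> v = q \<or> v = p" using d Ve x' by auto
    from main[OF this y' _ _ _ 3] cr show ?thesis by blast
  next
    case 4
    have "distinct [q, p, x', s, r, y']" "V - {x} = {q, p, x', s, r, y'}" "\<And>v. {x', v} \<in> E' \<longleftrightarrow> v = q \<or> v = p"
      "\<And>v. {y', v} \<in> E' \<longleftrightarrow> v = s \<or> v = r" using d Ve x' y' by auto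
    from main[OF this _ _ _ 4] cr show ?thesis by blast
  qed
qed

lemma K33_plus_degree_two:
  assumes simple: "simple_graph (V, E)" and x: "{x, a} \<in> E" "{x, b} \<in> E"
    and E': "\<And>e. e \<in> E' \<longleftrightarrow> e \<in> E \<and> x \<notin> e \<or> e = {a, b}"
    and K: "complete_bipartite_33 (V - {x}) E'"
  shows "has_minor_iso (V, E) H3"
proof -
  obtain P Q where PQ0: "V - {x} = P \<union> Q \<and> P \<inter> Q = {} \<and> card P = 3 \<and> card Q = 3 \<and>
      (\<forall>e\<in>E'. \<exists>p\<in>P. \<exists>q\<in>Q. e = {p, q}) \<and> (\<forall>p\<in>P. \<forall>q\<in>Q. {p, q} \<in> E')"
    using K unfolding complete_bipartite_33_def by (elim exE)
  then have PQ: "V - {x} = P \<union> Q" "P \<inter> Q = {}" "card P = 3" "card Q = 3"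
    "\<And>e. e \<in> E' \<Longrightarrow> \<exists>p\<in>P. \<exists>q\<in>Q. e = {p, q}" "\<And>p q. p \<in> P \<Longrightarrow> q \<in> Q \<Longrightarrow> {p, q} \<in> E'"
    by blast+
  have "{a, b} \<in> E'" using E' by blast
  then obtain a1 b1 where ab: "a1 \<in> P" "b1 \<in> Q" "{a, b} = {a1, b1}" using PQ(5) by blast
  have "card (P - {a1}) = 2" "card (Q - {b1}) = 2" using PQ(3,4) ab by auto
  then obtain a2 a3 b2 b3 where r: "P - {a1} = {a2, a3}" "a2 \<noteq> a3" "Q - {b1} = {b2, b3}" "b2 \<noteq> b3" by (auto simp: card_2_iff)
  have inP: "a2 \<in> P" "a3 \<in> P" "b2 \<in> Q" "b3 \<in> Q" "a2 \<noteq> a1" "a3 \<noteq> a1" "b2 \<noteq> b1" "b3 \<noteq> b1" using r by blast+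
  have inE: "{p, q} \<in> E" if "p \<in> P" "q \<in> Q" "p \<noteq> a1 \<or> q \<noteq> b1" for p q
  proof -
    have "{p, q} \<noteq> {a, b}" using that ab PQ(2) by (auto simp: doubleton_eq_iff)
    then show ?thesis using PQ(6)[OF that(1,2)] E' by blast
  qed
  have xPQ: "x \<notin> P" "x \<notin> Q" using PQ(1) by blast+
  show ?thesis
  proof (rule K33_subdivided_has_H3_minor[OF simple, of a1 a2 a3 b1 b2 b3 x])
    show "distinct [a1, a2, a3, b1, b2, b3, x]" using inP r ab PQ(2) xPQ by auto
    show "{a1, x} \<in> E" "{x, b1} \<in> E" using ab(3) x by (auto simp: doubleton_eq_iff insert_commute)
  qed (use inP ab inE in auto)
qed

section \<open>Nearly three-connected graphs without the two minors\<close>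

lemma contract_degree_two:
  assumes simple: "simple_graph (V, E)" and x: "{x, a} \<in> E" "{x, b} \<in> E" "a \<noteq> b"
    and N: "\<And>v. {x, v} \<in> E \<Longrightarrow> v = a \<or> v = b"
  obtains E' where "contract_edge a x (V, E) = (V - {x}, E')" "\<And>e. e \<in> E' \<longleftrightarrow> e \<in> E \<and> x \<notin> e \<or> e = {a, b}"
proof -
  define h where "h z = (if z = x then a else z)" for z
  define E' where "E' = (\<lambda>e. h ` e) ` (E - {{a, x}})"
  have ne: "x \<noteq> a" "x \<noteq> b" using edge_in_V[OF simple x(1)] edge_in_V[OF simple x(2)] by auto
  have id: "h ` e = e" if "x \<notin> e" for e using that by (force simp: h_def)
  have "e \<in> E' \<longleftrightarrow> e \<in> E \<and> x \<notin> e \<or> e = {a, b}" for e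
  proof
    assume "e \<in> E'"
    then obtain e0 where e0: "e0 \<in> E" "e0 \<noteq> {a, x}" "e = h ` e0" by (auto simp: E'_def)
    show "e \<in> E \<and> x \<notin> e \<or> e = {a, b}"
    proof (cases "x \<in> e0")
      case False then show ?thesis using e0 id[OF False] by simp
    next
      case True
      have "card e0 = 2" using simple e0(1) by (simp add: simple_graph_def)
      then obtain v where v: "e0 = {x, v}" using True unfolding card_2_iff by (metis insertE insert_commute singletonD)
      then have "v = b" using N[of v] e0 by (auto simp: insert_commute)
      then show ?thesis using v e0(3) ne by (simp add: h_def insert_commute)
    qed
  next
    assume "e \<in> E \<and> x \<notin> e \<or> e = {a, b}"
    then show "e \<in> E'"
    proof
      assume *: "e \<in> E \<and> x \<notin> e"
      show ?thesis unfolding E'_def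
      proof (rule image_eqI)
        show "e = h ` e" using * id by simp
        show "e \<in> E - {{a, x}}" using * by auto
      qed
    next
      assume "e = {a, b}"
      moreover have "h ` {x, b} = {a, b}" using ne by (auto simp: h_def)
      moreover have "{x, b} \<in> E - {{a, x}}" using x ne by (auto simp: doubleton_eq_iff)
      ultimately show ?thesis unfolding E'_def by blast
    qed
  qed
  moreover have "contract_edge a x (V, E) = (V - {x}, E')" by (simp add: contract_edge_def E'_def h_def)
  ultimately show ?thesis using that by blast
qed

lemma minor_contract: "{u, v} \<in> E \<Longrightarrow> minor_of (V, E) (contract_edge u v (V, E))"
  using minor_of.contract[OF minor_of.refl, of u v "(V, E)"] by simp

text \<open>The vertex \<open>x\<close> of \<open>K\<^sub>3\<^sub>,\<^sub>3\<close> is split into \<open>x\<close> and \<open>y\<close>, which have at least two neighbours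
each and all three together in \<open>Q\<close>.  Hence some vertex of \<open>Q\<close> is adjacent to \<open>y\<close> while \<open>x\<close> is
adjacent to the other two, and \<open>y\<close> subdivides an edge of \<open>K\<^sub>3\<^sub>,\<^sub>3\<close>.\<close>
lemma K33_split_vertex:
  assumes simple: "simple_graph (V, E)" and xy: "{x, y} \<in> E"
    and deg: "\<And>u a b. u \<in> V \<Longrightarrow> a \<in> V \<Longrightarrow> b \<in> V \<Longrightarrow> \<exists>v. {u, v} \<in> E \<and> v \<noteq> a \<and> v \<noteq> b"
    and PQ: "V - {y} = P \<union> Q" "P \<inter> Q = {}" "card P = 3" "card Q = 3" "x \<in> P"
    and full: "\<And>p q. p \<in> P - {x} \<Longrightarrow> q \<in> Q \<Longrightarrow> {p, q} \<in> E"
    and star: "\<And>q. q \<in> Q \<Longrightarrow> {x, q} \<in> E \<or> {y, q} \<in> E"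
    and only: "\<And>v. {x, v} \<in> E \<or> {y, v} \<in> E \<Longrightarrow> v \<in> Q \<union> {x, y}"
  shows "has_minor_iso (V, E) H3"
proof -
  have V: "x \<in> V" "y \<in> V" "x \<noteq> y" using edge_in_V[OF simple xy] by auto
  have "card (P - {x}) = 2" using PQ by simp
  then obtain a2 a3 where a: "P - {x} = {a2, a3}" "a2 \<noteq> a3" by (auto simp: card_2_iff)
  obtain b1 b2 b3 where b: "Q = {b1, b2, b3}" "b1 \<noteq> b2" "b1 \<noteq> b3" "b2 \<noteq> b3" using PQ(4) by (auto simp: card_3_iff)
  have y: "y \<notin> P" "y \<notin> Q" using PQ(1) by blast+
  have QV: "q \<in> V" if "q \<in> Q" for q using PQ(1) that by blast
  \<comment> \<open>\<open>x\<close> and \<open>y\<close> have degree at least three and are adjacent\<close>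
  have two: "\<exists>q\<in>Q. q \<noteq> c \<and> {u, q} \<in> E" if u: "u = x \<or> u = y" and c: "c \<in> Q" for u c
  proof -
    obtain u' where u': "{x, y} = {u, u'}" "u' \<in> V" using u V by (metis insert_commute)
    obtain v where v: "{u, v} \<in> E" "v \<noteq> u'" "v \<noteq> c" using deg[of u u' c] u u'(2) QV[OF c] V by blast
    have "v \<noteq> u" using edge_in_V[OF simple v(1)] by auto
    moreover have "v \<in> Q \<union> {x, y}" using only[of v] v(1) u by blast
    ultimately have "v \<in> Q" using v(2) u'(1) by blast
    then show ?thesis using v by blast
  qed
  have main: "has_minor_iso (V, E) H3"
    if q: "Q = {q1, q2, q3}" "q1 \<noteq> q2" "q1 \<noteq> q3" "q2 \<noteq> q3" and e: "{y, q1} \<in> E" "{x, q2} \<in> E" "{x, q3} \<in> E" for q1 q2 q3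
  proof (rule K33_subdivided_has_H3_minor[OF simple, of x a2 a3 q1 q2 q3 y])
    have "a2 \<in> P" "a3 \<in> P" "a2 \<noteq> x" "a3 \<noteq> x" using a by blast+
    moreover have "q1 \<in> Q" "q2 \<in> Q" "q3 \<in> Q" using q by auto
    moreover have "z \<noteq> w" if "z \<in> P" "w \<in> Q" for z w using that PQ(2) by blast
    ultimately show "distinct [x, a2, a3, q1, q2, q3, y]" using a(2) q(2-4) PQ(5) y V(3)
      by (simp add: eq_commute) blast
  qed (use xy e full a q in auto)
  have "({y, b1} \<in> E \<and> {x, b2} \<in> E \<and> {x, b3} \<in> E) \<or> ({y, b2} \<in> E \<and> {x, b1} \<in> E \<and> {x, b3} \<in> E) \<or>
     ({y, b3} \<in> E \<and> {x, b1} \<in> E \<and> {x, b2} \<in> E)"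
  proof -
    have "{x, b1} \<in> E \<or> {y, b1} \<in> E" "{x, b2} \<in> E \<or> {y, b2} \<in> E" "{x, b3} \<in> E \<or> {y, b3} \<in> E"
      using star b(1) by auto
    moreover have "{x, b2} \<in> E \<or> {x, b3} \<in> E" "{x, b1} \<in> E \<or> {x, b3} \<in> E" "{x, b1} \<in> E \<or> {x, b2} \<in> E"
      "{y, b2} \<in> E \<or> {y, b3} \<in> E"
      using two[of x b1] two[of x b2] two[of x b3] two[of y b1] b(1) by auto
    ultimately show ?thesis by blast
  qed
  then show ?thesis
  proof (elim disjE)
    assume "{y, b1} \<in> E \<and> {x, b2} \<in> E \<and> {x, b3} \<in> E"
    then show ?thesis using main[of b1 b2 b3] b by blast
  next
    assume *: "{y, b2} \<in> E \<and> {x, b1} \<in> E \<and> {x, b3} \<in> E"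
    have "Q = {b2, b1, b3}" using b(1) by blast
    then show ?thesis using main[of b2 b1 b3] b(2-4) * by auto
  next
    assume *: "{y, b3} \<in> E \<and> {x, b1} \<in> E \<and> {x, b2} \<in> E"
    have "Q = {b3, b1, b2}" using b(1) by blast
    then show ?thesis using main[of b3 b1 b2] b(2-4) * by auto
  qed
qed

lemma K33_contraction_has_H3_minor:
  assumes simple: "simple_graph (V, E)" and xy: "{x, y} \<in> E"
    and deg: "\<And>u a b. u \<in> V \<Longrightarrow> a \<in> V \<Longrightarrow> b \<in> V \<Longrightarrow> \<exists>v. {u, v} \<in> E \<and> v \<noteq> a \<and> v \<noteq> b"
    and G': "contract_edge x y (V, E) = (V - {y}, E')" and K: "complete_bipartite_33 (V - {y}) E'"
  shows "has_minor_iso (V, E) H3"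
proof -
  obtain P Q where PQ0: "V - {y} = P \<union> Q \<and> P \<inter> Q = {} \<and> card P = 3 \<and> card Q = 3 \<and>
      (\<forall>e\<in>E'. \<exists>p\<in>P. \<exists>q\<in>Q. e = {p, q}) \<and> (\<forall>p\<in>P. \<forall>q\<in>Q. {p, q} \<in> E')"
    using K unfolding complete_bipartite_33_def by (elim exE)
  then have PQ: "V - {y} = P \<union> Q" "P \<inter> Q = {}" "card P = 3" "card Q = 3"
    and E'1: "\<And>e. e \<in> E' \<Longrightarrow> \<exists>p\<in>P. \<exists>q\<in>Q. e = {p, q}" and E'2: "\<And>p q. p \<in> P \<Longrightarrow> q \<in> Q \<Longrightarrow> {p, q} \<in> E'"
    by blast+
  have V: "x \<in> V" "y \<in> V" "x \<noteq> y" using edge_in_V[OF simple xy] by auto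
  define h where "h z = (if z = y then x else z)" for z
  have E': "E' = (\<lambda>e. h ` e) ` (E - {{x, y}})" using G' by (simp add: contract_edge_def h_def)
  have img: "{h u, h v} \<in> E'" if "{u, v} \<in> E" "{u, v} \<noteq> {x, y}" for u v
    unfolding E' using that by (intro image_eqI[of _ _ "{u, v}"]) auto
  have yPQ: "y \<notin> P" "y \<notin> Q" using PQ(1) by blast+
  have pre: "\<exists>u' v'. {u', v'} \<in> E \<and> h u' = u \<and> h v' = v" if e: "{u, v} \<in> E'" for u v
  proof -
    obtain e0 where e0: "e0 \<in> E" "{u, v} = h ` e0" using e by (auto simp: E')
    have "card e0 = 2" using simple e0(1) by (simp add: simple_graph_def)
    then obtain i j where ij: "e0 = {i, j}" unfolding card_2_iff by blast
    then have "{u, v} = {h i, h j}" using e0(2) by simp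
    then have "(u = h i \<and> v = h j) \<or> (u = h j \<and> v = h i)" by (auto simp: doubleton_eq_iff)
    moreover have "{j, i} \<in> E" using e0(1) ij by (simp add: insert_commute)
    ultimately show ?thesis using e0(1) ij by blast
  qed
  have split: "has_minor_iso (V, E) H3"
    if R: "V - {y} = R \<union> S" "R \<inter> S = {}" "card R = 3" "card S = 3" "x \<in> R"
      and R1: "\<And>u v. u \<in> R \<Longrightarrow> {u, v} \<in> E' \<Longrightarrow> v \<in> S" and R2: "\<And>p q. p \<in> R \<Longrightarrow> q \<in> S \<Longrightarrow> {p, q} \<in> E'" for R S
  proof (rule K33_split_vertex[OF simple xy deg R])
    have yRS: "y \<notin> R" "y \<notin> S" using R(1) by blast+
    have hid: "z = w" if "h z = w" "w \<noteq> x" for z w using that by (auto simp: h_def split: if_splits)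
    have hx: "z = x \<or> z = y" if "h z = x" for z using that by (auto simp: h_def split: if_splits)
    show "{p, q} \<in> E" if pq: "p \<in> R - {x}" "q \<in> S" for p q
    proof -
      have "p \<noteq> x" "q \<noteq> x" using pq R(2,5) by auto
      moreover obtain u' v' where "{u', v'} \<in> E" "h u' = p" "h v' = q" using pre[OF R2[of p q]] pq by blast
      ultimately show ?thesis using hid[of u' p] hid[of v' q] by simp
    qed
    show "{x, q} \<in> E \<or> {y, q} \<in> E" if q: "q \<in> S" for q
    proof -
      have "q \<noteq> x" using q R(2,5) by auto
      moreover obtain u' v' where "{u', v'} \<in> E" "h u' = x" "h v' = q" using pre[OF R2[OF R(5) q]] by blast
      ultimately show ?thesis using hid[of v' q] hx[of u'] by auto
    qed
    show "v \<in> S \<union> {x, y}" if e: "{x, v} \<in> E \<or> {y, v} \<in> E" for v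
    proof (cases "v = x \<or> v = y")
      case False
      then have "h v = v" by (simp add: h_def)
      moreover have "h x = x" "h y = x" by (simp_all add: h_def)
      moreover have "{x, v} \<noteq> {x, y}" "{y, v} \<noteq> {x, y}" using False by (auto simp: doubleton_eq_iff)
      ultimately have "{x, v} \<in> E'" using img[of x v] img[of y v] e by auto
      then show ?thesis using R1[OF R(5)] by blast
    qed auto
  qed
  have "x \<in> P \<or> x \<in> Q" using PQ(1) V by blast
  then show ?thesis
  proof
    assume xP: "x \<in> P"
    show ?thesis
    proof (rule split[OF PQ xP _ E'2])
      fix u v assume "u \<in> P" "{u, v} \<in> E'"
      then show "v \<in> Q" using E'1[of "{u, v}"] PQ(2) by (auto simp: doubleton_eq_iff)
    qed
  next
    assume xQ: "x \<in> Q"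
    have QP: "V - {y} = Q \<union> P" "Q \<inter> P = {}" using PQ by auto
    show ?thesis
    proof (rule split[OF QP PQ(4,3) xQ])
      fix u v assume "u \<in> Q" "{u, v} \<in> E'"
      then show "v \<in> P" using E'1[of "{u, v}"] PQ(2) by (auto simp: doubleton_eq_iff)
    next
      fix p q assume "p \<in> Q" "q \<in> P"
      then show "{p, q} \<in> E'" using E'2[of q p] by (simp add: insert_commute)
    qed
  qed
qed

text \<open>By induction on the number of vertices.  A graph with at least seven vertices has a
contraction that is again nearly three-connected: suppress a vertex of degree two, or contract an
edge given by Tutte's argument.  The contraction has six vertices and is one of the two kinds;
undoing the contraction always creates H3, so seven vertices are impossible.\<close>
theorem nearly_three_connected_classification:
  assumes "simple_graph (V, E)" "nearly_three_connected V E" "6 \<le> card V"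
    "\<not> has_minor_iso (V, E) F3" "\<not> has_minor_iso (V, E) H3"
  shows "card V = 6 \<and> (complete_bipartite_33 V E \<or> two_caps V E)"
  using assms
proof (induction "card V" arbitrary: V E rule: less_induct)
  case less
  note simple = less.prems(1) and Q = less.prems(2) and card = less.prems(3) and noF = less.prems(4) and noH = less.prems(5)
  have fin: "finite V" using simple by (simp add: simple_graph_def)
  have two: "two_connected V E" using Q by (simp add: nearly_three_connected_def)
  have IH: "card W = 6 \<and> (complete_bipartite_33 W F \<or> two_caps W F)"
    if c: "contract_edge u v (V, E) = (W, F)" "{u, v} \<in> E" and W: "W = V - {v}" "7 \<le> card V" and QW: "nearly_three_connected W F" for u v W F
  proof (rule less.hyps)
    have vV: "v \<in> V" using edge_in_V[OF simple c(2)] by blast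
    show "card W < card V" unfolding W(1) by (rule card_Diff1_less[OF fin vV])
    show "simple_graph (W, F)" using simple_graph_contract[OF simple, of u v] c by simp
    show "6 \<le> card W" using W vV fin by simp
    have "minor_of (V, E) (W, F)" using minor_contract[OF c(2), of V] c(1) by simp
    then show "\<not> has_minor_iso (W, F) F3" "\<not> has_minor_iso (W, F) H3" using has_minor_iso_trans noF noH by blast+
  qed (rule QW)
  show ?case
  proof (cases "\<exists>x\<in>V. \<exists>a\<in>V. \<exists>b\<in>V. \<forall>v. {x, v} \<in> E \<longrightarrow> v = a \<or> v = b")
    case True
    then obtain x a b where x: "x \<in> V" "a \<in> V" "b \<in> V" "\<And>v. {x, v} \<in> E \<Longrightarrow> v = a \<or> v = b" by blast
    show ?thesis
    proof (cases "card V = 6")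
      case c6: True
      then show ?thesis using six_vertices_degree_two[OF simple Q c6 x noF noH] by blast
    next
      case False
      then have c7: "7 \<le> card V" using card by simp
      have deg: "\<exists>v. {u, v} \<in> E \<and> v \<noteq> c" if "u \<in> V" "c \<in> V" "c \<noteq> u" for u c
        using degree_at_least_two[OF two fin, of u c] that c7 by simp
      obtain c where c: "c \<in> V" "c \<noteq> x"
      proof -
        have "\<not> V \<subseteq> {x}" using card_mono[of "{x}" V] c7 by auto
        then show ?thesis using that by blast
      qed
      obtain v1 where v1: "{x, v1} \<in> E" using deg[OF x(1) c] by blast
      then have "v1 \<in> V" "v1 \<noteq> x" using edge_in_V[OF simple v1] by auto
      then obtain v2 where v2: "{x, v2} \<in> E" "v2 \<noteq> v1" using deg[of x v1] x(1) by blast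
      have ab: "{x, a} \<in> E" "{x, b} \<in> E" "a \<noteq> b" using x(4)[OF v1] x(4)[OF v2(1)] v1 v2 by auto
      obtain E' where E': "contract_edge a x (V, E) = (V - {x}, E')" "\<And>e. e \<in> E' \<longleftrightarrow> e \<in> E \<and> x \<notin> e \<or> e = {a, b}"
        using contract_degree_two[OF simple ab x(4)] by blast
      have ax: "{a, x} \<in> E" using ab(1) by (simp add: insert_commute)
      have QW: "nearly_three_connected (V - {x}) E'"
        by (rule nearly_three_connected_suppress[OF simple Q x(1) ab(1), of b]) (use x(4) E'(2) in auto)
      have sW: "simple_graph (V - {x}, E')" using simple_graph_contract[OF simple, of a x] ax E'(1) by simp
      have ex: "card (V - {x}) = 6" "complete_bipartite_33 (V - {x}) E' \<or> two_caps (V - {x}) E'"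
        using IH[OF E'(1) ax HOL.refl c7 QW] by auto
      then have "has_minor_iso (V, E) H3"
        using K33_plus_degree_two[OF simple ab(1,2) E'(2)]
          two_caps_plus_degree_two[OF simple Q x(1) ab x(4) E'(2) sW QW ex(1)] by blast
      then show ?thesis using noH by blast
    qed
  next
    case False
    have deg: "\<exists>v. {x, v} \<in> E \<and> v \<noteq> a \<and> v \<noteq> b" if "x \<in> V" "a \<in> V" "b \<in> V" for x a b using False that by blast
    show ?thesis
    proof (cases "card V = 6")
      case c6: True
      then show ?thesis using six_vertices_min_degree_three[OF simple Q c6 deg noH] by blast
    next
      case no6: False
      then have c7: "7 \<le> card V" using card by simp
      then have "V \<noteq> {}" by auto
      then obtain a0 where a0: "a0 \<in> V" by blast
      have three: "three_connected V E" by (rule nearly_three_connected_min_degree_three[OF simple Q a0 deg])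
      have "E \<noteq> {}" using deg[OF a0 a0 a0] by blast
      have E2: "e \<subseteq> V" "card e = 2" if "e \<in> E" for e using simple that by (auto simp: simple_graph_def)
      obtain x y where xy: "{x, y} \<in> E" "\<And>A B S. separation V E A B S \<Longrightarrow> {x, y} \<subseteq> S \<Longrightarrow> card S \<le> 3 \<Longrightarrow> A = {} \<or> B = {}"
        using three_connected_contractible_edge[OF fin E2 three \<open>E \<noteq> {}\<close>] by blast
      define E' where "E' = (\<lambda>e. (\<lambda>z. if z = y then x else z) ` e) ` (E - {{x, y}})"
      have c: "contract_edge x y (V, E) = (V - {y}, E')" by (simp add: contract_edge_def E'_def)
      have three': "three_connected (V - {y}) E'"
      proof (rule three_connected_contract[OF simple three xy])
        fix u v assume "{u, v} \<in> E" "{u, v} \<noteq> {x, y}"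
        then show "{if u = y then x else u, if v = y then x else v} \<in> E'"
          unfolding E'_def by (intro image_eqI[of _ _ "{u, v}"]) auto
      qed
      have ex: "card (V - {y}) = 6" "complete_bipartite_33 (V - {y}) E' \<or> two_caps (V - {y}) E'"
        using IH[OF c xy(1) HOL.refl c7 three_connected_imp_nearly[OF three']] by auto
      \<comment> \<open>a cap is a vertex of degree two, which three-connectivity excludes\<close>
      have "\<not> two_caps (V - {y}) E'"
      proof
        assume "two_caps (V - {y}) E'"
        then obtain p q x' r s y' where d: "distinct [p, q, x', r, s, y']" "V - {y} = {p, q, x', r, s, y'}"
          and x': "\<And>v. {x', v} \<in> E' \<longleftrightarrow> v = p \<or> v = q" unfolding two_caps_def by metis
        have "separation (V - {y}) E' {x'} {r, s, y'} {p, q}" unfolding separation_def using d x' by auto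
        moreover have "card {p, q} \<le> 2" by (simp add: card_insert_if)
        ultimately show False using three' unfolding three_connected_def by blast
      qed
      then have "has_minor_iso (V, E) H3" using K33_contraction_has_H3_minor[OF simple xy(1) deg c] ex(2) by blast
      then show ?thesis using noH by blast
    qed
  qed
qed

section \<open>The characterization\<close>

text \<open>The triangles over \<open>{a, b}\<close> force the inner product of the given configuration on both
planar sides.\<close>
lemma flattenable_glue_pair:
  assumes "flattenable (E1 \<union> {{a, x}, {b, x}})" "flattenable (E2 \<union> {{a, y}, {b, y}})"
    and ab: "{a, b} \<in> E1" "{a, b} \<in> E2" and card: "\<And>e. e \<in> E1 \<Longrightarrow> card e = 2" "\<And>e. e \<in> E2 \<Longrightarrow> card e = 2"
    and xy: "x \<notin> \<Union>E1" "y \<notin> \<Union>E2"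
    and sub: "\<And>e. e \<in> E1 \<Longrightarrow> e \<subseteq> U1" "\<And>e. e \<in> E2 \<Longrightarrow> e \<subseteq> U2" "U1 \<inter> U2 \<subseteq> {a, b}"
  shows "flattenable (E1 \<union> E2)"
  unfolding flattenable_def
proof (intro allI impI)
  fix w and p :: "'a \<Rightarrow> real^'a" assume w: "supported w (E1 \<union> E2)" and p: "unit_config p"
  obtain q1 :: "'a \<Rightarrow> complex" where q1: "unit_config q1" "q1 a \<bullet> q1 b = p a \<bullet> p b"
      "energy (restrict_weight w E1) p \<le> energy (restrict_weight w E1) q1"
    using rigid_pair_by_triangle[OF assms(1) ab(1) card(1) xy(1) supported_restrict_weight p] by blast
  have "supported (restrict_weight w (E2 - E1)) E2" by (auto simp: supported_def restrict_weight_def)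
  from rigid_pair_by_triangle[OF assms(2) ab(2) card(2) xy(2) this p]
  obtain q2 :: "'a \<Rightarrow> complex" where q2: "unit_config q2" "q2 a \<bullet> q2 b = p a \<bullet> p b"
      "energy (restrict_weight w (E2 - E1)) p \<le> energy (restrict_weight w (E2 - E1)) q2" by blast
  have "q1 a \<bullet> q1 b = q2 a \<bullet> q2 b" using q1(2) q2(2) by simp
  from glue_along_pair[OF w sub q1(1) q2(1) this q1(3) q2(3)]
  show "\<exists>q :: 'a \<Rightarrow> complex. unit_config q \<and> energy w p \<le> energy w q" .
qed

text \<open>The branch sets of the triangle are contracted, and the other vertices of \<open>C\<close> are removed.\<close>
lemma rooted_triangle_minor:
  assumes simple: "simple_graph (V, E)" and C: "C \<subseteq> V" "a \<in> V - C" "b \<in> V - C" "a \<noteq> b" and r: "rooted_triangle E C a b"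
  obtains x where "x \<in> C" "minor_of (V, E) (insert x (V - C), {e \<in> E. e \<inter> C = {}} \<union> {{a, b}} \<union> {{a, x}, {b, x}})"
proof -
  obtain A B X where *: "conn E A" "conn E B" "conn E X" "a \<in> A" "b \<in> B"
     "A \<subseteq> insert a C" "B \<subseteq> insert b C" "X \<subseteq> C" "A \<inter> B = {}" "A \<inter> X = {}" "B \<inter> X = {}"
     "touch E A B" "touch E A X" "touch E B X" using r unfolding rooted_triangle_def by blast
  obtain x where x: "x \<in> X" using *(3) unfolding conn_def by blast
  then have xC: "x \<in> C" using *(8) by blast
  define S where "S v = (if v = a then A else if v = b then B else if v = x then X else {v})" for v
  have S: "S a = A" "S b = B" "S x = X" using C(2-4) xC by (auto simp: S_def)
  have Sv: "S v = {v}" if "v \<noteq> a" "v \<noteq> b" "v \<noteq> x" for v using that by (simp add: S_def)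
  let ?W = "insert x (V - C)"
  have "minor_of (V, E) (?W, {e \<in> E. e \<inter> C = {}} \<union> {{a, b}} \<union> {{a, x}, {b, x}})"
  proof (rule minor_by_branch_sets[OF simple, where B = S])
    show "v \<in> S v \<and> S v \<subseteq> V \<and> conn E (S v)" if v: "v \<in> ?W" for v
    proof -
      consider "v = a" | "v = b" | "v = x" | "v \<noteq> a" "v \<noteq> b" "v \<noteq> x" by blast
      then show ?thesis
      proof cases
        case 1 then show ?thesis using S * C by auto
      next
        case 2 then show ?thesis using S * C by auto
      next
        case 3 then show ?thesis using S * C x by auto
      next
        case 4 then show ?thesis using Sv[OF 4] v conn_singleton[of E v] by auto
      qed
    qed
    have sub: "S v \<subseteq> insert v C" if "v \<in> ?W" for v
      using * Sv[of v] S by (cases "v = a"; cases "v = b"; cases "v = x") auto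
    show "S u \<inter> S v = {}" if uv: "u \<in> ?W" "v \<in> ?W" "u \<noteq> v" for u v
    proof -
      have one: "S u \<inter> {v} = {}" if "u \<in> ?W" "v \<in> ?W" "u \<noteq> v" "v \<noteq> x" for u v
        using sub[OF that(1)] that xC by blast
      have sp: "S v = {v}" if "v \<notin> {a, b, x}" for v using Sv that by blast
      consider "v \<notin> {a, b, x}" | "u \<notin> {a, b, x}" | "u \<in> {a, b, x}" "v \<in> {a, b, x}" by blast
      then show ?thesis
      proof cases
        case 1 then show ?thesis using one[OF uv] sp[OF 1] by auto
      next
        case 2 then show ?thesis using one[OF uv(2,1)] uv(3) sp[OF 2] by auto
      next
        case 3 then show ?thesis using uv(3) *(9-11) S by (auto simp: Int_commute)
      qed
    qed
    fix e assume "e \<in> {e \<in> E. e \<inter> C = {}} \<union> {{a, b}} \<union> {{a, x}, {b, x}}"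
    then consider "e \<in> E" "e \<inter> C = {}" | "e = {a, b}" | "e = {a, x}" | "e = {b, x}" by blast
    then show "\<exists>u v s t. e = {u, v} \<and> u \<in> ?W \<and> v \<in> ?W \<and> u \<noteq> v \<and> s \<in> S u \<and> t \<in> S v \<and> {s, t} \<in> E"
    proof cases
      case 1
      have "card e = 2" "e \<subseteq> V" using simple 1(1) by (auto simp: simple_graph_def)
      then obtain u v where uv: "e = {u, v}" "u \<noteq> v" unfolding card_2_iff by blast
      have "z \<in> S z" for z using S *(4,5) x Sv[of z] by (cases "z = a"; cases "z = b"; cases "z = x") auto
      then have "u \<in> S u" "v \<in> S v" by auto
      then show ?thesis using uv 1 \<open>e \<subseteq> V\<close> by blast
    next
      case 2
      obtain s t where "s \<in> A" "t \<in> B" "{s, t} \<in> E" using *(12) by (auto simp: touch_def)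
      then have "s \<in> S a" "t \<in> S b" "a \<in> ?W" "b \<in> ?W" using S C by auto
      then show ?thesis using 2 C(4) \<open>{s, t} \<in> E\<close> by blast
    next
      case 3
      obtain s t where "s \<in> A" "t \<in> X" "{s, t} \<in> E" using *(13) by (auto simp: touch_def)
      then have "s \<in> S a" "t \<in> S x" "a \<in> ?W" "x \<in> ?W" "a \<noteq> x" using S C xC by auto
      then show ?thesis using 3 \<open>{s, t} \<in> E\<close> by blast
    next
      case 4
      obtain s t where "s \<in> B" "t \<in> X" "{s, t} \<in> E" using *(14) by (auto simp: touch_def)
      then have "s \<in> S b" "t \<in> S x" "b \<in> ?W" "x \<in> ?W" "b \<noteq> x" using S C xC by auto
      then show ?thesis using 4 \<open>{s, t} \<in> E\<close> by blast
    qed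
  qed
  then show ?thesis using that xC by blast
qed

lemma adjacent_degree_two_minor:
  assumes simple: "simple_graph (V, E)" and d: "distinct [a, x, y, b]" and e: "{a, x} \<in> E" "{x, y} \<in> E" "{y, b} \<in> E"
  shows "minor_of (V, E) (V - {y}, {e \<in> E. x \<notin> e \<and> y \<notin> e} \<union> {{a, x}, {b, x}})"
proof (rule minor_by_branch_sets[OF simple, where B = "\<lambda>v. if v = x then {x, y} else {v}"])
  let ?B = "\<lambda>v. if v = x then {x, y} else {v}"
  have V: "a \<in> V" "x \<in> V" "y \<in> V" "b \<in> V"
    using edge_in_V[OF simple e(1)] edge_in_V[OF simple e(2)] edge_in_V[OF simple e(3)] by auto
  show "v \<in> ?B v \<and> ?B v \<subseteq> V \<and> conn E (?B v)" if "v \<in> V - {y}" for v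
    using that V conn_pair[OF e(2)] conn_singleton[of E v] by auto
  show "?B u \<inter> ?B v = {}" if "u \<in> V - {y}" "v \<in> V - {y}" "u \<noteq> v" for u v using that by auto
  fix f assume "f \<in> {e \<in> E. x \<notin> e \<and> y \<notin> e} \<union> {{a, x}, {b, x}}"
  then consider "f \<in> E" "x \<notin> f" "y \<notin> f" | "f = {a, x}" | "f = {b, x}" by blast
  then show "\<exists>u v s t. f = {u, v} \<and> u \<in> V - {y} \<and> v \<in> V - {y} \<and> u \<noteq> v \<and> s \<in> ?B u \<and> t \<in> ?B v \<and> {s, t} \<in> E"
  proof cases
    case 1
    have "card f = 2" "f \<subseteq> V" using simple 1(1) by (auto simp: simple_graph_def)
    then obtain u v where uv: "f = {u, v}" "u \<noteq> v" unfolding card_2_iff by blast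
    show ?thesis
      by (rule exI[of _ u], rule exI[of _ v], rule exI[of _ u], rule exI[of _ v]) (use uv 1 \<open>f \<subseteq> V\<close> in auto)
  next
    case 2
    show ?thesis
      by (rule exI[of _ a], rule exI[of _ x], rule exI[of _ a], rule exI[of _ x]) (use 2 d V e in auto)
  next
    case 3
    show ?thesis
      by (rule exI[of _ b], rule exI[of _ x], rule exI[of _ b], rule exI[of _ y])
        (use 3 d V e in \<open>auto simp: insert_commute\<close>)
  qed
qed

text \<open>Induction on the number of vertices and then of edges.  Cuts of at most two vertices reduce
to smaller graphs, except for those that split off a single vertex; the graphs without other cuts
are classified.\<close>
theorem flattenable_if_minor_free:
  fixes V :: "'a::finite set"
  assumes "simple_graph (V, E)" "\<not> has_minor_iso (V, E) F3" "\<not> has_minor_iso (V, E) H3"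
  shows "flattenable E"
  using assms
proof (induction "(V, E)" arbitrary: V E rule: wf_induct_rule[OF wf_measures[of "[\<lambda>G. card (fst G), \<lambda>G. card (snd G)]"]])
  case (1 V E)
  note simple = 1(2) and noF = 1(3) and noH = 1(4)
  have IH: "flattenable F" if m: "minor_of (V, E) (W, F)" and c: "card W < card V \<or> card W = card V \<and> card F < card E" for W F
  proof (rule 1(1))
    show "((W, F), V, E) \<in> measures [\<lambda>G. card (fst G), \<lambda>G. card (snd G)]" using c by auto
    show "simple_graph (W, F)" by (rule simple_graph_minor[OF m simple])
    show "\<not> has_minor_iso (W, F) F3" "\<not> has_minor_iso (W, F) H3" using has_minor_iso_trans[OF m] noF noH by blast+
  qed
  have fin: "finite V" "finite E" by auto
  have EV: "e \<subseteq> V" and E2: "card e = 2" if "e \<in> E" for e using simple that by (auto simp: simple_graph_def)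
  have edge_cases: "e \<inter> A = {} \<or> e \<inter> B = {}" if e: "e \<in> E" and sep: "separation V E A B S" for e A B S
  proof -
    obtain u v where uv: "e = {u, v}" using E2[OF e] unfolding card_2_iff by blast
    have "{v, u} \<in> E" using e uv by (simp add: insert_commute)
    then show ?thesis using sep e uv unfolding separation_def by auto
  qed
  show ?case
  proof (cases "card V \<le> 5")
    case True then show ?thesis using flattenable_card_le_5[of E V] EV by blast
  next
    case False
    then have c6: "6 \<le> card V" by simp
    show ?thesis
    proof (cases "two_connected V E")
      case False
      then obtain A B S where sep: "separation V E A B S" and S: "card S \<le> 1" and ne: "A \<noteq> {}" "B \<noteq> {}"
        unfolding two_connected_def by blast
      have sets: "A \<union> B \<union> S = V" "A \<inter> B = {}" "A \<inter> S = {}" "B \<inter> S = {}" using sep unfolding separation_def by auto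
      obtain s where s: "S \<subseteq> {s}"
      proof (cases "card S = 0")
        case True
        then have "S = {}" by simp
        then show ?thesis using that by blast
      next
        case False
        then have "card S = 1" using S by linarith
        then obtain s where "S = {s}" by (rule card_1_singletonE)
        then show ?thesis using that by blast
      qed
      \<comment> \<open>both sides are proper subgraphs\<close>
      have side: "flattenable {e \<in> E. e \<subseteq> W}" if W: "W \<subset> V" for W
      proof (rule IH)
        show "minor_of (V, E) (W, {e \<in> E. e \<subseteq> W})" by (rule minor_subgraph[OF simple]) (use W in auto)
        show "card W < card V \<or> card W = card V \<and> card {e \<in> E. e \<subseteq> W} < card E" using psubset_card_mono[OF fin(1) W] by blast
      qed
      have "flattenable ({e \<in> E. e \<subseteq> A \<union> S} \<union> {e \<in> E. e \<subseteq> B \<union> S})"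
      proof (rule flattenable_glue_vertex[where ?U1.0 = "A \<union> S" and ?U2.0 = "B \<union> S" and a = s])
        show "flattenable {e \<in> E. e \<subseteq> A \<union> S}" "flattenable {e \<in> E. e \<subseteq> B \<union> S}"
          by (rule side; use sets ne in blast)+
        show "(A \<union> S) \<inter> (B \<union> S) \<subseteq> {s}" using sets s by blast
      qed auto
      moreover have "E \<subseteq> {e \<in> E. e \<subseteq> A \<union> S} \<union> {e \<in> E. e \<subseteq> B \<union> S}"
        using edge_cases[OF _ sep] EV sets(1) by blast
      ultimately show ?thesis by (rule flattenable_mono)
    next
      case two: True
      show ?thesis
      proof (cases "adjacent_degree_two E")
        case True
        then obtain a x y b where d: "distinct [a, x, y, b]" and e: "{a, x} \<in> E" "{x, y} \<in> E" "{y, b} \<in> E"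
          and N: "\<And>v. {x, v} \<in> E \<Longrightarrow> v \<in> {a, y}" "\<And>v. {y, v} \<in> E \<Longrightarrow> v \<in> {x, b}"
          unfolding adjacent_degree_two_def by metis
        have yV: "y \<in> V" using edge_in_V[OF simple e(2)] by blast
        show ?thesis
        proof (rule flattenable_adjacent_degree_two[OF E2 d e N])
          show "flattenable ({e \<in> E. x \<notin> e \<and> y \<notin> e} \<union> {{a, x}, {b, x}})"
            by (rule IH[OF adjacent_degree_two_minor[OF simple d e]]) (use card_Diff1_less[OF fin(1) yV] in blast)
          fix f assume f: "f \<in> E"
          have "minor_of (V, E) (V, E - {f})" using minor_delete_edges[of "{f}" E V] f by simp
          then show "flattenable (E - {f})" by (rule IH) (use card_Diff1_less[OF fin(2) f] in blast)
        qed
      next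
        case no: False
        show ?thesis
        proof (cases "nearly_three_connected V E")
          case True
          from nearly_three_connected_classification[OF simple True c6 noF noH]
          have "complete_bipartite_33 V E \<or> two_caps V E" by blast
          then show ?thesis
          proof
            assume "complete_bipartite_33 V E"
            then obtain P Q where "P \<inter> Q = {}" "card P = 3" "card Q = 3" "\<forall>e\<in>E. \<exists>p\<in>P. \<exists>q\<in>Q. e = {p, q}"
              unfolding complete_bipartite_33_def by metis
            then show ?thesis using flattenable_K33[of P Q E] by blast
          next
            assume "two_caps V E"
            then obtain a b x c d y where V: "V = {a, b, x, c, d, y}"
              and x: "\<And>v. {x, v} \<in> E \<longleftrightarrow> v = a \<or> v = b" and y: "\<And>v. {y, v} \<in> E \<longleftrightarrow> v = c \<or> v = d"
              unfolding two_caps_def by metis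
            show ?thesis by (rule flattenable_two_triangle_caps[OF V]) (use EV E2 x y in auto)
          qed
        next
          case False
          then obtain A B S where sep: "separation V E A B S" and S: "card S \<le> 2" and cA: "\<not> card A \<le> 1" and cB: "\<not> card B \<le> 1"
            using two unfolding nearly_three_connected_def by blast
          have sets: "A \<union> B \<union> S = V" "A \<inter> B = {}" "A \<inter> S = {}" "B \<inter> S = {}" and nAB: "\<And>a b. a \<in> A \<Longrightarrow> b \<in> B \<Longrightarrow> {a, b} \<notin> E"
            using sep unfolding separation_def by auto
          have ne: "A \<noteq> {}" "B \<noteq> {}" using cA cB by auto
          then have "\<not> card S \<le> 1" using two sep unfolding two_connected_def by blast
          then have "card S = 2" using S by simp
          then obtain a b where ab: "S = {a, b}" "a \<noteq> b" unfolding card_2_iff by blast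
          \<comment> \<open>The part outside \<open>C\<close> together with a triangle over \<open>{a, b}\<close> is a minor with fewer
            vertices, as a single vertex of \<open>C\<close> is kept.\<close>
          have side: "\<exists>x\<in>C. flattenable ({e \<in> E. e \<inter> C = {}} \<union> {{a, b}} \<union> {{a, x}, {b, x}})"
            if CD: "C \<union> D \<union> {a, b} = V" "C \<inter> D = {}" "a \<notin> C" "b \<notin> C" "D \<noteq> {}" "2 \<le> card C" "a \<notin> D" "b \<notin> D"
              and nCD: "\<And>u v. u \<in> C \<Longrightarrow> v \<in> D \<Longrightarrow> {u, v} \<notin> E" for C D
          proof -
            have cl: "v \<in> C \<union> {a, b}" if uv: "u \<in> C" "{u, v} \<in> E" for u v
              using edge_in_V[OF simple uv(2)] nCD[OF uv(1), of v] uv(2) CD(1) by blast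
            have pre: "C \<subseteq> V" "a \<in> V - C" "b \<in> V - C" "V - C - {a, b} \<noteq> {}" using CD by auto
            have "rooted_triangle E C a b \<or> adjacent_degree_two E"
              by (rule rooted_triangle_or_adjacent_degree_two[OF fin(1) two E2 pre(1-3) ab(2) CD(6) pre(4) cl])
            then have "rooted_triangle E C a b" using no by blast
            from rooted_triangle_minor[OF simple pre(1-3) ab(2) this]
            obtain x where x: "x \<in> C" "minor_of (V, E) (insert x (V - C), {e \<in> E. e \<inter> C = {}} \<union> {{a, b}} \<union> {{a, x}, {b, x}})" by blast
            have "card (insert x (V - C)) = card V - card C + 1" using x(1) pre(1) by (simp add: card_Diff_subset)
            moreover have "card C \<le> card V" using pre(1) by (intro card_mono) auto
            ultimately have "card (insert x (V - C)) < card V" using CD(6) by linarith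
            then show ?thesis using IH[OF x(2)] x(1) by blast
          qed
          have abn: "a \<notin> A" "b \<notin> A" "a \<notin> B" "b \<notin> B" using sets ab by auto
          have c2: "2 \<le> card A" "2 \<le> card B" using cA cB by auto
          have "\<exists>x\<in>A. flattenable ({e \<in> E. e \<inter> A = {}} \<union> {{a, b}} \<union> {{a, x}, {b, x}})"
            by (rule side[of A B]) (use sets ab abn ne c2 nAB in auto)
          then obtain x where x: "x \<in> A" "flattenable ({e \<in> E. e \<inter> A = {}} \<union> {{a, b}} \<union> {{a, x}, {b, x}})" by blast
          have "\<exists>x\<in>B. flattenable ({e \<in> E. e \<inter> B = {}} \<union> {{a, b}} \<union> {{a, x}, {b, x}})"
          proof (rule side[of B A])
            show "{u, v} \<notin> E" if "u \<in> B" "v \<in> A" for u v using nAB[OF that(2,1)] by (simp add: insert_commute)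
          qed (use sets ab abn ne c2 in auto)
          then obtain y where y: "y \<in> B" "flattenable ({e \<in> E. e \<inter> B = {}} \<union> {{a, b}} \<union> {{a, y}, {b, y}})" by blast
          have "flattenable (({e \<in> E. e \<inter> A = {}} \<union> {{a, b}}) \<union> ({e \<in> E. e \<inter> B = {}} \<union> {{a, b}}))"
          proof (rule flattenable_glue_pair[OF x(2) y(2), where ?U1.0 = "B \<union> S" and ?U2.0 = "A \<union> S"])
            show "x \<notin> \<Union> ({e \<in> E. e \<inter> A = {}} \<union> {{a, b}})" "y \<notin> \<Union> ({e \<in> E. e \<inter> B = {}} \<union> {{a, b}})"
              using x(1) y(1) abn by auto
            show "(B \<union> S) \<inter> (A \<union> S) \<subseteq> {a, b}" using sets ab by auto
            show "card e = 2" if "e \<in> {e \<in> E. e \<inter> A = {}} \<union> {{a, b}}" for e using that E2 ab(2) by auto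
            show "card e = 2" if "e \<in> {e \<in> E. e \<inter> B = {}} \<union> {{a, b}}" for e using that E2 ab(2) by auto
            show "e \<subseteq> B \<union> S" if "e \<in> {e \<in> E. e \<inter> A = {}} \<union> {{a, b}}" for e
              using that EV[of e] sets(1) ab(1) by blast
            show "e \<subseteq> A \<union> S" if "e \<in> {e \<in> E. e \<inter> B = {}} \<union> {{a, b}}" for e
              using that EV[of e] sets(1) ab(1) by blast
          qed auto
          then show ?thesis by (rule flattenable_mono) (use edge_cases[OF _ sep] in blast)
        qed
      qed
    qed
  qed
qed

theorem theorem5p1:
  fixes E :: "'n::finite set set"
  assumes "simple_graph (UNIV, E)"
  shows "egd E \<le> 2 \<longleftrightarrow>
    \<not> has_minor_iso (UNIV, E) F3 \<and> \<not> has_minor_iso (UNIV, E) H3"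
proof
  assume "egd E \<le> 2"
  then have "flattenable E" by (simp only: egd_le_2_iff_flattenable)
  then show "\<not> has_minor_iso (UNIV, E) F3 \<and> \<not> has_minor_iso (UNIV, E) H3"
    using F3_minor_not_flattenable[OF assms] H3_minor_not_flattenable[OF assms] by auto
next
  assume "\<not> has_minor_iso (UNIV, E) F3 \<and> \<not> has_minor_iso (UNIV, E) H3"
  then have "flattenable E" using flattenable_if_minor_free[OF assms] by blast
  then show "egd E \<le> 2" by (simp only: egd_le_2_iff_flattenable)
qed

end
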